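(* Let $p$ be a prime or the symbol $\infty$ and let $G$ be a finite group. Let $\Omega(G,M^\circ_{\mathscr S})$ be the lattice Burnside ring of $G$ associated to the sublattices $\mathscr S_{\unlhd H}$ of normal subgroups of $H$, for $H\leq G$ (see context). Then $G$ is a $p$-group (where an $\infty$-group means a solvable group) if and only if the number of primitive idempotents of $\Omega(G,M^\circ_{\mathscr S})_{(p)}$ is $|\mathrm C(G)|$, where $\mathrm C(G)$ is a full set of nonconjugate subgroups of $G$ (i.e. a set of representatives of the conjugacy classes of subgroups of $G$).
   Context: Write ${}^gH=gHg^{-1}$. Let $\mathscr S$ be the lattice of subgroups of $G$ ordered by inclusion with $G$ acting by conjugation, and for $H\leq G$ let $\mathscr S_{\unlhd H}$ be the set of normal subgroups of $H$. $M^\circ_{\mathscr S}$ is the functor $H\mapsto\mathscr S_{\unlhd H}$ (a monoid under intersection), with conjugation maps $L\mapsto{}^gL$ and restriction maps $\mathscr S_{\unlhd H}\to\mathscr S_{\unlhd K}$, $L\mapsto L\cap K$, for $K\leq H$. The ring $\Omega(G,M^\circ_{\mathscr S})$ is the free abelian group on symbols $[(G/K)_L]$, one for each $G$-orbit (under simultaneous conjugation) of pairs $(K,L)$ with $L\unlhd K\leq G$ (so $[(G/{}^gK)_{{}^gL}]=[(G/K)_L]$), with multiplication $$[(G/K)_L]\cdot[(G/U)_N]=\sum_{KhU\in K\backslash G/U}[(G/(K\cap{}^hU))_{L\cap{}^hN}].$$ $R_{(p)}=\mathbb Z_{(p)}\otimes_{\mathbb Z}R$ for $p$ prime ($\mathbb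 Z_{(p)}$ the localization of $\mathbb Z$ at $p$), and $R_{(\infty)}=R$. *)

theory Defs
  imports "HOL-Algebra.Algebra" "HOL-Library.Extended_Nat"
begin

subsection \<open>Conjugation and double cosets\<close>

definition conj_set :: "('a, 'b) monoid_scheme \<Rightarrow> 'a \<Rightarrow> 'a set \<Rightarrow> 'a set" where
  "conj_set G g H = g <#\<^bsub>G\<^esub> H #>\<^bsub>G\<^esub> inv\<^bsub>G\<^esub> g"

definition double_cosets :: "('a, 'b) monoid_scheme \<Rightarrow> 'a set \<Rightarrow> 'a set \<Rightarrow> 'a set set" where
  "double_cosets G K U = (\<lambda>h. (K #>\<^bsub>G\<^esub> h) <#>\<^bsub>G\<^esub> U) ` carrier G"

definition full_nonconjugate_subgroups :: "('a, 'b) monoid_scheme \<Rightarrow> 'a set set \<Rightarrow> bool" where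
  "full_nonconjugate_subgroups G C \<longleftrightarrow>
     (\<forall>K\<in>C. subgroup K G) \<and>
     (\<forall>H. subgroup H G \<longrightarrow> (\<exists>!K. K \<in> C \<and> (\<exists>g\<in>carrier G. K = conj_set G g H)))"


subsection \<open>The lattice Burnside ring\<close>

definition normal_pairs :: "('a, 'b) monoid_scheme \<Rightarrow> ('a set \<times> 'a set) set" where
  "normal_pairs G = {(K, L). subgroup K G \<and> L \<lhd> (G\<lparr>carrier := K\<rparr>)}"

definition conj_pair :: "('a, 'b) monoid_scheme \<Rightarrow> 'a \<Rightarrow> 'a set \<times> 'a set \<Rightarrow> 'a set \<times> 'a set" where
  "conj_pair G g = (\<lambda>(K, L). (conj_set G g K, conj_set G g L))"

text \<open>The symbol $[(G/K)_L]$ is the orbit of the pair $(K, L)$.\<close>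

abbreviation pair_class ::
  "('a, 'b) monoid_scheme \<Rightarrow> 'a set \<times> 'a set \<Rightarrow> ('a set \<times> 'a set) set" where
  "pair_class G \<equiv> orbit G (conj_pair G)"

definition meet_pair ::
  "('a, 'b) monoid_scheme \<Rightarrow> 'a \<Rightarrow> 'a set \<times> 'a set \<Rightarrow> 'a set \<times> 'a set \<Rightarrow> 'a set \<times> 'a set" where
  "meet_pair G h = (\<lambda>(K, L) (U, N). (K \<inter> conj_set G h U, L \<inter> conj_set G h N))"

definition pair_mult ::
  "('a, 'b) monoid_scheme \<Rightarrow> 'a set \<times> 'a set \<Rightarrow> 'a set \<times> 'a set \<Rightarrow> ('a set \<times> 'a set) set \<Rightarrow>\<^sub>0 int" where
  "pair_mult G P Q =
     (\<Sum>D\<in>double_cosets G (fst P) (fst Q). frag_of (pair_class G (meet_pair G (SOME h. h \<in> D) P Q)))"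

text \<open>Independence of all choices made here is the lemma \<open>lattice_burnside_mult_basis\<close> below.\<close>

definition class_mult ::
  "('a, 'b) monoid_scheme \<Rightarrow> ('a set \<times> 'a set) set \<Rightarrow> ('a set \<times> 'a set) set
     \<Rightarrow> ('a set \<times> 'a set) set \<Rightarrow>\<^sub>0 int" where
  "class_mult G A B = pair_mult G (SOME P. P \<in> A) (SOME Q. Q \<in> B)"

definition bilinear_extend :: "('a \<Rightarrow> 'b \<Rightarrow> 'c \<Rightarrow>\<^sub>0 int) \<Rightarrow> ('a \<Rightarrow>\<^sub>0 int) \<Rightarrow> ('b \<Rightarrow>\<^sub>0 int) \<Rightarrow> 'c \<Rightarrow>\<^sub>0 int" where
  "bilinear_extend m x y = frag_extend (\<lambda>a. frag_extend (m a) y) x"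

definition lattice_burnside_ring ::
  "('a, 'b) monoid_scheme \<Rightarrow> (('a set \<times> 'a set) set \<Rightarrow>\<^sub>0 int) ring" where
  "lattice_burnside_ring G =
     \<lparr>carrier = carrier (free_Abelian_group (orbits G (normal_pairs G) (conj_pair G))),
      monoid.mult = bilinear_extend (class_mult G),
      one = frag_of (pair_class G (carrier G, carrier G)),
      ring.zero = 0, add = (+)\<rparr>"


subsection \<open>Localization at a prime\<close>

definition int_localized :: "nat \<Rightarrow> rat ring" where
  "int_localized q =
     \<lparr>carrier = {of_int a / of_int b | a b. \<not> int q dvd b},
      monoid.mult = (*), one = 1, ring.zero = 0, add = (+)\<rparr>"

definition integral_monoid_ring :: "('a, 'b) monoid_scheme \<Rightarrow> ('a \<Rightarrow>\<^sub>0 int) ring" where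
  "integral_monoid_ring M =
     \<lparr>carrier = carrier (free_Abelian_group (carrier M)),
      monoid.mult = bilinear_extend (\<lambda>a b. frag_of (a \<otimes>\<^bsub>M\<^esub> b)),
      one = frag_of \<one>\<^bsub>M\<^esub>, ring.zero = 0, add = (+)\<rparr>"

definition tensor_relations ::
  "('a, 'c) ring_scheme \<Rightarrow> ('b, 'd) ring_scheme \<Rightarrow> ('a \<times> 'b \<Rightarrow>\<^sub>0 int) set" where
  "tensor_relations A B =
     {frag_of (a \<oplus>\<^bsub>A\<^esub> a', b) - frag_of (a, b) - frag_of (a', b) | a a' b.
        a \<in> carrier A \<and> a' \<in> carrier A \<and> b \<in> carrier B} \<union>
     {frag_of (a, b \<oplus>\<^bsub>B\<^esub> b') - frag_of (a, b) - frag_of (a, b') | a b b'.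
        a \<in> carrier A \<and> b \<in> carrier B \<and> b' \<in> carrier B}"

text \<open>
  The tensor product of rings over the integers. The product
  $(a \otimes b)(a' \otimes b') = aa' \otimes bb'$ is the one inherited from the integral monoid ring
  of the multiplicative monoid of $A \times B$. The set of relations is stable under multiplication
  by elements $(a, b)$, so the ideal it generates is the additive subgroup it generates.
\<close>

definition tensor_ring ::
  "('a, 'c) ring_scheme \<Rightarrow> ('b, 'd) ring_scheme \<Rightarrow> ('a \<times> 'b \<Rightarrow>\<^sub>0 int) set ring" where
  "tensor_ring A B =
     integral_monoid_ring (A \<times>\<times> B) Quot (Idl\<^bsub>integral_monoid_ring (A \<times>\<times> B)\<^esub> (tensor_relations A B))"


subsection \<open>Primitive idempotents\<close>

definition idempotents :: "('a, 'b) ring_scheme \<Rightarrow> 'a set" where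
  "idempotents R = {e \<in> carrier R. e \<otimes>\<^bsub>R\<^esub> e = e}"

definition primitive_idempotents :: "('a, 'b) ring_scheme \<Rightarrow> 'a set" where
  "primitive_idempotents R =
     {e \<in> idempotents R. e \<noteq> \<zero>\<^bsub>R\<^esub> \<and>
        \<not> (\<exists>f\<in>idempotents R. \<exists>g\<in>idempotents R. f \<noteq> \<zero>\<^bsub>R\<^esub> \<and> g \<noteq> \<zero>\<^bsub>R\<^esub> \<and>
             f \<otimes>\<^bsub>R\<^esub> g = \<zero>\<^bsub>R\<^esub> \<and> g \<otimes>\<^bsub>R\<^esub> f = \<zero>\<^bsub>R\<^esub> \<and> e = f \<oplus>\<^bsub>R\<^esub> g)}"

text \<open>
  The number of primitive idempotents of $R_{(p)}$. The cases are separated only because $R_{(p)}$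
  for a prime \<open>p\<close> and $R_{(\infty)} = R$ have different types.
\<close>

definition num_primitive_idempotents_at :: "enat \<Rightarrow> ('a, 'b) ring_scheme \<Rightarrow> nat" where
  "num_primitive_idempotents_at p R =
     (case p of
        enat q \<Rightarrow> card (primitive_idempotents (tensor_ring (int_localized q) R))
      | \<infinity> \<Rightarrow> card (primitive_idempotents R))"

definition is_p_group :: "enat \<Rightarrow> ('a, 'b) monoid_scheme \<Rightarrow> bool" where
  "is_p_group p G = (case p of enat q \<Rightarrow> (\<exists>n. order G = q ^ n) | \<infinity> \<Rightarrow> solvable G)"


subsection \<open>The multiplication formula\<close>

lemma conj_set_eq: "conj_set G g H = (\<lambda>x. g \<otimes>\<^bsub>G\<^esub> x \<otimes>\<^bsub>G\<^esub> inv\<^bsub>G\<^esub> g) ` H"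
  by (auto simp: conj_set_def l_coset_def r_coset_def)

lemma double_coset_eq:
  "(K #>\<^bsub>G\<^esub> h) <#>\<^bsub>G\<^esub> U = {k \<otimes>\<^bsub>G\<^esub> h \<otimes>\<^bsub>G\<^esub> u | k u. k \<in> K \<and> u \<in> U}"
  by (auto simp: set_mult_def r_coset_def)

context group
begin

lemma cancel_assoc:
  assumes "a \<in> carrier G" "x \<in> carrier G"
  shows "a \<otimes> (inv a \<otimes> x) = x" "inv a \<otimes> (a \<otimes> x) = x"
  using assms by (simp_all add: m_assoc[symmetric])

lemma conj_set_mult:
  assumes "a \<in> carrier G" "b \<in> carrier G" "H \<subseteq> carrier G"
  shows "conj_set G a (conj_set G b H) = conj_set G (a \<otimes> b) H"
proof -
  have "a \<otimes> (b \<otimes> x \<otimes> inv b) \<otimes> inv a = a \<otimes> b \<otimes> x \<otimes> inv (a \<otimes> b)" if "x \<in> H" for x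
    using assms that by (auto simp: m_assoc inv_mult_group subset_iff)
  then show ?thesis
    by (auto simp: conj_set_eq image_image intro!: image_cong)
qed

lemma conj_set_carrier:
  "g \<in> carrier G \<Longrightarrow> H \<subseteq> carrier G \<Longrightarrow> conj_set G g H \<subseteq> carrier G"
  by (auto simp: conj_set_eq)

lemma conj_set_Int:
  assumes "g \<in> carrier G" "A \<subseteq> carrier G" "B \<subseteq> carrier G"
  shows "conj_set G g (A \<inter> B) = conj_set G g A \<inter> conj_set G g B"
proof -
  have "inj_on (\<lambda>x. g \<otimes> x \<otimes> inv g) (carrier G)"
    using assms(1) by (intro inj_onI) simp
  then show ?thesis
    unfolding conj_set_eq using assms(2,3) by (rule inj_on_image_Int)
qed

lemma conj_set_fixed:
  assumes "subgroup K G" "L \<lhd> (G\<lparr>carrier := K\<rparr>)" "k \<in> K"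
  shows "conj_set G k L = L"
proof -
  interpret K: group "G\<lparr>carrier := K\<rparr>"
    using assms(1) by (rule subgroup.subgroup_is_group) (rule is_group)
  interpret L: normal L "G\<lparr>carrier := K\<rparr>"
    by fact
  have LK: "L \<subseteq> K" using L.subset by simp
  have KG: "K \<subseteq> carrier G" using assms(1) by (rule subgroup.subset)
  have sub: "conj_set G j L \<subseteq> L" if "j \<in> K" for j
  proof -
    have "inv\<^bsub>G\<lparr>carrier := K\<rparr>\<^esub> j = inv j"
      using assms(1) that by (simp add: m_inv_consistent)
    then show ?thesis
      using L.inv_op_closed2[of j] that by (auto simp: conj_set_eq)
  qed
  have kG: "k \<in> carrier G" and LG: "L \<subseteq> carrier G" using assms(3) KG LK by auto
  have "conj_set G (inv k) L \<subseteq> L"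
    using sub assms(1,3) by (simp add: subgroup.m_inv_closed)
  then have "conj_set G k (conj_set G (inv k) L) \<subseteq> conj_set G k L"
    unfolding conj_set_eq[of G k] by (rule image_mono)
  moreover have "conj_set G k (conj_set G (inv k) L) = conj_set G \<one> L"
    using kG LG by (simp add: conj_set_mult)
  moreover have "conj_set G \<one> L = L"
    using LG by (auto simp: conj_set_eq subset_iff image_iff)
  ultimately show ?thesis using sub[OF assms(3)] by auto
qed

lemma conj_set_self: "subgroup K G \<Longrightarrow> k \<in> K \<Longrightarrow> conj_set G k K = K"
  using conj_set_fixed[of K K k] group.normal_self[OF subgroup.subgroup_is_group[OF _ is_group], of K]
  by simp

lemma normal_pairs_subset:
  assumes "P \<in> normal_pairs G"
  shows "fst P \<subseteq> carrier G" "snd P \<subseteq> carrier G"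
proof -
  obtain K L where P: "P = (K, L)" "subgroup K G" "L \<lhd> (G\<lparr>carrier := K\<rparr>)"
    using assms by (auto simp: normal_pairs_def)
  then interpret L: normal L "G\<lparr>carrier := K\<rparr>" by simp
  show "fst P \<subseteq> carrier G" "snd P \<subseteq> carrier G"
    using P L.subset subgroup.subset[OF P(2)] by auto
qed

lemma conj_pair_mult:
  assumes "a \<in> carrier G" "b \<in> carrier G" "fst P \<subseteq> carrier G" "snd P \<subseteq> carrier G"
  shows "conj_pair G a (conj_pair G b P) = conj_pair G (a \<otimes> b) P"
  using assms by (auto simp: conj_pair_def conj_set_mult split: prod.splits)

lemma pair_class_conj:
  assumes "a \<in> carrier G" "fst P \<subseteq> carrier G" "snd P \<subseteq> carrier G"
  shows "pair_class G (conj_pair G a P) = pair_class G P"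
proof -
  have "conj_pair G g (conj_pair G a P) = conj_pair G (g \<otimes> a) P" if "g \<in> carrier G" for g
    using assms that by (simp add: conj_pair_mult)
  moreover have "conj_pair G g P = conj_pair G (g \<otimes> inv a) (conj_pair G a P)" if "g \<in> carrier G" for g
    using assms that by (simp add: conj_pair_mult m_assoc)
  ultimately show ?thesis
    using assms(1) unfolding orbit_def by (smt (verit, best) Collect_cong inv_closed m_closed)
qed

lemma conj_meet_pair:
  assumes "a \<in> carrier G" "b \<in> carrier G" "h \<in> carrier G"
    and "P \<in> normal_pairs G" "Q \<in> normal_pairs G"
  shows "meet_pair G h (conj_pair G a P) (conj_pair G b Q)
       = conj_pair G a (meet_pair G (inv a \<otimes> h \<otimes> b) P Q)"
proof -
  have *: "conj_set G a A \<inter> conj_set G h (conj_set G b B)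
         = conj_set G a (A \<inter> conj_set G (inv a \<otimes> h \<otimes> b) B)"
    if "A \<subseteq> carrier G" "B \<subseteq> carrier G" for A B
  proof -
    have "a \<otimes> (inv a \<otimes> h \<otimes> b) = h \<otimes> b"
      using assms by (simp add: m_assoc cancel_assoc)
    then show ?thesis
      using assms that by (simp add: conj_set_Int conj_set_carrier conj_set_mult)
  qed
  show ?thesis
    using *[OF normal_pairs_subset(1)[OF assms(4)] normal_pairs_subset(1)[OF assms(5)]]
      *[OF normal_pairs_subset(2)[OF assms(4)] normal_pairs_subset(2)[OF assms(5)]]
    by (auto simp: meet_pair_def conj_pair_def split: prod.splits)
qed

lemma meet_pair_subset:
  assumes "P \<in> normal_pairs G"
  shows "fst (meet_pair G h P Q) \<subseteq> carrier G" "snd (meet_pair G h P Q) \<subseteq> carrier G"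
  using normal_pairs_subset[OF assms] by (auto simp: meet_pair_def split: prod.splits)

lemma pair_class_meet_conj:
  assumes "a \<in> carrier G" "b \<in> carrier G" "h \<in> carrier G"
    and "P \<in> normal_pairs G" "Q \<in> normal_pairs G"
  shows "pair_class G (meet_pair G h (conj_pair G a P) (conj_pair G b Q))
       = pair_class G (meet_pair G (inv a \<otimes> h \<otimes> b) P Q)"
  using assms by (simp add: conj_meet_pair pair_class_conj meet_pair_subset)

lemma pair_class_meet_double_coset:
  assumes "P \<in> normal_pairs G" "Q \<in> normal_pairs G" "D \<in> double_cosets G (fst P) (fst Q)"
    and "x \<in> D" "y \<in> D"
  shows "pair_class G (meet_pair G x P Q) = pair_class G (meet_pair G y P Q)"
proof -
  have P: "subgroup (fst P) G" "snd P \<lhd> (G\<lparr>carrier := fst P\<rparr>)"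
    and Q: "subgroup (fst Q) G" "snd Q \<lhd> (G\<lparr>carrier := fst Q\<rparr>)"
    using assms(1,2) by (auto simp: normal_pairs_def)
  obtain h where h: "h \<in> carrier G" "D = (fst P #> h) <#> fst Q"
    using assms(3) by (auto simp: double_cosets_def)
  have "pair_class G (meet_pair G z P Q) = pair_class G (meet_pair G h P Q)" if "z \<in> D" for z
  proof -
    obtain k u where ku: "k \<in> fst P" "u \<in> fst Q" "z = k \<otimes> h \<otimes> u"
    proof -
      have "z \<in> {k \<otimes> h \<otimes> u |k u. k \<in> fst P \<and> u \<in> fst Q}"
        using \<open>z \<in> D\<close> by (simp only: h(2) double_coset_eq)
      then show ?thesis using that by (elim CollectE exE conjE)
    qed
    have kG: "k \<in> carrier G" and uG: "u \<in> carrier G"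
      using ku normal_pairs_subset[OF assms(1)] normal_pairs_subset[OF assms(2)] by auto
    have iu: "inv u \<in> fst Q" using Q(1) ku(2) by (rule subgroup.m_inv_closed)
    have fixP: "conj_pair G k P = P"
      using P ku(1) by (auto simp: conj_pair_def conj_set_self conj_set_fixed split: prod.splits)
    have fixQ: "conj_pair G (inv u) Q = Q"
      using Q iu by (auto simp: conj_pair_def conj_set_self conj_set_fixed split: prod.splits)
    have "inv k \<otimes> (k \<otimes> h \<otimes> u) \<otimes> inv u = h"
      using kG uG h(1) by (simp add: m_assoc cancel_assoc)
    then show ?thesis
      using pair_class_meet_conj[of k "inv u" "k \<otimes> h \<otimes> u" P Q] kG uG h(1) assms(1,2) ku(3) fixP fixQ
      by simp
  qed
  then show ?thesis using assms(4,5) by simp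
qed

lemma double_coset_rep:
  assumes "P \<in> normal_pairs G" "Q \<in> normal_pairs G" "D \<in> double_cosets G (fst P) (fst Q)"
  shows "(SOME h. h \<in> D) \<in> D" "D \<subseteq> carrier G"
proof -
  have P: "subgroup (fst P) G" and Q: "subgroup (fst Q) G"
    using assms(1,2) by (auto simp: normal_pairs_def)
  obtain h where h: "h \<in> carrier G" "D = (fst P #> h) <#> fst Q"
    using assms(3) by (auto simp: double_cosets_def)
  have "h = \<one> \<otimes> h \<otimes> \<one>" using h by simp
  then have "\<exists>k u. h = k \<otimes> h \<otimes> u \<and> k \<in> fst P \<and> u \<in> fst Q"
    using subgroup.one_closed[OF P] subgroup.one_closed[OF Q] by (intro exI conjI)
  then have "h \<in> D"
    by (simp only: h(2) double_coset_eq mem_Collect_eq)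
  then show "(SOME h. h \<in> D) \<in> D" by (rule someI)
  show "D \<subseteq> carrier G"
    using h normal_pairs_subset(1)[OF assms(1)] normal_pairs_subset(1)[OF assms(2)]
    by (auto simp: double_coset_eq)
qed

lemma pair_mult_reps:
  assumes "P \<in> normal_pairs G" "Q \<in> normal_pairs G"
    and "\<And>D. D \<in> double_cosets G (fst P) (fst Q) \<Longrightarrow> r D \<in> D"
  shows "pair_mult G P Q
       = (\<Sum>D\<in>double_cosets G (fst P) (fst Q). frag_of (pair_class G (meet_pair G (r D) P Q)))"
  unfolding pair_mult_def
proof (intro sum.cong refl arg_cong[where f = frag_of])
  fix D assume D: "D \<in> double_cosets G (fst P) (fst Q)"
  show "pair_class G (meet_pair G (SOME h. h \<in> D) P Q) = pair_class G (meet_pair G (r D) P Q)"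
    using assms(1,2) D double_coset_rep(1)[OF assms(1,2) D] assms(3)[OF D]
    by (rule pair_class_meet_double_coset)
qed

lemma normal_pairs_conj:
  assumes "a \<in> carrier G" "P \<in> normal_pairs G"
  shows "conj_pair G a P \<in> normal_pairs G"
proof -
  obtain K L where P: "P = (K, L)" "subgroup K G" "L \<lhd> (G\<lparr>carrier := K\<rparr>)"
    using assms(2) by (auto simp: normal_pairs_def)
  define f where "f = (\<lambda>x. a \<otimes> x \<otimes> inv a)"
  have f_mult: "f x \<otimes> f y = f (x \<otimes> y)" if "x \<in> carrier G" "y \<in> carrier G" for x y
    using that assms(1) by (simp add: f_def m_assoc cancel_assoc)
  have f_hom: "group_hom G G f"
    using assms(1) is_group f_mult by (auto simp: group_hom_def group_hom_axioms_def hom_def f_def)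
  interpret K: group "G\<lparr>carrier := K\<rparr>"
    using P(2) by (rule subgroup.subgroup_is_group) (rule is_group)
  interpret L: normal L "G\<lparr>carrier := K\<rparr>" by fact
  have KG: "K \<subseteq> carrier G" using P(2) by (rule subgroup.subset)
  have LG: "subgroup L G"
    using P(2) L.subgroup_axioms incl_subgroup by blast
  have sK: "subgroup (f ` K) G" and sL: "subgroup (f ` L) G"
    using group_hom.subgroup_img_is_subgroup[OF f_hom] P(2) LG by auto
  have "f ` L \<lhd> (G\<lparr>carrier := f ` K\<rparr>)"
  proof (rule group.normal_invI)
    show "group (G\<lparr>carrier := f ` K\<rparr>)"
      using sK by (rule subgroup.subgroup_is_group) (rule is_group)
    show "subgroup (f ` L) (G\<lparr>carrier := f ` K\<rparr>)"
      using sL sK L.subset by (intro subgroup_incl) auto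
    fix x h assume x: "x \<in> carrier (G\<lparr>carrier := f ` K\<rparr>)" and h: "h \<in> f ` L"
    obtain y l where yl: "x = f y" "y \<in> K" "h = f l" "l \<in> L" using x h by auto
    have G: "y \<in> carrier G" "l \<in> carrier G" using yl KG L.subset by auto
    have "inv\<^bsub>G\<lparr>carrier := f ` K\<rparr>\<^esub> x = inv x"
      using sK yl by (simp add: m_inv_consistent)
    moreover have "x \<otimes> h \<otimes> inv x = f (y \<otimes> l \<otimes> inv y)"
      unfolding yl
      using group_hom.hom_inv[OF f_hom G(1)] f_mult[OF G] f_mult[OF m_closed[OF G] inv_closed[OF G(1)]]
      by simp
    moreover have "y \<otimes> l \<otimes> inv y \<in> L"
      using conj_set_fixed[OF P(2,3) yl(2)] yl(4) by (auto simp: conj_set_eq)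
    ultimately show "x \<otimes>\<^bsub>G\<lparr>carrier := f ` K\<rparr>\<^esub> h \<otimes>\<^bsub>G\<lparr>carrier := f ` K\<rparr>\<^esub> inv\<^bsub>G\<lparr>carrier := f ` K\<rparr>\<^esub> x \<in> f ` L"
      by simp
  qed
  then show ?thesis
    using sK by (simp add: P(1) normal_pairs_def conj_pair_def conj_set_eq f_def)
qed

lemma pair_mult_conj:
  assumes P: "P \<in> normal_pairs G" and Q: "Q \<in> normal_pairs G"
    and a: "a \<in> carrier G" and b: "b \<in> carrier G"
  shows "pair_mult G (conj_pair G a P) (conj_pair G b Q) = pair_mult G P Q"
proof -
  let ?P = "conj_pair G a P" and ?Q = "conj_pair G b Q"
  define t where "t = (\<lambda>x. a \<otimes> x \<otimes> inv b)"
  define s where "s = (\<lambda>x. inv a \<otimes> x \<otimes> b)"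
  have st: "s (t x) = x" "t (s x) = x" if "x \<in> carrier G" for x
    using that a b by (simp_all add: s_def t_def m_assoc cancel_assoc)
  have t_closed: "t x \<in> carrier G" and s_closed: "s x \<in> carrier G" if "x \<in> carrier G" for x
    using that a b by (simp_all add: s_def t_def)
  have PG: "fst P \<subseteq> carrier G" and QG: "fst Q \<subseteq> carrier G"
    using normal_pairs_subset(1) P Q by auto
  have key: "t ` ((fst P #> h) <#> fst Q) = (fst ?P #> t h) <#> fst ?Q" if h: "h \<in> carrier G" for h
  proof -
    have e: "t (k \<otimes> h \<otimes> u) = (a \<otimes> k \<otimes> inv a) \<otimes> t h \<otimes> (b \<otimes> u \<otimes> inv b)"
      if "k \<in> fst P" "u \<in> fst Q" for k u
      using that PG QG a b h by (simp add: t_def m_assoc cancel_assoc subset_iff)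
    have "fst ?P = (\<lambda>x. a \<otimes> x \<otimes> inv a) ` fst P" "fst ?Q = (\<lambda>x. b \<otimes> x \<otimes> inv b) ` fst Q"
      by (auto simp: conj_pair_def conj_set_eq split: prod.splits)
    then have "(fst ?P #> t h) <#> fst ?Q
        = {(a \<otimes> k \<otimes> inv a) \<otimes> t h \<otimes> (b \<otimes> u \<otimes> inv b) | k u. k \<in> fst P \<and> u \<in> fst Q}"
      by (auto simp: double_coset_eq)
    also have "\<dots> = {t (k \<otimes> h \<otimes> u) | k u. k \<in> fst P \<and> u \<in> fst Q}"
      using e by (metis (no_types, lifting))
    also have "\<dots> = t ` ((fst P #> h) <#> fst Q)"
      by (auto simp: double_coset_eq)
    finally show ?thesis ..
  qed
  have dc: "D \<subseteq> carrier G" if "D \<in> double_cosets G (fst P) (fst Q)" for D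
    using double_coset_rep(2)[OF P Q that] .
  have bij: "bij_betw ((`) t) (double_cosets G (fst P) (fst Q)) (double_cosets G (fst ?P) (fst ?Q))"
  proof (rule bij_betw_imageI)
    show "inj_on ((`) t) (double_cosets G (fst P) (fst Q))"
    proof (rule inj_on_subset[OF inj_on_image_Pow])
      show "inj_on t (carrier G)" using st(1) by (rule inj_on_inverseI)
      show "double_cosets G (fst P) (fst Q) \<subseteq> Pow (carrier G)" using dc by auto
    qed
    have "t ` carrier G = carrier G"
    proof (intro equalityI subsetI)
      fix x assume "x \<in> carrier G"
      then show "x \<in> t ` carrier G" using st(2)[of x] s_closed[of x] by (metis imageI)
    qed (auto simp: t_closed)
    moreover have "(`) t ` double_cosets G (fst P) (fst Q)
        = (\<lambda>h. (fst ?P #> h) <#> fst ?Q) ` t ` carrier G"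
      unfolding double_cosets_def image_image using key by (intro image_cong) auto
    ultimately show "(`) t ` double_cosets G (fst P) (fst Q) = double_cosets G (fst ?P) (fst ?Q)"
      by (simp add: double_cosets_def)
  qed
  define r where "r = (\<lambda>D. t (SOME h. h \<in> s ` D))"
  have sD: "s ` t ` D = D" if "D \<in> double_cosets G (fst P) (fst Q)" for D
  proof -
    have "s ` t ` D = (\<lambda>x. x) ` D"
      unfolding image_image using st(1) dc[OF that] by (intro image_cong) auto
    then show ?thesis by simp
  qed
  have r: "r (t ` D) = t (SOME h. h \<in> D)" if "D \<in> double_cosets G (fst P) (fst Q)" for D
    using sD[OF that] by (simp add: r_def)
  have "pair_mult G ?P ?Q
      = (\<Sum>D\<in>double_cosets G (fst ?P) (fst ?Q). frag_of (pair_class G (meet_pair G (r D) ?P ?Q)))"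
  proof (rule pair_mult_reps)
    fix D assume "D \<in> double_cosets G (fst ?P) (fst ?Q)"
    then obtain E where E: "E \<in> double_cosets G (fst P) (fst Q)" "D = t ` E"
      using bij_betw_imp_surj_on[OF bij, symmetric] by (metis imageE)
    then show "r D \<in> D" using r[OF E(1)] imageI[OF double_coset_rep(1)[OF P Q E(1)], of t] by simp
  qed (rule normal_pairs_conj[OF a P] normal_pairs_conj[OF b Q])+
  also have "\<dots> = (\<Sum>D\<in>double_cosets G (fst P) (fst Q).
      frag_of (pair_class G (meet_pair G (r (t ` D)) ?P ?Q)))"
    using sum.reindex_bij_betw[OF bij, symmetric] .
  also have "\<dots> = pair_mult G P Q"
    unfolding pair_mult_def
  proof (intro sum.cong refl arg_cong[where f = frag_of])
    fix D assume D: "D \<in> double_cosets G (fst P) (fst Q)"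
    let ?h = "SOME h. h \<in> D"
    have h: "?h \<in> carrier G" using double_coset_rep[OF P Q D] by auto
    have "pair_class G (meet_pair G (t ?h) ?P ?Q) = pair_class G (meet_pair G (s (t ?h)) P Q)"
      unfolding s_def by (rule pair_class_meet_conj[OF a b t_closed[OF h] P Q])
    then show "pair_class G (meet_pair G (r (t ` D)) ?P ?Q) = pair_class G (meet_pair G ?h P Q)"
      using st(1)[OF h] r[OF D] by simp
  qed
  finally show ?thesis .
qed

lemma pair_class_rep:
  assumes "P \<in> normal_pairs G"
  obtains a where "a \<in> carrier G" "(SOME R. R \<in> pair_class G P) = conj_pair G a P"
proof -
  have "conj_pair G \<one> P \<in> pair_class G P" by (auto simp: orbit_def)
  then have "(SOME R. R \<in> pair_class G P) \<in> pair_class G P" by (rule someI)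
  then show ?thesis using that by (auto simp: orbit_def)
qed

theorem lattice_burnside_mult_basis:
  assumes "(K, L) \<in> normal_pairs G" "(U, N) \<in> normal_pairs G"
    and "\<And>D. D \<in> double_cosets G K U \<Longrightarrow> r D \<in> D"
  shows "frag_of (pair_class G (K, L)) \<otimes>\<^bsub>lattice_burnside_ring G\<^esub> frag_of (pair_class G (U, N))
       = (\<Sum>D\<in>double_cosets G K U.
            frag_of (pair_class G (K \<inter> conj_set G (r D) U, L \<inter> conj_set G (r D) N)))"
proof -
  have "class_mult G (pair_class G (K, L)) (pair_class G (U, N)) = pair_mult G (K, L) (U, N)"
    unfolding class_mult_def using assms(1,2)
    by (metis pair_class_rep pair_mult_conj)
  then show ?thesis
    using pair_mult_reps[OF assms(1,2), of r] assms(3)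
    by (simp add: lattice_burnside_ring_def bilinear_extend_def meet_pair_def)
qed

end

end

theory Submission
  imports Defs
begin

text \<open>
  Regard the symbol $[(G/K)_L]$ as the $G$-set $G/K$ in which the point $gK$ carries the label
  $gLg^{-1}$. Products of symbols are products of $G$-sets, with labels intersected. For every pair
  $M \unlhd H$ the mark at $(H, M)$ counts the points that are fixed by $H$ and whose label contains
  $M$; it is multiplicative, and since the table of marks is triangular for inclusion of pairs, the
  marks together embed the ring into the integer-valued functions on pairs (\<open>ghost_mult\<close>,
  \<open>ghost_injective\<close>). Likewise $R_{(p)}$ is embedded into the rational-valued functions, with image
  the functions $b^{-1}\varphi(x)$, where $x$ lies in the ring and $p \nmid b$. So idempotents are
  indicator functions of certain sets of pairs, their supports, and primitive idempotents are the
  minimal supports (\<open>card_primitive_idempotents\<close>).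

  The image of the marks is cut out by the congruences that the orbit counting lemma yields for the
  action of the stabilizer of $(H, M)$ on the points counted at $(H, M)$ (\<open>image_criterion\<close>). These
  congruences compare $(H, M)$ with pairs that have the same second component. Hence for each
  subgroup $L$ the pairs whose second component is conjugate to $L$ form a support. The set of pairs
  is thus partitioned into $|\mathrm C(G)|$ supports, and the number of primitive idempotents is
  $|\mathrm C(G)|$ exactly if none of these splits further.

  If $G$ is a $p$-group, then $H/M$ acts on the points whose label contains $M$, so the marks at
  $(H, M)$ and $(M, M)$ are congruent modulo $p$, and a support contains both pairs or none of them.
  If $G$ is solvable and $M \neq H$, some maximal subgroup $K$ of $H$ is normal and contains $M$; the marks
  at $(H, M)$ and $(K, M)$ are then congruent modulo $|H : K|$, and one descends to $(M, M)$.

  Conversely, suppose that $G$ is not a $p$-group. The pairs $(H, 1)$ form one of the blocks above,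
  and it is enough to find a support that contains $(1, 1)$ but not $(G, 1)$. For a prime $p$ take the
  pairs $(H, 1)$ with $H$ a $p$-group: if $P$ is a Sylow $p$-subgroup, the marks of $[(G/P)_1]$ are
  prime to $p$ at these pairs and zero at all others, so that a polynomial in this symbol without
  constant term is an idempotent multiplied by a number prime to $p$ (\<open>p_subgroups_support\<close>).
  For $p = \infty$ take the pairs $(H, 1)$ with $H$ solvable: adjoining to $H$ an element that
  normalizes $H$ does not affect solvability, so the congruences hold (\<open>solvable_idempotent\<close>).
\<close>

section \<open>Bilinear extension\<close>

lemma frag_extend_diff_fun:
  fixes f g :: "'a \<Rightarrow> 'c \<Rightarrow>\<^sub>0 int"
  shows "frag_extend (\<lambda>a. f a - g a) x = frag_extend f x - frag_extend g x"
proof -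
  have "frag_cmul c (u - v) = frag_cmul c u - frag_cmul c v" for c and u v :: "'c \<Rightarrow>\<^sub>0 int"
    by (rule poly_mapping_eqI) (simp add: lookup_minus right_diff_distrib)
  then show ?thesis by (simp add: frag_extend_def sum_subtractf)
qed

lemma bilinear_extend_simps:
  "bilinear_extend m 0 y = 0" "bilinear_extend m x 0 = 0"
  "bilinear_extend m (x - x') y = bilinear_extend m x y - bilinear_extend m x' y"
  "bilinear_extend m x (y - y') = bilinear_extend m x y - bilinear_extend m x y'"
  "bilinear_extend m (frag_of a) (frag_of b) = m a b"
  by (simp_all add: bilinear_extend_def frag_extend_diff frag_extend_diff_fun)
    (simp add: frag_extend_def)

lemma bilinear_extend_add:
  "bilinear_extend m (x + x') y = bilinear_extend m x y + bilinear_extend m x' y"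
  "bilinear_extend m x (y + y') = bilinear_extend m x y + bilinear_extend m x y'"
  using bilinear_extend_simps(3)[of m x "0 - x'" y] bilinear_extend_simps(3)[of m 0 x' y]
    bilinear_extend_simps(4)[of m x y "0 - y'"] bilinear_extend_simps(4)[of m x 0 y']
  by (simp_all add: bilinear_extend_simps)

lemma keys_bilinear_extend:
  assumes "\<And>a b. a \<in> Poly_Mapping.keys x \<Longrightarrow> b \<in> Poly_Mapping.keys y \<Longrightarrow> Poly_Mapping.keys (m a b) \<subseteq> S"
  shows "Poly_Mapping.keys (bilinear_extend m x y) \<subseteq> S"
proof -
  have "Poly_Mapping.keys (frag_extend (m a) y) \<subseteq> S" if "a \<in> Poly_Mapping.keys x" for a
    using keys_frag_extend[of "m a" y] assms[OF that] by blast
  then show ?thesis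
    unfolding bilinear_extend_def using keys_frag_extend[of "\<lambda>a. frag_extend (m a) y" x] by blast
qed

section \<open>Atoms\<close>

text \<open>
  The minimal elements of a family of sets that is closed under relative complements; the wording
  follows the definition of a primitive idempotent.
\<close>

definition atoms :: "'i set set \<Rightarrow> 'i set set" where
  "atoms \<A> = {S \<in> \<A>. S \<noteq> {} \<and>
     \<not> (\<exists>T\<in>\<A>. \<exists>U\<in>\<A>. T \<noteq> {} \<and> U \<noteq> {} \<and> T \<inter> U = {} \<and> S = T \<union> U)}"

lemma atoms_subset: "atoms \<A> \<subseteq> \<A>"
  by (auto simp: atoms_def)

lemma not_atom:
  "T \<in> \<A> \<Longrightarrow> U \<in> \<A> \<Longrightarrow> T \<noteq> {} \<Longrightarrow> U \<noteq> {} \<Longrightarrow> T \<inter> U = {} \<Longrightarrow> T \<union> U \<notin> atoms \<A>"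
  by (auto simp: atoms_def)

text \<open>
  In functions with values in a domain the idempotents are the indicator functions. Orthogonality of
  idempotents becomes disjointness, and a sum of orthogonal idempotents becomes a union.
\<close>

lemma card_primitive_idempotents:
  fixes \<Theta> :: "'r \<Rightarrow> 'i \<Rightarrow> 'c::idom" and R (structure)
  assumes inj: "\<And>x y. x \<in> carrier R \<Longrightarrow> y \<in> carrier R \<Longrightarrow> (\<And>i. i \<in> I \<Longrightarrow> \<Theta> x i = \<Theta> y i) \<Longrightarrow> x = y"
    and mult: "\<And>x y. x \<in> carrier R \<Longrightarrow> y \<in> carrier R \<Longrightarrow> x \<otimes> y \<in> carrier R"
      "\<And>x y i. x \<in> carrier R \<Longrightarrow> y \<in> carrier R \<Longrightarrow> i \<in> I \<Longrightarrow> \<Theta> (x \<otimes> y) i = \<Theta> x i * \<Theta> y i"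
    and add: "\<And>x y. x \<in> carrier R \<Longrightarrow> y \<in> carrier R \<Longrightarrow> x \<oplus> y \<in> carrier R"
      "\<And>x y i. x \<in> carrier R \<Longrightarrow> y \<in> carrier R \<Longrightarrow> i \<in> I \<Longrightarrow> \<Theta> (x \<oplus> y) i = \<Theta> x i + \<Theta> y i"
    and zero: "\<zero> \<in> carrier R" "\<And>i. i \<in> I \<Longrightarrow> \<Theta> \<zero> i = 0"
  shows "card (primitive_idempotents R)
       = card (atoms {S. S \<subseteq> I \<and> (\<exists>x\<in>carrier R. \<forall>i\<in>I. \<Theta> x i = of_bool (i \<in> S))})"
    (is "_ = card (atoms ?\<A>)")
proof -
  define supp where "supp = (\<lambda>e. {i \<in> I. \<Theta> e i = 1})"
  have val: "\<Theta> e i = of_bool (i \<in> supp e)" if "e \<in> idempotents R" "i \<in> I" for e i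
  proof -
    have "\<Theta> e i * \<Theta> e i = \<Theta> e i" using that mult(2)[of e e i] by (simp add: idempotents_def)
    then have "\<Theta> e i * (\<Theta> e i - 1) = 0" by (simp add: algebra_simps)
    then show ?thesis using that by (auto simp: supp_def)
  qed
  have carr: "e \<in> carrier R" if "e \<in> idempotents R" for e using that by (simp add: idempotents_def)
  have inj_supp: "e = f" if "e \<in> idempotents R" "f \<in> idempotents R" "supp e = supp f" for e f
    using inj[OF carr[OF that(1)] carr[OF that(2)]] val[OF that(1)] val[OF that(2)] that(3) by simp
  have suppA: "supp e \<in> ?\<A>" if "e \<in> idempotents R" for e
    using val[OF that] carr[OF that] by (auto simp: supp_def)
  have surj: "\<exists>e\<in>idempotents R. supp e = S" if S: "S \<in> ?\<A>" for S
  proof -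
    obtain x where x: "x \<in> carrier R" "\<And>i. i \<in> I \<Longrightarrow> \<Theta> x i = of_bool (i \<in> S)" "S \<subseteq> I"
      using S by blast
    have "x \<otimes> x = x" using x mult by (intro inj) auto
    moreover have "supp x = S" using x by (auto simp: supp_def)
    ultimately show ?thesis using x(1) by (auto simp: idempotents_def)
  qed
  have zero_idem: "\<zero> \<in> idempotents R"
    using zero mult by (auto simp: idempotents_def intro!: inj)
  have "supp \<zero> = {}" using zero(2) by (auto simp: supp_def)
  then have supp_zero: "e = \<zero> \<longleftrightarrow> supp e = {}" if "e \<in> idempotents R" for e
    using inj_supp[OF that zero_idem] by auto
  have orth: "e \<otimes> f = \<zero> \<longleftrightarrow> supp e \<inter> supp f = {}"
    if ef: "e \<in> idempotents R" "f \<in> idempotents R" for e f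
  proof
    assume *: "e \<otimes> f = \<zero>"
    have "i \<notin> supp e \<inter> supp f" for i
    proof
      assume i: "i \<in> supp e \<inter> supp f"
      then have "\<Theta> (e \<otimes> f) i = 1" using mult(2) carr ef by (simp add: supp_def)
      then show False using * zero(2) i by (auto simp: supp_def)
    qed
    then show "supp e \<inter> supp f = {}" by blast
  next
    assume "supp e \<inter> supp f = {}"
    then show "e \<otimes> f = \<zero>"
      using val[OF ef(1)] val[OF ef(2)] mult carr[OF ef(1)] carr[OF ef(2)] zero by (intro inj) auto
  qed
  have sum: "e = f \<oplus> g \<longleftrightarrow> supp e = supp f \<union> supp g"
    if efg: "e \<in> idempotents R" "f \<in> idempotents R" "g \<in> idempotents R" and "supp f \<inter> supp g = {}" for e f g
  proof -
    have v: "\<Theta> (f \<oplus> g) i = of_bool (i \<in> supp f \<union> supp g)" if "i \<in> I" for i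
      using val[OF efg(2) that] val[OF efg(3) that] add(2) carr efg that \<open>supp f \<inter> supp g = {}\<close> by auto
    have "supp (f \<oplus> g) = supp f \<union> supp g" using v by (auto simp: supp_def)
    moreover have "e = f \<oplus> g" if "supp e = supp f \<union> supp g"
      using v val[OF efg(1)] that carr efg add(1) by (intro inj) auto
    ultimately show ?thesis by auto
  qed
  have prim: "e \<in> primitive_idempotents R \<longleftrightarrow> supp e \<in> atoms ?\<A>" if e: "e \<in> idempotents R" for e
  proof
    assume p: "e \<in> primitive_idempotents R"
    have "\<not> (\<exists>T\<in>?\<A>. \<exists>U\<in>?\<A>. T \<noteq> {} \<and> U \<noteq> {} \<and> T \<inter> U = {} \<and> supp e = T \<union> U)"
    proof
      assume "\<exists>T\<in>?\<A>. \<exists>U\<in>?\<A>. T \<noteq> {} \<and> U \<noteq> {} \<and> T \<inter> U = {} \<and> supp e = T \<union> U"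
      then obtain T U where TU: "T \<in> ?\<A>" "U \<in> ?\<A>" "T \<noteq> {}" "U \<noteq> {}" "T \<inter> U = {}" "supp e = T \<union> U" by blast
      obtain f g where fg: "f \<in> idempotents R" "supp f = T" "g \<in> idempotents R" "supp g = U"
        using surj[OF TU(1)] surj[OF TU(2)] by blast
      have "f \<noteq> \<zero> \<and> g \<noteq> \<zero> \<and> f \<otimes> g = \<zero> \<and> g \<otimes> f = \<zero> \<and> e = f \<oplus> g"
        using supp_zero orth sum fg TU e by (simp add: Int_commute)
      then show False using p fg by (auto simp: primitive_idempotents_def)
    qed
    moreover have "supp e \<noteq> {}" using p supp_zero[OF e] by (simp add: primitive_idempotents_def)
    ultimately show "supp e \<in> atoms ?\<A>" using suppA[OF e] unfolding atoms_def by blast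
  next
    assume a: "supp e \<in> atoms ?\<A>"
    have "False" if fg: "f \<in> idempotents R" "g \<in> idempotents R" "f \<noteq> \<zero>" "g \<noteq> \<zero>" "f \<otimes> g = \<zero>" "e = f \<oplus> g" for f g
    proof -
      have "supp f \<noteq> {}" "supp g \<noteq> {}" "supp f \<inter> supp g = {}" using supp_zero orth fg by auto
      moreover from this have "supp e = supp f \<union> supp g" using sum[OF e fg(1,2)] fg(6) by simp
      ultimately show False using a suppA[OF fg(1)] suppA[OF fg(2)] unfolding atoms_def by blast
    qed
    moreover have "e \<noteq> \<zero>" using a supp_zero[OF e] by (auto simp: atoms_def)
    ultimately show "e \<in> primitive_idempotents R" using e unfolding primitive_idempotents_def by blast
  qed
  have "bij_betw supp (primitive_idempotents R) (atoms ?\<A>)"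
  proof (rule bij_betwI')
    fix e f assume "e \<in> primitive_idempotents R" "f \<in> primitive_idempotents R"
    then show "supp e = supp f \<longleftrightarrow> e = f" using inj_supp by (auto simp: primitive_idempotents_def)
  next
    fix e assume e: "e \<in> primitive_idempotents R"
    then have "e \<in> idempotents R" by (simp add: primitive_idempotents_def)
    from prim[OF this] e show "supp e \<in> atoms ?\<A>" by blast
  next
    fix S assume S: "S \<in> atoms ?\<A>"
    then have "S \<in> ?\<A>" using atoms_subset by blast
    then obtain e where "e \<in> idempotents R" "supp e = S" using surj by blast
    then show "\<exists>e\<in>primitive_idempotents R. S = supp e" using prim S by blast
  qed
  then show ?thesis by (rule bij_betw_same_card)
qed

lemma atom_below:
  assumes "S \<in> \<A>" "S \<noteq> {}" "finite S"
  obtains A where "A \<in> atoms \<A>" "A \<subseteq> S"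
proof -
  have "\<exists>A\<in>atoms \<A>. A \<subseteq> S"
    using assms
  proof (induction "card S" arbitrary: S rule: less_induct)
    case less
    show ?case
    proof (cases "S \<in> atoms \<A>")
      case False
      then obtain T U where TU: "T \<in> \<A>" "U \<in> \<A>" "T \<noteq> {}" "U \<noteq> {}" "T \<inter> U = {}" "S = T \<union> U"
        using less.prems unfolding atoms_def by blast
      then have "T \<subset> S" by blast
      then have "card T < card S" "finite T" using less.prems(3) by (auto intro: psubset_card_mono finite_subset)
      then show ?thesis using less.hyps[of T] TU by blast
    qed blast
  qed
  then show thesis using that by blast
qed

text \<open>
  The sets \<open>E L\<close> partition the index set. As every member of the family is a union of them, they are
  the atoms.
\<close>

lemma card_atoms_eq:
  assumes E: "\<And>L. L \<in> C \<Longrightarrow> E L \<in> \<A>" "\<And>L. L \<in> C \<Longrightarrow> E L \<noteq> {}"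
    and disj: "\<And>K L. K \<in> C \<Longrightarrow> L \<in> C \<Longrightarrow> K \<noteq> L \<Longrightarrow> E K \<inter> E L = {}"
    and cover: "\<And>S. S \<in> \<A> \<Longrightarrow> S \<subseteq> (\<Union>L\<in>C. E L)"
    and diff: "\<And>S T. S \<in> \<A> \<Longrightarrow> T \<in> \<A> \<Longrightarrow> T \<subseteq> S \<Longrightarrow> S - T \<in> \<A>"
    and union: "\<And>S L. S \<in> \<A> \<Longrightarrow> L \<in> C \<Longrightarrow> S \<inter> E L \<noteq> {} \<Longrightarrow> E L \<subseteq> S"
  shows "card (atoms \<A>) = card C"
proof -
  have "atoms \<A> = E ` C"
  proof (intro equalityI subsetI)
    fix S assume S: "S \<in> atoms \<A>"
    then have SA: "S \<in> \<A>" "S \<noteq> {}" by (auto simp: atoms_def)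
    then obtain L where L: "L \<in> C" "S \<inter> E L \<noteq> {}" using cover by blast
    then have sub: "E L \<subseteq> S" using union SA by blast
    have "S = E L"
    proof (rule ccontr)
      assume "S \<noteq> E L"
      then have "S - E L \<noteq> {}" "S - E L \<in> \<A>" "E L \<inter> (S - E L) = {}" "E L \<union> (S - E L) = S"
        using sub diff SA E L by auto
      then show False using S not_atom[OF E(1)[OF L(1)] _ E(2)[OF L(1)]] by metis
    qed
    then show "S \<in> E ` C" using L by blast
  next
    fix S assume "S \<in> E ` C"
    then obtain L where L: "L \<in> C" "S = E L" by blast
    have False if TU: "T \<in> \<A>" "U \<in> \<A>" "T \<noteq> {}" "U \<noteq> {}" "T \<inter> U = {}" "S = T \<union> U" for T U
    proof -
      have "T \<inter> E L \<noteq> {}" "U \<inter> E L \<noteq> {}" using TU L by auto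
      then have "E L \<subseteq> T" "E L \<subseteq> U" using union TU(1,2) L(1) by simp_all
      then show False using TU(3-6) L by auto
    qed
    then show "S \<in> atoms \<A>" using E[OF L(1)] L unfolding atoms_def by blast
  qed
  moreover have "inj_on E C" using disj E(2) unfolding inj_on_def by (metis Int_absorb)
  ultimately show ?thesis by (simp add: card_image)
qed

text \<open>
  Pick an atom inside each \<open>E L\<close> with \<open>L \<noteq> L0\<close>, one inside \<open>T\<close>, and one inside \<open>E L0 - T\<close>.
\<close>

lemma card_atoms_gt:
  assumes E: "\<And>L. L \<in> C \<Longrightarrow> E L \<in> \<A>" "\<And>L. L \<in> C \<Longrightarrow> E L \<noteq> {}"
    and disj: "\<And>K L. K \<in> C \<Longrightarrow> L \<in> C \<Longrightarrow> K \<noteq> L \<Longrightarrow> E K \<inter> E L = {}"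
    and diff: "\<And>S T. S \<in> \<A> \<Longrightarrow> T \<in> \<A> \<Longrightarrow> T \<subseteq> S \<Longrightarrow> S - T \<in> \<A>"
    and fin: "finite I" "\<And>S. S \<in> \<A> \<Longrightarrow> S \<subseteq> I" "finite C"
    and T: "L0 \<in> C" "T \<in> \<A>" "T \<noteq> {}" "T \<subset> E L0"
  shows "card C < card (atoms \<A>)"
proof -
  define B where "B = (\<lambda>L. if L = L0 then T else E L)"
  have B: "B L \<in> \<A>" "B L \<noteq> {}" "B L \<subseteq> E L" if "L \<in> C" for L using E T that by (auto simp: B_def)
  have fS: "finite S" if "S \<in> \<A>" for S using fin(1,2) that finite_subset by blast
  have "\<forall>L\<in>C. \<exists>A. A \<in> atoms \<A> \<and> A \<subseteq> B L" using B(1,2) fS atom_below by metis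
  then obtain h where h: "\<And>L. L \<in> C \<Longrightarrow> h L \<in> atoms \<A>" "\<And>L. L \<in> C \<Longrightarrow> h L \<subseteq> B L" by metis
  have U: "E L0 - T \<in> \<A>" "E L0 - T \<noteq> {}" using diff E T by auto
  obtain A where A: "A \<in> atoms \<A>" "A \<subseteq> E L0 - T" using atom_below[OF U fS[OF U(1)]] by blast
  have ne: "S \<noteq> {}" if "S \<in> atoms \<A>" for S using that by (simp add: atoms_def)
  have inj: "inj_on h C"
  proof (rule inj_onI, rule ccontr)
    fix K L assume KL: "K \<in> C" "L \<in> C" "h K = h L" "K \<noteq> L"
    then have "h K \<subseteq> E K \<inter> E L" using h(2) B(3) by blast
    then show False using disj KL ne h(1) by blast
  qed
  have "A \<notin> h ` C"
  proof
    assume "A \<in> h ` C"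
    then obtain L where L: "L \<in> C" "A = h L" by blast
    have "A \<inter> B L = {}"
    proof (cases "L = L0")
      case False
      then show ?thesis using disj[OF L(1) T(1)] A(2) by (auto simp: B_def)
    qed (use A(2) in \<open>auto simp: B_def\<close>)
    then show False using h(2)[OF L(1)] L(2) ne[OF A(1)] by blast
  qed
  then have "card (insert A (h ` C)) = card C + 1" using inj fin(3) by (simp add: card_image)
  moreover have "finite (atoms \<A>)"
    by (rule finite_subset[of _ "Pow I"]) (use fin in \<open>auto simp: atoms_def\<close>)
  then have "card (insert A (h ` C)) \<le> card (atoms \<A>)" using A(1) h(1) by (intro card_mono) auto
  ultimately show ?thesis by simp
qed

section \<open>Units of the coefficient ring\<close>

text \<open>
  The integers that may serve as denominators: those prime to $p$, and only $1$ if nothing is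
  localized.
\<close>

definition unit_at :: "enat \<Rightarrow> int \<Rightarrow> bool" where
  "unit_at p b \<longleftrightarrow> (case p of enat q \<Rightarrow> \<not> int q dvd b | \<infinity> \<Rightarrow> b = 1)"

lemma unit_at_one: "p = \<infinity> \<or> (\<exists>q::nat. Factorial_Ring.prime q \<and> p = enat q) \<Longrightarrow> unit_at p 1"
  using not_prime_1 by (auto simp: unit_at_def)

lemma unit_at_mult:
  "p = \<infinity> \<or> (\<exists>q::nat. Factorial_Ring.prime q \<and> p = enat q) \<Longrightarrow> unit_at p a \<Longrightarrow> unit_at p b \<Longrightarrow> unit_at p (a * b)"
  by (auto simp: unit_at_def prime_dvd_mult_iff)

lemma two_valued_congruent:
  fixes d u :: int
  assumes "\<not> d dvd u" "d dvd a - b" "a \<in> {0, u}" "b \<in> {0, u}"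
  shows "a = b"
  using assms by auto

locale finite_group = group +
  assumes fin: "finite (carrier G)"
begin

section \<open>Conjugation and normal pairs\<close>

lemma subgroup_finite: "subgroup H G \<Longrightarrow> finite H"
  using fin subgroup.subset finite_subset by blast

lemma subgroup_card_pos: "subgroup H G \<Longrightarrow> card H > 0"
  using subgroup_finite subgroup.one_closed card_gt_0_iff by blast

lemma conj_set_one: "H \<subseteq> carrier G \<Longrightarrow> conj_set G \<one> H = H"
  by (auto simp: conj_set_eq subset_iff image_iff)

lemma mem_conj_set:
  assumes "g \<in> carrier G" "H \<subseteq> carrier G" "x \<in> carrier G"
  shows "x \<in> conj_set G g H \<longleftrightarrow> inv g \<otimes> x \<otimes> g \<in> H"
proof
  assume "x \<in> conj_set G g H"
  then obtain h where "h \<in> H" "x = g \<otimes> h \<otimes> inv g" by (auto simp: conj_set_eq)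
  then show "inv g \<otimes> x \<otimes> g \<in> H" using assms by (auto simp: m_assoc cancel_assoc subset_iff)
next
  assume "inv g \<otimes> x \<otimes> g \<in> H"
  moreover have "x = g \<otimes> (inv g \<otimes> x \<otimes> g) \<otimes> inv g"
    using assms by (auto simp: m_assoc cancel_assoc)
  ultimately show "x \<in> conj_set G g H" by (auto simp: conj_set_eq)
qed

lemma inj_on_conjugation: "g \<in> carrier G \<Longrightarrow> inj_on (\<lambda>x. g \<otimes> x \<otimes> inv g) (carrier G)"
  by (intro inj_onI) simp

lemma card_conj_set:
  assumes "g \<in> carrier G" "H \<subseteq> carrier G"
  shows "card (conj_set G g H) = card H"
  unfolding conj_set_eq using inj_on_subset[OF inj_on_conjugation] assms by (intro card_image) auto

lemma conj_set_mono: "A \<subseteq> B \<Longrightarrow> conj_set G g A \<subseteq> conj_set G g B"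
  by (auto simp: conj_set_eq)

lemma conj_set_cancel:
  assumes "g \<in> carrier G" "H \<subseteq> carrier G"
  shows "conj_set G g (conj_set G (inv g) H) = H" "conj_set G (inv g) (conj_set G g H) = H"
  using assms by (simp_all add: conj_set_mult conj_set_one)

lemma conj_set_le_iff:
  assumes "g \<in> carrier G" "A \<subseteq> carrier G" "B \<subseteq> carrier G"
  shows "conj_set G g A \<subseteq> conj_set G g B \<longleftrightarrow> A \<subseteq> B"
  using assms conj_set_mono conj_set_cancel by metis

lemma subgroup_conj_set:
  assumes "g \<in> carrier G" "subgroup H G"
  shows "subgroup (conj_set G g H) G"
proof -
  have "(H, H) \<in> normal_pairs G"
    using assms(2) group.normal_self[OF subgroup_imp_group[OF assms(2)]] by (auto simp: normal_pairs_def)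
  from normal_pairs_conj[OF assms(1) this] show ?thesis
    by (auto simp: normal_pairs_def conj_pair_def)
qed

text \<open>
  Normality of $L$ in $K$ in terms of conjugation in $G$, so that no subgroup has to be turned into
  a group of its own.
\<close>

lemma normal_pairs_iff:
  "(K, L) \<in> normal_pairs G \<longleftrightarrow>
     subgroup K G \<and> subgroup L G \<and> L \<subseteq> K \<and> (\<forall>k\<in>K. conj_set G k L = L)"
proof
  assume *: "(K, L) \<in> normal_pairs G"
  then have K: "subgroup K G" and L: "L \<lhd> (G\<lparr>carrier := K\<rparr>)" by (auto simp: normal_pairs_def)
  have "subgroup L (G\<lparr>carrier := K\<rparr>)" using L by (rule normal_imp_subgroup)
  then show "subgroup K G \<and> subgroup L G \<and> L \<subseteq> K \<and> (\<forall>k\<in>K. conj_set G k L = L)"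
    using K incl_subgroup[OF K] subgroup.subset conj_set_fixed[OF K L] by fastforce
next
  assume *: "subgroup K G \<and> subgroup L G \<and> L \<subseteq> K \<and> (\<forall>k\<in>K. conj_set G k L = L)"
  have "L \<lhd> (G\<lparr>carrier := K\<rparr>)"
  proof (rule group.normal_invI)
    show "group (G\<lparr>carrier := K\<rparr>)" using * subgroup_imp_group by blast
    show "subgroup L (G\<lparr>carrier := K\<rparr>)" using * subgroup_incl by blast
    fix x h assume x: "x \<in> carrier (G\<lparr>carrier := K\<rparr>)" and h: "h \<in> L"
    have "x \<otimes> h \<otimes> inv x \<in> conj_set G x L" using h by (auto simp: conj_set_eq)
    then show "x \<otimes>\<^bsub>G\<lparr>carrier := K\<rparr>\<^esub> h \<otimes>\<^bsub>G\<lparr>carrier := K\<rparr>\<^esub> inv\<^bsub>G\<lparr>carrier := K\<rparr>\<^esub> x \<in> L"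
      using x * m_inv_consistent[of K x] by simp
  qed
  then show "(K, L) \<in> normal_pairs G" using * by (auto simp: normal_pairs_def)
qed

lemma normal_pairsD:
  assumes "P \<in> normal_pairs G"
  shows "subgroup (fst P) G" "subgroup (snd P) G" "snd P \<subseteq> fst P"
    "\<And>k. k \<in> fst P \<Longrightarrow> conj_set G k (snd P) = snd P"
    "fst P \<subseteq> carrier G" "snd P \<subseteq> carrier G"
  using assms normal_pairs_iff[of "fst P" "snd P"] normal_pairs_subset[OF assms] by auto

lemma finite_normal_pairs: "finite (normal_pairs G)"
proof (rule finite_subset)
  show "normal_pairs G \<subseteq> Pow (carrier G) \<times> Pow (carrier G)"
    using normal_pairs_subset by fastforce
qed (simp add: fin)

lemma meet_pair_normal:
  assumes "P \<in> normal_pairs G" "Q \<in> normal_pairs G" "h \<in> carrier G"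
  shows "meet_pair G h P Q \<in> normal_pairs G"
proof -
  let ?Q = "conj_pair G h Q"
  have Q: "?Q \<in> normal_pairs G" using assms normal_pairs_conj by blast
  have m: "meet_pair G h P Q = (fst P \<inter> fst ?Q, snd P \<inter> snd ?Q)"
    by (simp add: meet_pair_def conj_pair_def split: prod.splits)
  note p = normal_pairsD[OF assms(1)] and q = normal_pairsD[OF Q]
  have "conj_set G k (snd P \<inter> snd ?Q) = snd P \<inter> snd ?Q" if "k \<in> fst P \<inter> fst ?Q" for k
    using conj_set_Int[of k "snd P" "snd ?Q"] that p(4-6) q(4-6) by auto
  then show ?thesis
    unfolding m normal_pairs_iff using p q by (auto intro: subgroups_Inter_pair)
qed

section \<open>Sums over double cosets\<close>

abbreviation dcoset :: "'a set \<Rightarrow> 'a set \<Rightarrow> 'a \<Rightarrow> 'a set" where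
  "dcoset A B g \<equiv> (A #> g) <#> B"

lemma dcoset_self:
  assumes "subgroup A G" "subgroup B G" "g \<in> carrier G"
  shows "g \<in> dcoset A B g"
proof -
  have "g = \<one> \<otimes> g \<otimes> \<one>" using assms by simp
  then show ?thesis unfolding double_coset_eq
    using subgroup.one_closed[OF assms(1)] subgroup.one_closed[OF assms(2)] by blast
qed

lemma dcoset_subset:
  assumes "subgroup A G" "subgroup B G" "g \<in> carrier G"
  shows "dcoset A B g \<subseteq> carrier G"
  using assms subgroup.mem_carrier unfolding double_coset_eq by fastforce

lemma dcoset_eq_of_mem:
  assumes A: "subgroup A G" and B: "subgroup B G" and "g \<in> carrier G" "h \<in> dcoset A B g"
  shows "dcoset A B h = dcoset A B g"
proof -
  obtain a b where h: "h = a \<otimes> g \<otimes> b" "a \<in> A" "b \<in> B"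
    using assms(4) by (auto simp: double_coset_eq)
  have G: "a \<in> carrier G" "b \<in> carrier G" using h A B subgroup.mem_carrier by metis+
  have G2: "\<And>x. x \<in> A \<Longrightarrow> x \<in> carrier G" "\<And>x. x \<in> B \<Longrightarrow> x \<in> carrier G"
    using A B subgroup.mem_carrier by metis+
  have 1: "x \<otimes> h \<otimes> y = (x \<otimes> a) \<otimes> g \<otimes> (b \<otimes> y)" "x \<otimes> g \<otimes> y = (x \<otimes> inv a) \<otimes> h \<otimes> (inv b \<otimes> y)"
    if "x \<in> A" "y \<in> B" for x y
    using G G2 that assms(3) by (simp_all add: h(1) m_assoc cancel_assoc)
  have 2: "x \<otimes> a \<in> A" "x \<otimes> inv a \<in> A" if "x \<in> A" for x
    using that h A by (auto intro: subgroup.m_closed subgroup.m_inv_closed)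
  have 3: "b \<otimes> x \<in> B" "inv b \<otimes> x \<in> B" if "x \<in> B" for x
    using that h B by (auto intro: subgroup.m_closed subgroup.m_inv_closed)
  show ?thesis
    unfolding double_coset_eq
  proof (intro equalityI subsetI; elim CollectE exE conjE)
    fix z x y assume "z = x \<otimes> h \<otimes> y" "x \<in> A" "y \<in> B"
    then show "z \<in> {k \<otimes> g \<otimes> u |k u. k \<in> A \<and> u \<in> B}" using 1(1) 2(1) 3(1) by blast
  next
    fix z x y assume "z = x \<otimes> g \<otimes> y" "x \<in> A" "y \<in> B"
    then show "z \<in> {k \<otimes> h \<otimes> u |k u. k \<in> A \<and> u \<in> B}" using 1(2) 2(2) 3(2) by blast
  qed
qed

text \<open>
  The fibres of $(a, b) \mapsto agb$ on $A \times B$ are the orbits of $A \cap gBg^{-1}$, acting by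
  $c \cdot (a, b) = (ac, g^{-1}c^{-1}g\,b)$.
\<close>

lemma card_dcoset:
  assumes A: "subgroup A G" and B: "subgroup B G" and g: "g \<in> carrier G"
  shows "card (dcoset A B g) * card (A \<inter> conj_set G g B) = card A * card B"
proof -
  let ?f = "\<lambda>(a, b). a \<otimes> g \<otimes> b"
  let ?J = "A \<inter> conj_set G g B"
  have G2: "\<And>x. x \<in> A \<Longrightarrow> x \<in> carrier G" "\<And>x. x \<in> B \<Longrightarrow> x \<in> carrier G"
    using A B subgroup.mem_carrier by metis+
  have BG: "B \<subseteq> carrier G" using G2 by auto
  have fibre: "card {p \<in> A \<times> B. ?f p = d} = card ?J" if d: "d \<in> dcoset A B g" for d
  proof -
    obtain a b where ab: "d = a \<otimes> g \<otimes> b" "a \<in> A" "b \<in> B"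
      using d by (auto simp: double_coset_eq)
    have "bij_betw (\<lambda>c. (a \<otimes> c, inv g \<otimes> inv c \<otimes> g \<otimes> b)) ?J {p \<in> A \<times> B. ?f p = d}"
    proof (rule bij_betw_byWitness[where f' = "\<lambda>(x, y). inv a \<otimes> x"])
      show "\<forall>c\<in>?J. (\<lambda>(x, y). inv a \<otimes> x) (a \<otimes> c, inv g \<otimes> inv c \<otimes> g \<otimes> b) = c"
        using ab G2 by (auto simp: cancel_assoc)
      show "\<forall>p\<in>{p \<in> A \<times> B. ?f p = d}. (\<lambda>c. (a \<otimes> c, inv g \<otimes> inv c \<otimes> g \<otimes> b)) ((\<lambda>(x, y). inv a \<otimes> x) p) = p"
      proof
        fix p assume "p \<in> {p \<in> A \<times> B. ?f p = d}"
        then obtain x y where xy: "p = (x, y)" "x \<in> A" "y \<in> B" "x \<otimes> g \<otimes> y = d" by auto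
        have G: "a \<in> carrier G" "b \<in> carrier G" "x \<in> carrier G" "y \<in> carrier G"
          using ab xy G2 by auto
        have "inv g \<otimes> inv (inv a \<otimes> x) \<otimes> g \<otimes> b = inv g \<otimes> inv x \<otimes> (a \<otimes> g \<otimes> b)"
          using G g by (simp add: m_assoc inv_mult_group)
        also have "\<dots> = inv g \<otimes> inv x \<otimes> (x \<otimes> g \<otimes> y)" using ab(1) xy(4) by simp
        also have "\<dots> = y" using G g by (simp add: m_assoc cancel_assoc)
        finally show "(\<lambda>c. (a \<otimes> c, inv g \<otimes> inv c \<otimes> g \<otimes> b)) ((\<lambda>(x, y). inv a \<otimes> x) p) = p"
          using G xy(1) by (simp add: cancel_assoc)
      qed
      show "(\<lambda>c. (a \<otimes> c, inv g \<otimes> inv c \<otimes> g \<otimes> b)) ` ?J \<subseteq> {p \<in> A \<times> B. ?f p = d}"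
      proof (intro image_subsetI)
        fix c assume c: "c \<in> ?J"
        have G: "a \<in> carrier G" "b \<in> carrier G" "c \<in> carrier G" using ab c G2 by auto
        have "inv c \<in> conj_set G g B"
          using c subgroup_conj_set[OF g B] by (auto intro: subgroup.m_inv_closed)
        then have "inv g \<otimes> inv c \<otimes> g \<in> B" using mem_conj_set[OF g BG] G by simp
        then have "inv g \<otimes> inv c \<otimes> g \<otimes> b \<in> B" using ab B by (auto intro: subgroup.m_closed)
        moreover have "a \<otimes> c \<otimes> g \<otimes> (inv g \<otimes> inv c \<otimes> g \<otimes> b) = d"
          using G g ab by (simp add: m_assoc cancel_assoc)
        moreover have "a \<otimes> c \<in> A" using ab c A by (auto intro: subgroup.m_closed)
        ultimately show "(a \<otimes> c, inv g \<otimes> inv c \<otimes> g \<otimes> b) \<in> {p \<in> A \<times> B. ?f p = d}" by auto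
      qed
      show "(\<lambda>(x, y). inv a \<otimes> x) ` {p \<in> A \<times> B. ?f p = d} \<subseteq> ?J"
      proof (intro image_subsetI)
        fix p assume "p \<in> {p \<in> A \<times> B. ?f p = d}"
        then obtain x y where p: "p = (x, y)" and xy: "x \<in> A" "y \<in> B" "x \<otimes> g \<otimes> y = d" by auto
        have G: "a \<in> carrier G" "b \<in> carrier G" "x \<in> carrier G" "y \<in> carrier G"
          using ab xy G2 by auto
        have "x = a \<otimes> g \<otimes> b \<otimes> inv (g \<otimes> y)"
          using xy(3) ab(1) G g by (metis inv_solve_right m_assoc m_closed)
        then have "inv a \<otimes> x = g \<otimes> (b \<otimes> inv y) \<otimes> inv g"
          using G g by (simp add: m_assoc cancel_assoc inv_mult_group)
        moreover have "b \<otimes> inv y \<in> B" using ab xy B by (auto intro: subgroup.m_closed subgroup.m_inv_closed)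
        moreover have "inv a \<otimes> x \<in> A" using ab xy A by (auto intro: subgroup.m_closed subgroup.m_inv_closed)
        ultimately show "(\<lambda>(x, y). inv a \<otimes> x) p \<in> ?J" by (auto simp: conj_set_eq p)
      qed
    qed
    then show ?thesis by (simp add: bij_betw_same_card)
  qed
  have fA: "finite (A \<times> B)" using A B subgroup_finite by blast
  have img: "?f ` (A \<times> B) = dcoset A B g" unfolding double_coset_eq by (auto simp: image_iff)
  have "card (A \<times> B) = (\<Sum>d\<in>?f ` (A \<times> B). card {p \<in> A \<times> B. ?f p = d})"
    using sum.image_gen[OF fA, of "\<lambda>_. 1::nat" ?f] by simp
  also have "\<dots> = card (dcoset A B g) * card ?J" unfolding img using fibre by simp
  finally show ?thesis by (simp add: card_cartesian_product)
qed

definition dcoset_closed :: "'a set \<Rightarrow> 'a set \<Rightarrow> 'a set \<Rightarrow> bool" where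
  "dcoset_closed A B S \<longleftrightarrow> S \<subseteq> carrier G \<and> (\<forall>g\<in>S. dcoset A B g \<subseteq> S)"

lemma dcoset_closed_sum:
  fixes f :: "'a \<Rightarrow> 'c::comm_monoid_add"
  assumes A: "subgroup A G" and B: "subgroup B G" and S: "dcoset_closed A B S"
  shows "sum f S = (\<Sum>D\<in>dcoset A B ` S. sum f D)"
proof -
  have "S = \<Union> (dcoset A B ` S)"
    using S dcoset_self[OF A B] unfolding dcoset_closed_def by blast
  moreover have "sum f (\<Union> (dcoset A B ` S)) = (\<Sum>D\<in>dcoset A B ` S. sum f D)"
  proof (rule sum.Union_disjoint[unfolded comp_def])
    show "\<forall>D\<in>dcoset A B ` S. finite D"
      using S finite_subset[OF dcoset_subset[OF A B] fin] unfolding dcoset_closed_def by blast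
    show "\<forall>D\<in>dcoset A B ` S. \<forall>E\<in>dcoset A B ` S. D \<noteq> E \<longrightarrow> D \<inter> E = {}"
    proof (intro ballI impI)
      fix D E assume "D \<in> dcoset A B ` S" "E \<in> dcoset A B ` S" "D \<noteq> E"
      then obtain g h where *: "D = dcoset A B g" "E = dcoset A B h" "g \<in> carrier G" "h \<in> carrier G"
        using S unfolding dcoset_closed_def by blast
      have "D = E" if "x \<in> D" "x \<in> E" for x
        using dcoset_eq_of_mem[OF A B *(3), of x] dcoset_eq_of_mem[OF A B *(4), of x] * that by simp
      then show "D \<inter> E = {}" using \<open>D \<noteq> E\<close> by auto
    qed
  qed
  ultimately show ?thesis by simp
qed

lemma double_cosets_conv: "double_cosets G A B = dcoset A B ` carrier G"
  by (simp add: double_cosets_def)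

text \<open>
  Each double coset contributes $|A||B|$ times the value of $F$. This is the form in which orbits
  are counted below: for $A$ acting on the points of $G/B$ it is the orbit counting lemma, and for
  $S = G$ it turns the sum over $K \backslash G / U$ in the product of two symbols into a sum over $G$.
\<close>

lemma dcoset_weighted_sum:
  fixes F :: "'a \<Rightarrow> int"
  assumes A: "subgroup A G" and B: "subgroup B G" and S: "dcoset_closed A B S"
    and F: "\<And>D x y. D \<in> dcoset A B ` S \<Longrightarrow> x \<in> D \<Longrightarrow> y \<in> D \<Longrightarrow> F x = F y"
    and r: "\<And>D. D \<in> dcoset A B ` S \<Longrightarrow> r D \<in> D"
  shows "(\<Sum>g\<in>S. int (card (A \<inter> conj_set G g B)) * F g)
       = int (card A * card B) * (\<Sum>D\<in>dcoset A B ` S. F (r D))"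
proof -
  have "(\<Sum>g\<in>D. int (card (A \<inter> conj_set G g B)) * F g) = int (card A * card B) * F (r D)"
    if D: "D \<in> dcoset A B ` S" for D
  proof -
    obtain g where g: "g \<in> S" "D = dcoset A B g" "g \<in> carrier G"
      using D S by (auto simp: dcoset_closed_def)
    have c: "int (card D) * int (card (A \<inter> conj_set G x B)) = int (card A * card B)" if "x \<in> D" for x
      using card_dcoset[OF A B, of x] dcoset_eq_of_mem[OF A B g(3), of x] that g
        dcoset_subset[OF A B g(3)] by (metis of_nat_mult subsetD)
    have "D \<noteq> {}" using g dcoset_self[OF A B] by auto
    moreover have "finite D" using g dcoset_subset[OF A B g(3)] fin finite_subset by blast
    ultimately have pos: "int (card D) \<noteq> 0" by simp
    have rD: "r D \<in> D" using r[OF D] .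
    have "(\<Sum>g\<in>D. int (card (A \<inter> conj_set G g B)) * F g)
        = (\<Sum>g\<in>D. int (card (A \<inter> conj_set G (r D) B)) * F (r D))"
    proof (intro sum.cong refl)
      fix x assume x: "x \<in> D"
      have "int (card (A \<inter> conj_set G x B)) = int (card (A \<inter> conj_set G (r D) B))"
        using c[OF x] c[OF rD] pos by (metis mult_cancel_left)
      then show "int (card (A \<inter> conj_set G x B)) * F x = int (card (A \<inter> conj_set G (r D) B)) * F (r D)"
        using F[OF D x rD] by simp
    qed
    also have "\<dots> = (int (card D) * int (card (A \<inter> conj_set G (r D) B))) * F (r D)" by simp
    finally show ?thesis using c[OF rD] by simp
  qed
  then show ?thesis
    unfolding dcoset_closed_sum[OF A B S] by (simp add: sum_distrib_left)
qed

lemma dvd_card_dcoset_closed: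
  assumes A: "subgroup A G" and B: "subgroup B G" and S: "dcoset_closed A B S"
    and d: "\<And>g. g \<in> S \<Longrightarrow> k dvd card (dcoset A B g)"
  shows "k dvd card S"
proof -
  have "card S = (\<Sum>D\<in>dcoset A B ` S. card D)"
    using dcoset_closed_sum[OF A B S, of "\<lambda>_. 1::nat"] by simp
  then show ?thesis using d by (auto intro: dvd_sum)
qed

section \<open>Marks\<close>

text \<open>
  For \<open>Z = (H, M)\<close> and \<open>P = (K, L)\<close>, the elements $g$ for which the point $gK$ is fixed by $H$ and
  its label $gLg^{-1}$ contains $M$.
\<close>

definition transporter :: "'a set \<times> 'a set \<Rightarrow> 'a set \<times> 'a set \<Rightarrow> 'a set" where
  "transporter Z P =
     {g \<in> carrier G. fst Z \<subseteq> conj_set G g (fst P) \<and> snd Z \<subseteq> conj_set G g (snd P)}"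

text \<open>
  The transporter is a union of left cosets of $K$, so the division is exact and gives the number of
  these points (see \<open>card_transporter\<close>).
\<close>

definition mark :: "'a set \<times> 'a set \<Rightarrow> 'a set \<times> 'a set \<Rightarrow> int" where
  "mark Z P = int (card (transporter Z P) div card (fst P))"

lemma finite_transporter: "finite (transporter Z P)"
  using fin by (simp add: transporter_def)

lemma dcoset_closed_transporter:
  assumes A: "subgroup A G" and P: "P \<in> normal_pairs G"
    and Z: "fst Z \<subseteq> carrier G" "snd Z \<subseteq> carrier G" "\<And>a. a \<in> A \<Longrightarrow> conj_pair G a Z = Z"
  shows "dcoset_closed A (fst P) (transporter Z P)"
proof -
  note p = normal_pairsD[OF P]
  have "a \<otimes> g \<otimes> b \<in> transporter Z P" if "a \<in> A" "g \<in> transporter Z P" "b \<in> fst P" for a g b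
  proof -
    have G: "a \<in> carrier G" "g \<in> carrier G" "b \<in> carrier G"
      using that subgroup.mem_carrier[OF A] subgroup.mem_carrier[OF p(1)] by (auto simp: transporter_def)
    have c: "conj_set G (a \<otimes> g \<otimes> b) B = conj_set G a (conj_set G g B)"
      if "conj_set G b B = B" "B \<subseteq> carrier G" for B
      using G that by (metis conj_set_mult conj_set_carrier m_closed)
    have "conj_set G a (fst Z) = fst Z" "conj_set G a (snd Z) = snd Z"
      using Z(3)[OF that(1)] by (auto simp: conj_pair_def split: prod.splits)
    then show ?thesis
      using that(2) c[OF conj_set_self[OF p(1) that(3)] p(5)] c[OF p(4)[OF that(3)] p(6)] G
        conj_set_mono[of _ _ a] unfolding transporter_def by (metis (no_types, lifting) m_closed mem_Collect_eq)
  qed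
  then show ?thesis
    unfolding dcoset_closed_def double_coset_eq using transporter_def[of Z P] by blast
qed

lemma card_transporter:
  assumes "fst Z \<subseteq> carrier G" "snd Z \<subseteq> carrier G" "P \<in> normal_pairs G"
  shows "int (card (transporter Z P)) = int (card (fst P)) * mark Z P"
proof -
  note p = normal_pairsD[OF assms(3)]
  have "conj_pair G \<one> Z = Z"
    using assms by (auto simp: conj_pair_def conj_set_one split: prod.splits)
  then have cl: "dcoset_closed {\<one>} (fst P) (transporter Z P)"
    using dcoset_closed_transporter[OF triv_subgroup assms(3) assms(1,2)] by simp
  have "card (fst P) dvd card (dcoset {\<one>} (fst P) g)" if "g \<in> transporter Z P" for g
  proof -
    have g: "g \<in> carrier G" using that by (simp add: transporter_def)
    have "{\<one>} \<inter> conj_set G g (fst P) = {\<one>}"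
      using subgroup.one_closed[OF subgroup_conj_set[OF g p(1)]] by auto
    then show ?thesis using card_dcoset[OF triv_subgroup p(1) g] by simp
  qed
  then have "card (fst P) dvd card (transporter Z P)"
    by (rule dvd_card_dcoset_closed[OF triv_subgroup p(1) cl])
  then show ?thesis by (simp add: mark_def flip: of_nat_mult)
qed

lemma mark_conj_right:
  assumes "a \<in> carrier G" "fst P \<subseteq> carrier G" "snd P \<subseteq> carrier G"
  shows "mark Z (conj_pair G a P) = mark Z P"
proof -
  have e: "fst (conj_pair G a P) = conj_set G a (fst P)" "snd (conj_pair G a P) = conj_set G a (snd P)"
    by (auto simp: conj_pair_def split: prod.splits)
  have "bij_betw (\<lambda>g. g \<otimes> a) (transporter Z (conj_pair G a P)) (transporter Z P)"
    by (rule bij_betw_byWitness[where f' = "\<lambda>g. g \<otimes> inv a"])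
      (use assms in \<open>auto simp: transporter_def e m_assoc conj_set_mult cancel_assoc\<close>)
  then show ?thesis
    using assms by (simp add: mark_def bij_betw_same_card e card_conj_set)
qed

lemma mark_conj_left:
  assumes "a \<in> carrier G" "fst Z \<subseteq> carrier G" "snd Z \<subseteq> carrier G" "P \<in> normal_pairs G"
  shows "mark (conj_pair G a Z) P = mark Z P"
proof -
  note p = normal_pairsD[OF assms(4)]
  have e: "fst (conj_pair G a Z) = conj_set G a (fst Z)" "snd (conj_pair G a Z) = conj_set G a (snd Z)"
    by (auto simp: conj_pair_def split: prod.splits)
  have c: "conj_set G a H \<subseteq> conj_set G g K \<longleftrightarrow> H \<subseteq> conj_set G (inv a \<otimes> g) K"
    if "g \<in> carrier G" "H \<subseteq> carrier G" "K \<subseteq> carrier G" for g H K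
    using conj_set_le_iff[of a H "conj_set G (inv a \<otimes> g) K"] that assms(1)
    by (simp add: conj_set_mult conj_set_carrier cancel_assoc)
  have t: "g \<in> transporter (conj_pair G a Z) P \<longleftrightarrow> g \<in> carrier G \<and> inv a \<otimes> g \<in> transporter Z P" for g
    unfolding transporter_def e using c[of g] assms p(5,6) by auto
  have "bij_betw (\<lambda>g. inv a \<otimes> g) (transporter (conj_pair G a Z) P) (transporter Z P)"
  proof (rule bij_betw_byWitness[where f' = "\<lambda>g. a \<otimes> g"])
    have "g \<in> carrier G" if "g \<in> transporter Z P" for g using that by (simp add: transporter_def)
    then show "(\<lambda>g. a \<otimes> g) ` transporter Z P \<subseteq> transporter (conj_pair G a Z) P"
      "\<forall>g\<in>transporter Z P. inv a \<otimes> (a \<otimes> g) = g"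
      using assms(1) by (auto simp: t cancel_assoc)
  qed (use assms(1) in \<open>auto simp: t cancel_assoc\<close>)
  then show ?thesis by (simp add: mark_def bij_betw_same_card)
qed

lemma mark_nonzero_iff:
  assumes "fst Z \<subseteq> carrier G" "snd Z \<subseteq> carrier G" "P \<in> normal_pairs G"
  shows "mark Z P \<noteq> 0 \<longleftrightarrow> transporter Z P \<noteq> {}"
  using card_transporter[OF assms] finite_transporter[of Z P] subgroup_card_pos[OF normal_pairsD(1)[OF assms(3)]] by auto

lemma pair_class_self: "P \<in> normal_pairs G \<Longrightarrow> P \<in> pair_class G P"
  unfolding orbit_def using normal_pairs_subset[of P]
  by (intro CollectI exI[of _ \<one>]) (auto simp: conj_pair_def conj_set_one split: prod.splits)

lemma mark_pair_class:
  assumes "P \<in> normal_pairs G" "Q \<in> normal_pairs G" "pair_class G P = pair_class G Q"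
  shows "mark Z P = mark Z Q"
proof -
  obtain a where "a \<in> carrier G" "P = conj_pair G a Q"
    using pair_class_self[OF assms(1)] assms(3) by (auto simp: orbit_def)
  then show ?thesis using mark_conj_right normal_pairs_subset[OF assms(2)] by simp
qed

lemma transporter_meet_pair:
  assumes "P \<in> normal_pairs G" "Q \<in> normal_pairs G" "t \<in> carrier G"
  shows "transporter Z (meet_pair G t P Q) = {g \<in> transporter Z P. g \<otimes> t \<in> transporter Z Q}"
proof -
  note p = normal_pairsD[OF assms(1)] and q = normal_pairsD[OF assms(2)]
  have "conj_set G g (A \<inter> conj_set G t B) = conj_set G g A \<inter> conj_set G (g \<otimes> t) B"
    if "g \<in> carrier G" "A \<subseteq> carrier G" "B \<subseteq> carrier G" for g A B
    using that assms(3) by (simp add: conj_set_Int conj_set_carrier conj_set_mult)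
  then show ?thesis using p(5,6) q(5,6) assms(3)
    by (auto simp: transporter_def meet_pair_def split: prod.splits)
qed

text \<open>
  The left side counts pairs of points, that is, up to the factor $|K||U|$, pairs of group elements
  $(g, gt)$. For fixed $t$ the condition says that $g$ transports to \<open>meet_pair G t P Q\<close>.
\<close>

lemma mark_mult:
  assumes P: "P \<in> normal_pairs G" and Q: "Q \<in> normal_pairs G"
    and Z: "fst Z \<subseteq> carrier G" "snd Z \<subseteq> carrier G"
    and r: "\<And>D. D \<in> double_cosets G (fst P) (fst Q) \<Longrightarrow> r D \<in> D"
  shows "mark Z P * mark Z Q
       = (\<Sum>D\<in>double_cosets G (fst P) (fst Q). mark Z (meet_pair G (r D) P Q))"
proof -
  note p = normal_pairsD[OF P] and q = normal_pairsD[OF Q]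
  have cl: "dcoset_closed (fst P) (fst Q) (carrier G)"
    unfolding dcoset_closed_def using dcoset_subset[OF p(1) q(1)] by blast
  have "int (card (fst P) * card (fst Q)) * (mark Z P * mark Z Q)
      = int (card (transporter Z P \<times> transporter Z Q))"
    by (simp add: card_cartesian_product card_transporter[OF Z P] card_transporter[OF Z Q])
  also have "transporter Z P \<times> transporter Z Q
      = (\<lambda>(t, g). (g, g \<otimes> t)) ` (SIGMA t:carrier G. transporter Z (meet_pair G t P Q))"
  proof (intro equalityI subsetI)
    fix z assume "z \<in> transporter Z P \<times> transporter Z Q"
    then obtain g h where z: "z = (g, h)" "g \<in> transporter Z P" "h \<in> transporter Z Q" by auto
    have G: "g \<in> carrier G" "h \<in> carrier G" using z by (auto simp: transporter_def)
    show "z \<in> (\<lambda>(t, g). (g, g \<otimes> t)) ` (SIGMA t:carrier G. transporter Z (meet_pair G t P Q))"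
      using G z by (intro image_eqI[of _ _ "(inv g \<otimes> h, g)"])
        (auto simp: transporter_meet_pair[OF P Q] cancel_assoc)
  qed (auto simp: transporter_meet_pair[OF P Q])
  also have "card \<dots> = card (SIGMA t:carrier G. transporter Z (meet_pair G t P Q))"
    by (rule card_image) (auto simp: inj_on_def transporter_def)
  also have "int \<dots> = (\<Sum>t\<in>carrier G. int (card (transporter Z (meet_pair G t P Q))))"
    using fin finite_transporter by (simp add: card_SigmaI)
  also have "\<dots> = (\<Sum>t\<in>carrier G. int (card (fst P \<inter> conj_set G t (fst Q))) * mark Z (meet_pair G t P Q))"
    using card_transporter[OF Z meet_pair_normal[OF P Q]]
    by (intro sum.cong refl) (simp add: meet_pair_def split: prod.splits)
  also have "\<dots> = int (card (fst P) * card (fst Q))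
      * (\<Sum>D\<in>dcoset (fst P) (fst Q) ` carrier G. mark Z (meet_pair G (r D) P Q))"
  proof (rule dcoset_weighted_sum[OF p(1) q(1) cl])
    fix D x y assume D: "D \<in> dcoset (fst P) (fst Q) ` carrier G" and xy: "x \<in> D" "y \<in> D"
    then have D': "D \<in> double_cosets G (fst P) (fst Q)" by (simp add: double_cosets_conv)
    have "x \<in> carrier G" "y \<in> carrier G" using double_coset_rep(2)[OF P Q D'] xy by auto
    then show "mark Z (meet_pair G x P Q) = mark Z (meet_pair G y P Q)"
      using mark_pair_class pair_class_meet_double_coset[OF P Q D' xy] meet_pair_normal[OF P Q] by blast
  next
    show "\<And>D. D \<in> dcoset (fst P) (fst Q) ` carrier G \<Longrightarrow> r D \<in> D"
      using r by (simp add: double_cosets_conv)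
  qed
  finally show ?thesis
    using subgroup_card_pos[OF p(1)] subgroup_card_pos[OF q(1)] by (simp add: double_cosets_conv)
qed

section \<open>The ghost map\<close>

abbreviation symbols :: "('a set \<times> 'a set) set set" where
  "symbols \<equiv> orbits G (normal_pairs G) (conj_pair G)"

abbreviation burnside :: "(('a set \<times> 'a set) set \<Rightarrow>\<^sub>0 int) ring" where
  "burnside \<equiv> lattice_burnside_ring G"

text \<open>
  The marks, extended linearly from the symbols. The choice of a representative is harmless, as marks
  depend only on the class (\<open>ghost_basis\<close>).
\<close>

definition ghost :: "(('a set \<times> 'a set) set \<Rightarrow>\<^sub>0 int) \<Rightarrow> 'a set \<times> 'a set \<Rightarrow> int" where
  "ghost x Z = (\<Sum>A\<in>symbols. Poly_Mapping.lookup x A * mark Z (SOME P. P \<in> A))"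

lemma symbols_eq: "symbols = pair_class G ` normal_pairs G"
  by (auto simp: orbits_def)

lemma finite_symbols: "finite symbols"
  using finite_normal_pairs by (simp add: symbols_eq)

lemma burnside_simps:
  "x \<in> carrier burnside \<longleftrightarrow> Poly_Mapping.keys x \<subseteq> symbols"
  "x \<otimes>\<^bsub>burnside\<^esub> y = bilinear_extend (class_mult G) x y"
  "x \<oplus>\<^bsub>burnside\<^esub> y = x + y" "\<zero>\<^bsub>burnside\<^esub> = 0"
  "\<one>\<^bsub>burnside\<^esub> = frag_of (pair_class G (carrier G, carrier G))"
  by (simp_all add: lattice_burnside_ring_def)

lemma burnside_diff:
  "x \<in> carrier burnside \<Longrightarrow> y \<in> carrier burnside \<Longrightarrow> x - y \<in> carrier burnside"
  using keys_diff[of x y] by (auto simp: burnside_simps)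

lemma burnside_add:
  "x \<in> carrier burnside \<Longrightarrow> y \<in> carrier burnside \<Longrightarrow> x + y \<in> carrier burnside"
  using keys_add[of x y] by (auto simp: burnside_simps)

lemma burnside_cmul: "x \<in> carrier burnside \<Longrightarrow> frag_cmul c x \<in> carrier burnside"
  using keys_cmul[of c x] by (auto simp: burnside_simps)

lemma burnside_zero: "0 \<in> carrier burnside"
  by (simp add: burnside_simps)

lemma burnside_basis: "P \<in> normal_pairs G \<Longrightarrow> frag_of (pair_class G P) \<in> carrier burnside"
  by (simp add: burnside_simps symbols_eq keys_frag_of)

lemma ghost_simps:
  "ghost 0 Z = 0" "ghost (x + y) Z = ghost x Z + ghost y Z"
  "ghost (x - y) Z = ghost x Z - ghost y Z" "ghost (frag_cmul c x) Z = c * ghost x Z"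
  by (simp_all add: ghost_def lookup_add lookup_minus algebra_simps sum.distrib sum_subtractf sum_distrib_left)

lemma ghost_sum: "ghost (sum f S) Z = (\<Sum>i\<in>S. ghost (f i) Z)"
  by (induction S rule: infinite_finite_induct) (simp_all add: ghost_simps)

lemma ghost_basis:
  assumes P: "P \<in> normal_pairs G"
  shows "ghost (frag_of (pair_class G P)) Z = mark Z P"
proof -
  obtain a where a: "a \<in> carrier G" "(SOME R. R \<in> pair_class G P) = conj_pair G a P"
    by (rule pair_class_rep[OF P])
  have "ghost (frag_of (pair_class G P)) Z = (\<Sum>A\<in>symbols. if A = pair_class G P then mark Z (SOME R. R \<in> A) else 0)"
    unfolding ghost_def by (intro sum.cong refl) auto
  also have "\<dots> = mark Z (SOME R. R \<in> pair_class G P)"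
    using finite_symbols P by (simp add: symbols_eq)
  finally show ?thesis using a mark_conj_right normal_pairs_subset[OF P] by simp
qed

lemma burnside_induct [consumes 1, case_names zero basis diff]:
  assumes "x \<in> carrier burnside" "Q 0" "\<And>P. P \<in> normal_pairs G \<Longrightarrow> Q (frag_of (pair_class G P))"
    "\<And>a b. a \<in> carrier burnside \<Longrightarrow> b \<in> carrier burnside \<Longrightarrow> Q a \<Longrightarrow> Q b \<Longrightarrow> Q (a - b)"
  shows "Q x"
proof -
  have "Poly_Mapping.keys x \<subseteq> symbols" using assms(1) by (simp add: burnside_simps)
  then have "x \<in> carrier burnside \<and> Q x"
  proof (induction x rule: frag_induction)
    case (one A)
    then show ?case using assms(3) burnside_basis by (auto simp: symbols_eq)
  qed (use assms burnside_diff burnside_zero in auto)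
  then show ?thesis ..
qed

lemma burnside_mult_basis:
  assumes P: "P \<in> normal_pairs G" and Q: "Q \<in> normal_pairs G"
  shows "frag_of (pair_class G P) \<otimes>\<^bsub>burnside\<^esub> frag_of (pair_class G Q) \<in> carrier burnside"
    "fst Z \<subseteq> carrier G \<Longrightarrow> snd Z \<subseteq> carrier G \<Longrightarrow>
     ghost (frag_of (pair_class G P) \<otimes>\<^bsub>burnside\<^esub> frag_of (pair_class G Q)) Z = mark Z P * mark Z Q"
proof -
  define r :: "'a set \<Rightarrow> 'a" where "r = (\<lambda>D. SOME h. h \<in> D)"
  let ?D = "double_cosets G (fst P) (fst Q)"
  have r: "r D \<in> D" "r D \<in> carrier G" if "D \<in> ?D" for D
    using double_coset_rep[OF P Q that] by (auto simp: r_def)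
  have e: "frag_of (pair_class G P) \<otimes>\<^bsub>burnside\<^esub> frag_of (pair_class G Q)
      = (\<Sum>D\<in>?D. frag_of (pair_class G (meet_pair G (r D) P Q)))"
    using lattice_burnside_mult_basis[of "fst P" "snd P" "fst Q" "snd Q" r] P Q r(1)
    by (simp add: meet_pair_def split_beta)
  have m: "meet_pair G (r D) P Q \<in> normal_pairs G" if "D \<in> ?D" for D
    using meet_pair_normal[OF P Q r(2)[OF that]] .
  have "(\<Sum>D\<in>S. frag_of (pair_class G (meet_pair G (r D) P Q))) \<in> carrier burnside" if "S \<subseteq> ?D" for S
    using that by (induction S rule: infinite_finite_induct)
      (auto intro!: burnside_add burnside_basis m burnside_zero)
  then show "frag_of (pair_class G P) \<otimes>\<^bsub>burnside\<^esub> frag_of (pair_class G Q) \<in> carrier burnside"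
    unfolding e by blast
  assume Z: "fst Z \<subseteq> carrier G" "snd Z \<subseteq> carrier G"
  show "ghost (frag_of (pair_class G P) \<otimes>\<^bsub>burnside\<^esub> frag_of (pair_class G Q)) Z = mark Z P * mark Z Q"
    using mark_mult[OF P Q Z, of r] r(1) by (simp add: e ghost_sum ghost_basis m)
qed

lemma burnside_mult:
  assumes "x \<in> carrier burnside" "y \<in> carrier burnside"
  shows "x \<otimes>\<^bsub>burnside\<^esub> y \<in> carrier burnside \<and>
    (\<forall>Z. fst Z \<subseteq> carrier G \<longrightarrow> snd Z \<subseteq> carrier G \<longrightarrow>
      ghost (x \<otimes>\<^bsub>burnside\<^esub> y) Z = ghost x Z * ghost y Z)"
  using assms(1)
proof (induction x rule: burnside_induct)
  case zero
  then show ?case by (simp add: burnside_simps(2) bilinear_extend_simps burnside_zero ghost_simps)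
next
  case (diff a b)
  then show ?case
    by (simp add: burnside_simps(2) bilinear_extend_simps burnside_diff ghost_simps left_diff_distrib)
next
  case (basis P)
  show ?case
    using assms(2)
  proof (induction y rule: burnside_induct)
    case zero
    then show ?case by (simp add: burnside_simps(2) bilinear_extend_simps burnside_zero ghost_simps)
  next
    case (diff a b)
    then show ?case
      by (simp add: burnside_simps(2) bilinear_extend_simps burnside_diff ghost_simps right_diff_distrib)
  next
    case (basis Q)
    then show ?case using burnside_mult_basis[OF \<open>P \<in> normal_pairs G\<close>] by (simp add: ghost_basis \<open>P \<in> normal_pairs G\<close>)
  qed
qed

lemmas burnside_mult_closed = burnside_mult[THEN conjunct1]

lemma ghost_mult:
  assumes "x \<in> carrier burnside" "y \<in> carrier burnside" "Z \<in> normal_pairs G"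
  shows "ghost (x \<otimes>\<^bsub>burnside\<^esub> y) Z = ghost x Z * ghost y Z"
  using burnside_mult[OF assms(1,2)] normal_pairs_subset[OF assms(3)] by blast

lemma ghost_conj:
  assumes "x \<in> carrier burnside" "Z \<in> normal_pairs G" "a \<in> carrier G"
  shows "ghost x (conj_pair G a Z) = ghost x Z"
  using assms(1)
proof (induction x rule: burnside_induct)
  case (basis P)
  then show ?case using mark_conj_left[OF assms(3) normal_pairs_subset[OF assms(2)]] by (simp add: ghost_basis)
qed (simp_all add: ghost_simps)

lemma whole_pair: "(carrier G, carrier G) \<in> normal_pairs G"
  by (simp add: normal_pairs_def subgroup_self normal_self)

lemma conj_set_whole: "g \<in> carrier G \<Longrightarrow> conj_set G g (carrier G) = carrier G"
  using conj_set_self[OF subgroup_self] .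

lemma ghost_one:
  assumes "Z \<in> normal_pairs G"
  shows "ghost \<one>\<^bsub>burnside\<^esub> Z = 1"
proof -
  have "transporter Z (carrier G, carrier G) = carrier G"
    using normal_pairs_subset[OF assms] by (auto simp: transporter_def conj_set_whole)
  then have "mark Z (carrier G, carrier G) = 1"
    using subgroup_card_pos[OF subgroup_self] div_self[of "card (carrier G)"] by (simp add: mark_def)
  then show ?thesis by (simp add: burnside_simps ghost_basis whole_pair)
qed

lemma burnside_one: "\<one>\<^bsub>burnside\<^esub> \<in> carrier burnside"
  using burnside_basis[OF whole_pair] by (simp add: burnside_simps)

lemma mark_self_pos: "P \<in> normal_pairs G \<Longrightarrow> mark P P \<noteq> 0"
proof -
  assume P: "P \<in> normal_pairs G"
  have "\<one> \<in> transporter P P" using normal_pairs_subset[OF P] by (simp add: transporter_def conj_set_one)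
  then show ?thesis using mark_nonzero_iff[OF normal_pairs_subset[OF P] P] by blast
qed

text \<open>
  A number that grows strictly along proper inclusions of pairs and is invariant under conjugation;
  it serves to pick maximal pairs.
\<close>

definition pair_size :: "'a set \<times> 'a set \<Rightarrow> nat" where
  "pair_size P = card (fst P) + card (snd P)"

lemma pair_le_size:
  assumes "Z \<in> normal_pairs G" "Y \<in> normal_pairs G" "fst Z \<subseteq> fst Y" "snd Z \<subseteq> snd Y"
  shows "pair_size Z \<le> pair_size Y" "pair_size Y \<le> pair_size Z \<Longrightarrow> Z = Y"
proof -
  have f: "finite (fst Y)" "finite (snd Y)" using normal_pairsD[OF assms(2)] subgroup_finite by auto
  have *: "card (fst Z) \<le> card (fst Y)" "card (snd Z) \<le> card (snd Y)"
    using assms f card_mono by auto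
  then show "pair_size Z \<le> pair_size Y" by (simp add: pair_size_def)
  assume "pair_size Y \<le> pair_size Z"
  then have "fst Z = fst Y" "snd Z = snd Y"
    using * card_subset_eq[OF f(1) assms(3)] card_subset_eq[OF f(2) assms(4)] by (auto simp: pair_size_def)
  then show "Z = Y" by (simp add: prod_eq_iff)
qed

lemma pair_size_conj:
  "a \<in> carrier G \<Longrightarrow> P \<in> normal_pairs G \<Longrightarrow> pair_size (conj_pair G a P) = pair_size P"
  using normal_pairs_subset[of P] by (auto simp: pair_size_def conj_pair_def card_conj_set split: prod.splits)

lemma transporter_iff:
  "g \<in> transporter Z P \<longleftrightarrow> g \<in> carrier G \<and> fst Z \<subseteq> fst (conj_pair G g P) \<and> snd Z \<subseteq> snd (conj_pair G g P)"
  by (auto simp: transporter_def conj_pair_def split: prod.splits)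

lemma mark_nonzeroE:
  assumes "Z \<in> normal_pairs G" "P \<in> normal_pairs G" "mark Z P \<noteq> 0"
  obtains g where "g \<in> carrier G" "fst Z \<subseteq> fst (conj_pair G g P)" "snd Z \<subseteq> snd (conj_pair G g P)"
  using assms mark_nonzero_iff[OF normal_pairs_subset[OF assms(1)] assms(2)] transporter_iff by blast

text \<open>
  Evaluate at a pair of maximal size among those whose symbol occurs in \<open>x\<close>. Every other symbol that
  occurs has mark zero there, since a nonzero mark means inclusion up to conjugacy.
\<close>

lemma ghost_injective:
  assumes x: "x \<in> carrier burnside" and 0: "\<And>Z. Z \<in> normal_pairs G \<Longrightarrow> ghost x Z = 0"
  shows "x = 0"
proof (rule ccontr)
  assume "x \<noteq> 0"
  let ?S = "{P \<in> normal_pairs G. pair_class G P \<in> Poly_Mapping.keys x}"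
  have "?S \<noteq> {}"
  proof -
    obtain A where "A \<in> Poly_Mapping.keys x" using \<open>x \<noteq> 0\<close> by (metis all_not_in_conv keys_eq_empty)
    moreover from this have "A \<in> symbols" using x by (auto simp: burnside_simps)
    ultimately show ?thesis by (auto simp: symbols_eq)
  qed
  moreover have "finite ?S" using finite_normal_pairs by simp
  ultimately have "Max (pair_size ` ?S) \<in> pair_size ` ?S" by (intro Max_in) auto
  then obtain P where P: "P \<in> ?S" "\<And>Q. Q \<in> ?S \<Longrightarrow> pair_size Q \<le> pair_size P"
    using \<open>finite ?S\<close> by (metis (no_types, lifting) Max_ge finite_imageI imageE image_eqI)
  then have PN: "P \<in> normal_pairs G" by simp
  have "ghost x P = (\<Sum>A\<in>symbols. if A = pair_class G P then Poly_Mapping.lookup x A * mark P P else 0)"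
    unfolding ghost_def
  proof (intro sum.cong refl)
    fix A assume "A \<in> symbols"
    then obtain Q where Q: "Q \<in> normal_pairs G" "A = pair_class G Q" by (auto simp: symbols_eq)
    obtain a where a: "a \<in> carrier G" "(SOME R. R \<in> A) = conj_pair G a Q"
      unfolding Q(2) by (rule pair_class_rep[OF Q(1)])
    have m: "mark P (SOME R. R \<in> A) = mark P Q"
      using a mark_conj_right normal_pairs_subset[OF Q(1)] by simp
    show "Poly_Mapping.lookup x A * mark P (SOME R. R \<in> A)
        = (if A = pair_class G P then Poly_Mapping.lookup x A * mark P P else 0)"
    proof (cases "A = pair_class G P")
      case True
      then show ?thesis using m mark_pair_class[OF Q(1) PN, of P] Q by simp
    next
      case False
      have "Poly_Mapping.lookup x A = 0" if nz: "mark P Q \<noteq> 0"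
      proof (rule ccontr)
        assume "Poly_Mapping.lookup x A \<noteq> 0"
        then have "pair_size Q \<le> pair_size P" using P(2)[of Q] Q by (simp add: in_keys_iff)
        obtain g where g: "g \<in> carrier G" "fst P \<subseteq> fst (conj_pair G g Q)" "snd P \<subseteq> snd (conj_pair G g Q)"
          using mark_nonzeroE[OF PN Q(1) nz] .
        have "P = conj_pair G g Q"
          using pair_le_size(2)[OF PN normal_pairs_conj[OF g(1) Q(1)] g(2,3)] pair_size_conj[OF g(1) Q(1)]
            \<open>pair_size Q \<le> pair_size P\<close> by simp
        then show False using False Q(2) pair_class_conj[OF g(1) normal_pairs_subset[OF Q(1)]] by simp
      qed
      then show ?thesis using False m by auto
    qed
  qed
  also have "\<dots> = Poly_Mapping.lookup x (pair_class G P) * mark P P"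
    using finite_symbols PN by (simp add: symbols_eq)
  finally show False
    using 0[OF PN] mark_self_pos[OF PN] P(1) by (simp add: in_keys_iff)
qed

section \<open>The image of the ghost map\<close>

definition pair_stabilizer :: "'a set \<times> 'a set \<Rightarrow> 'a set" where
  "pair_stabilizer Z = {n \<in> carrier G. conj_pair G n Z = Z}"

text \<open>
  For $n$ in the stabilizer of $(H, M)$ this is the pair $(\langle n, H\rangle, M)$. A point counted
  at $(H, M)$ is fixed by $n$ if and only if it is counted at this pair.
\<close>

definition adjoin :: "'a \<Rightarrow> 'a set \<times> 'a set \<Rightarrow> 'a set \<times> 'a set" where
  "adjoin n Z = (generate G (insert n (fst Z)), snd Z)"

lemma subgroup_pair_stabilizer:
  assumes "fst Z \<subseteq> carrier G" "snd Z \<subseteq> carrier G"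
  shows "subgroup (pair_stabilizer Z) G"
proof (rule subgroupI)
  show "pair_stabilizer Z \<noteq> {}"
    using assms by (auto simp: pair_stabilizer_def conj_pair_def conj_set_one split: prod.splits intro!: exI[of _ \<one>])
  show "inv a \<in> pair_stabilizer Z" if "a \<in> pair_stabilizer Z" for a
  proof -
    have a: "a \<in> carrier G" "conj_pair G a Z = Z" using that by (auto simp: pair_stabilizer_def)
    have "conj_pair G (inv a) (conj_pair G a Z) = conj_pair G \<one> Z"
      using a(1) assms by (simp add: conj_pair_mult)
    also have "\<dots> = Z" using assms by (auto simp: conj_pair_def conj_set_one split: prod.splits)
    finally show ?thesis using a by (simp add: pair_stabilizer_def)
  qed
  show "a \<otimes> b \<in> pair_stabilizer Z" if "a \<in> pair_stabilizer Z" "b \<in> pair_stabilizer Z" for a b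
    using that assms by (simp add: pair_stabilizer_def flip: conj_pair_mult)
qed (auto simp: pair_stabilizer_def)

lemma fst_subset_pair_stabilizer:
  assumes "Z \<in> normal_pairs G"
  shows "fst Z \<subseteq> pair_stabilizer Z"
  using normal_pairsD[OF assms] conj_set_self
  by (auto simp: pair_stabilizer_def conj_pair_def split: prod.splits)

lemma pair_stabilizer_iff:
  "n \<in> pair_stabilizer Z \<longleftrightarrow> n \<in> carrier G \<and> conj_set G n (fst Z) = fst Z \<and> conj_set G n (snd Z) = snd Z"
  by (auto simp: pair_stabilizer_def conj_pair_def split: prod.splits)

lemma generate_insert_subset_iff:
  assumes "subgroup K G"
  shows "generate G (insert n H) \<subseteq> K \<longleftrightarrow> n \<in> K \<and> H \<subseteq> K"
proof
  assume *: "generate G (insert n H) \<subseteq> K"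
  have "insert n H \<subseteq> generate G (insert n H)" by (auto intro: generate.incl)
  then show "n \<in> K \<and> H \<subseteq> K" using * by blast
next
  assume "n \<in> K \<and> H \<subseteq> K"
  then show "generate G (insert n H) \<subseteq> K" using generate_subgroup_incl[OF _ assms] by blast
qed

lemma adjoin_normal:
  assumes Z: "Z \<in> normal_pairs G" and n: "n \<in> pair_stabilizer Z"
  shows "adjoin n Z \<in> normal_pairs G"
proof -
  note z = normal_pairsD[OF Z]
  let ?J = "generate G (insert n (fst Z))"
  have S: "subgroup (pair_stabilizer (snd Z, snd Z)) G" using subgroup_pair_stabilizer z by simp
  have "?J \<subseteq> pair_stabilizer (snd Z, snd Z)"
    unfolding generate_insert_subset_iff[OF S] using n z by (auto simp: pair_stabilizer_iff)
  then have "conj_set G k (snd Z) = snd Z" if "k \<in> ?J" for k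
    using that by (auto simp: pair_stabilizer_iff)
  moreover have "fst Z \<subseteq> ?J" by (auto intro: generate.incl)
  moreover have "subgroup ?J G"
    using n z by (intro generate_is_subgroup) (auto simp: pair_stabilizer_iff)
  ultimately show ?thesis unfolding adjoin_def normal_pairs_iff using z by blast
qed

text \<open>
  The orbit counting lemma: the stabilizer $N$ of the pair permutes the points counted by
  \<open>mark Z P\<close>, and \<open>mark (adjoin n Z) P\<close> is the number of points fixed by $n$. The sum is therefore $|N|$
  times the number of orbits.
\<close>

lemma sum_mark_adjoin:
  assumes Z: "Z \<in> normal_pairs G" and P: "P \<in> normal_pairs G"
  shows "int (card (pair_stabilizer Z)) dvd (\<Sum>n\<in>pair_stabilizer Z. mark (adjoin n Z) P)"
proof -
  note z = normal_pairsD[OF Z] and p = normal_pairsD[OF P]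
  let ?N = "pair_stabilizer Z" and ?T = "transporter Z P"
  have N: "subgroup ?N G" by (rule subgroup_pair_stabilizer[OF z(5,6)])
  have cl: "dcoset_closed ?N (fst P) ?T"
    by (rule dcoset_closed_transporter[OF N P z(5,6)]) (simp add: pair_stabilizer_def)
  have t: "transporter (adjoin n Z) P = {g \<in> ?T. n \<in> conj_set G g (fst P)}" for n
    unfolding transporter_def adjoin_def fst_conv snd_conv
    using generate_insert_subset_iff[OF subgroup_conj_set[OF _ p(1)]] by blast
  have c: "int (card (transporter (adjoin n Z) P)) = int (card (fst P)) * mark (adjoin n Z) P"
    if "n \<in> ?N" for n
    using card_transporter normal_pairs_subset[OF adjoin_normal[OF Z that]] P by blast
  have "int (card (fst P)) * (\<Sum>n\<in>?N. mark (adjoin n Z) P)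
      = (\<Sum>n\<in>?N. int (card {g \<in> ?T. n \<in> conj_set G g (fst P)}))"
    using c by (simp add: sum_distrib_left t)
  also have "\<dots> = (\<Sum>n\<in>?N. \<Sum>g\<in>{g \<in> ?T. n \<in> conj_set G g (fst P)}. 1)" by simp
  also have "\<dots> = (\<Sum>g\<in>?T. \<Sum>n\<in>{n \<in> ?N. n \<in> conj_set G g (fst P)}. 1)"
    by (rule sum.swap_restrict) (use finite_transporter subgroup_finite[OF N] in auto)
  also have "\<dots> = (\<Sum>g\<in>?T. int (card (?N \<inter> conj_set G g (fst P))) * 1)"
    by (simp add: Int_def)
  also have "\<dots> = int (card ?N * card (fst P)) * (\<Sum>D\<in>dcoset ?N (fst P) ` ?T. 1)"
  proof (rule dcoset_weighted_sum[OF N p(1) cl, of _ "\<lambda>D. SOME g. g \<in> D"])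
    fix D assume "D \<in> dcoset ?N (fst P) ` ?T"
    then obtain g where "g \<in> D" using dcoset_self[OF N p(1)] by (auto simp: transporter_def)
    then show "(SOME g. g \<in> D) \<in> D" by (rule someI)
  qed simp
  finally have "int (card (fst P)) * (\<Sum>n\<in>?N. mark (adjoin n Z) P)
      = int (card (fst P)) * (int (card ?N) * (\<Sum>D\<in>dcoset ?N (fst P) ` ?T. 1))" by simp
  then have "(\<Sum>n\<in>?N. mark (adjoin n Z) P) = int (card ?N) * (\<Sum>D\<in>dcoset ?N (fst P) ` ?T. 1)"
    using subgroup_card_pos[OF p(1)] mult_left_cancel[of "int (card (fst P))"] by simp
  then show ?thesis by simp
qed

text \<open>
  A conjugate of a finite subgroup that contains the subgroup is equal to it.
\<close>

lemma card_mark_self: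
  assumes P: "P \<in> normal_pairs G"
  shows "int (card (pair_stabilizer P)) = int (card (fst P)) * mark P P"
proof -
  note p = normal_pairsD[OF P]
  have "transporter P P = pair_stabilizer P"
  proof (rule Set.set_eqI)
    fix g
    have "A = conj_set G g A" if "g \<in> carrier G" "A \<subseteq> carrier G" "A \<subseteq> conj_set G g A" for A
      using card_subset_eq[of "conj_set G g A" A] that card_conj_set conj_set_carrier fin finite_subset
      by metis
    then show "g \<in> transporter P P \<longleftrightarrow> g \<in> pair_stabilizer P"
      using p(5,6) by (auto simp: transporter_def pair_stabilizer_iff)
  qed
  then show ?thesis using card_transporter[OF p(5,6) P] by simp
qed

text \<open>
  Subtract multiples of symbols until nothing remains. At a maximal pair $P = (H, M)$ of the support
  the congruence reduces to its terms with $n \in H$, because adjoining any other element leads out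
  of the support. It then says that $f(P)$ is a multiple of the mark of the symbol of $P$ at $P$. The set \<open>S\<close>
  stands for the support: it is closed under conjugation and under passing to smaller pairs, so that
  the marks of the subtracted symbol vanish outside \<open>S\<close>.
\<close>

lemma image_criterion_aux:
  fixes f :: "'a set \<times> 'a set \<Rightarrow> int"
  assumes "\<And>Z a. Z \<in> normal_pairs G \<Longrightarrow> a \<in> carrier G \<Longrightarrow> f (conj_pair G a Z) = f Z"
    and "\<And>Z. Z \<in> normal_pairs G \<Longrightarrow>
      int (card (pair_stabilizer Z)) dvd (\<Sum>n\<in>pair_stabilizer Z. f (adjoin n Z))"
    and "S \<subseteq> normal_pairs G"
    and "\<And>Z Y. Z \<in> S \<Longrightarrow> Y \<in> normal_pairs G \<Longrightarrow> fst Y \<subseteq> fst Z \<Longrightarrow> snd Y \<subseteq> snd Z \<Longrightarrow> Y \<in> S"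
    and "\<And>Z a. Z \<in> S \<Longrightarrow> a \<in> carrier G \<Longrightarrow> conj_pair G a Z \<in> S"
    and "\<And>Z. Z \<in> normal_pairs G \<Longrightarrow> Z \<notin> S \<Longrightarrow> f Z = 0"
  shows "\<exists>x\<in>carrier burnside. \<forall>Z\<in>normal_pairs G. ghost x Z = f Z"
  using assms
proof (induction "card S" arbitrary: S f rule: less_induct)
  case less
  note conj = less.prems(1) and cong = less.prems(2) and SN = less.prems(3) and down = less.prems(4)
    and Sconj = less.prems(5) and out = less.prems(6)
  show ?case
  proof (cases "S = {}")
    case True
    then show ?thesis using out burnside_zero by (intro bexI[of _ 0]) (auto simp: ghost_simps)
  next
    case False
    have fS: "finite S" using SN finite_normal_pairs finite_subset by blast
    have "Max (pair_size ` S) \<in> pair_size ` S" using False fS by (intro Max_in) auto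
    then obtain P where P: "P \<in> S" "\<And>Q. Q \<in> S \<Longrightarrow> pair_size Q \<le> pair_size P"
      using fS by (metis Max_ge finite_imageI imageE image_eqI)
    have PN: "P \<in> normal_pairs G" using P SN by blast
    note p = normal_pairsD[OF PN]
    let ?N = "pair_stabilizer P"
    have N: "subgroup ?N G" by (rule subgroup_pair_stabilizer[OF p(5,6)])
    have "(\<Sum>n\<in>?N. f (adjoin n P)) = (\<Sum>n\<in>?N. if n \<in> fst P then f P else 0)"
    proof (intro sum.cong refl)
      fix n assume n: "n \<in> ?N"
      have A: "adjoin n P \<in> normal_pairs G" by (rule adjoin_normal[OF PN n])
      have le: "fst P \<subseteq> fst (adjoin n P)" "snd P \<subseteq> snd (adjoin n P)" "n \<in> fst (adjoin n P)"
        by (auto simp: adjoin_def intro: generate.incl)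
      show "f (adjoin n P) = (if n \<in> fst P then f P else 0)"
      proof (cases "n \<in> fst P")
        case True
        then have "fst (adjoin n P) \<subseteq> fst P"
          using generate_insert_subset_iff[OF p(1), of n "fst P"] by (simp add: adjoin_def)
        then have "adjoin n P = P" using le(1) by (simp add: adjoin_def prod_eq_iff)
        then show ?thesis using True by simp
      next
        case False
        have "adjoin n P \<notin> S"
          using pair_le_size(2)[OF PN A le(1,2)] P(2) le(3) False by metis
        then show ?thesis using out[OF A] False by simp
      qed
    qed
    also have "\<dots> = int (card (fst P)) * f P"
      using subgroup_finite[OF N] fst_subset_pair_stabilizer[OF PN]
      by (simp add: sum.If_cases Int_absorb1)
    finally have "int (card (fst P)) * mark P P dvd int (card (fst P)) * f P"
      using cong[OF PN] card_mark_self[OF PN] by simp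
    then have "mark P P dvd f P" using subgroup_card_pos[OF p(1)] by simp
    then obtain c where c: "f P = mark P P * c" by (auto elim: dvdE)
    define f' where "f' = (\<lambda>Z. f Z - c * mark Z P)"
    define S' where "S' = S - pair_class G P"
    have "\<exists>x\<in>carrier burnside. \<forall>Z\<in>normal_pairs G. ghost x Z = f' Z"
    proof (rule less.hyps[of S'])
      have "P \<in> pair_class G P" by (rule pair_class_self[OF PN])
      then show "card S' < card S"
        unfolding S'_def using fS P(1) by (intro psubset_card_mono) auto
      show "f' (conj_pair G a Z) = f' Z" if "Z \<in> normal_pairs G" "a \<in> carrier G" for Z a
        using conj[OF that] mark_conj_left[OF that(2) normal_pairs_subset[OF that(1)] PN] by (simp add: f'_def)
      show "int (card (pair_stabilizer Z)) dvd (\<Sum>n\<in>pair_stabilizer Z. f' (adjoin n Z))"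
        if Z: "Z \<in> normal_pairs G" for Z
        unfolding f'_def sum_subtractf sum_distrib_left[symmetric]
        by (intro dvd_diff cong[OF Z] dvd_mult sum_mark_adjoin[OF Z PN])
      show "S' \<subseteq> normal_pairs G" using SN by (auto simp: S'_def)
      have cl: "Z \<in> pair_class G P \<longleftrightarrow> (\<exists>a\<in>carrier G. Z = conj_pair G a P)" for Z
        by (auto simp: orbit_def)
      show "conj_pair G a Z \<in> S'" if "Z \<in> S'" "a \<in> carrier G" for Z a
      proof -
        have Z: "Z \<in> S" "Z \<notin> pair_class G P" "Z \<in> normal_pairs G" using that SN by (auto simp: S'_def)
        have "conj_pair G a Z \<notin> pair_class G P"
        proof
          assume "conj_pair G a Z \<in> pair_class G P"
          then obtain b where b: "b \<in> carrier G" "conj_pair G a Z = conj_pair G b P" using cl by blast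
          have "Z = conj_pair G (inv a) (conj_pair G a Z)"
            using that(2) normal_pairs_subset[OF Z(3)]
            by (simp add: conj_pair_mult) (auto simp: conj_pair_def conj_set_one split: prod.splits)
          also have "\<dots> = conj_pair G (inv a \<otimes> b) P" using b that(2) p(5,6) by (simp add: conj_pair_mult)
          finally show False using Z(2) cl that(2) b by auto
        qed
        then show ?thesis using Sconj[OF Z(1) that(2)] by (simp add: S'_def)
      qed
      show "Y \<in> S'" if "Z \<in> S'" "Y \<in> normal_pairs G" "fst Y \<subseteq> fst Z" "snd Y \<subseteq> snd Z" for Z Y
      proof -
        have Z: "Z \<in> S" "Z \<notin> pair_class G P" "Z \<in> normal_pairs G" using that SN by (auto simp: S'_def)
        have "Y \<notin> pair_class G P"
        proof
          assume Y: "Y \<in> pair_class G P"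
          then have "pair_size Y = pair_size P" using cl pair_size_conj[OF _ PN] by auto
          then have "Y = Z" using pair_le_size(2)[OF that(2) Z(3) that(3,4)] P(2)[OF Z(1)] by simp
          then show False using Y Z(2) by simp
        qed
        then show ?thesis using down[OF Z(1) that(2-4)] by (simp add: S'_def)
      qed
      show "f' Z = 0" if Z: "Z \<in> normal_pairs G" "Z \<notin> S'" for Z
      proof (cases "Z \<in> S")
        case True
        then obtain a where a: "a \<in> carrier G" "Z = conj_pair G a P" using Z cl by (auto simp: S'_def)
        then show ?thesis
          using conj[OF PN a(1)] mark_conj_left[OF a(1) p(5,6) PN] by (simp add: f'_def c)
      next
        case False
        have "mark Z P = 0"
        proof (rule ccontr)
          assume "mark Z P \<noteq> 0"
          then obtain g where g: "g \<in> carrier G" "fst Z \<subseteq> fst (conj_pair G g P)" "snd Z \<subseteq> snd (conj_pair G g P)"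
            using mark_nonzeroE[OF Z(1) PN] by blast
          show False using down[OF Sconj[OF P(1) g(1)] Z(1) g(2,3)] False by simp
        qed
        then show ?thesis using out[OF Z(1) False] by (simp add: f'_def)
      qed
    qed
    then obtain x where x: "x \<in> carrier burnside" "\<And>Z. Z \<in> normal_pairs G \<Longrightarrow> ghost x Z = f' Z" by blast
    let ?y = "x + frag_cmul c (frag_of (pair_class G P))"
    have "?y \<in> carrier burnside" using x(1) burnside_add burnside_cmul burnside_basis[OF PN] by blast
    moreover have "ghost ?y Z = f Z" if "Z \<in> normal_pairs G" for Z
      using x(2)[OF that] by (simp add: ghost_simps ghost_basis PN f'_def)
    ultimately show ?thesis by blast
  qed
qed

text \<open>
  A function on pairs is the tuple of marks of a ring element as soon as it satisfies the
  congruences of \<open>sum_mark_adjoin\<close>.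
\<close>

theorem image_criterion:
  fixes f :: "'a set \<times> 'a set \<Rightarrow> int"
  assumes "\<And>Z a. Z \<in> normal_pairs G \<Longrightarrow> a \<in> carrier G \<Longrightarrow> f (conj_pair G a Z) = f Z"
    and "\<And>Z. Z \<in> normal_pairs G \<Longrightarrow>
      int (card (pair_stabilizer Z)) dvd (\<Sum>n\<in>pair_stabilizer Z. f (adjoin n Z))"
  obtains x where "x \<in> carrier burnside" "\<And>Z. Z \<in> normal_pairs G \<Longrightarrow> ghost x Z = f Z"
  using image_criterion_aux[of f "normal_pairs G"] assms normal_pairs_conj by blast

text \<open>
  For these indicator functions the sum in the congruence has all its terms equal.
\<close>

corollary ghost_indicator:
  assumes "\<And>Z a. Z \<in> normal_pairs G \<Longrightarrow> a \<in> carrier G \<Longrightarrow> Q (conj_pair G a Z) \<longleftrightarrow> Q Z"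
    and "\<And>Z n. Z \<in> normal_pairs G \<Longrightarrow> n \<in> pair_stabilizer Z \<Longrightarrow> Q (adjoin n Z) \<longleftrightarrow> Q Z"
  obtains x where "x \<in> carrier burnside" "\<And>Z. Z \<in> normal_pairs G \<Longrightarrow> ghost x Z = of_bool (Q Z)"
proof (rule image_criterion[of "\<lambda>Z. of_bool (Q Z)"])
  show "int (card (pair_stabilizer Z)) dvd (\<Sum>n\<in>pair_stabilizer Z. of_bool (Q (adjoin n Z)))"
    if "Z \<in> normal_pairs G" for Z
    using assms(2)[OF that] by simp
qed (use assms(1) that in auto)

section \<open>Congruences between marks\<close>

lemma subgroup_card_dvd:
  assumes "subgroup J G" "subgroup H G" "J \<subseteq> H"
  shows "card J dvd card H"
proof -
  have "subgroup J (G\<lparr>carrier := H\<rparr>)" using assms subgroup_incl by blast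
  from group.lagrange[OF subgroup_imp_group[OF assms(2)] this]
  have "card (rcosets\<^bsub>G\<lparr>carrier := H\<rparr>\<^esub> J) * card J = card H" by (simp add: order_def)
  then show ?thesis by (rule dvdI[OF trans[OF sym mult.commute]])
qed

text \<open>
  As $K$ is normal in $H$, the group $H$ permutes the points counted at $(K, M)$. Those counted at
  $(H, M)$ are the fixed points, and any other orbit has size $|H : J|$ for a proper subgroup
  $J \geq K$.
\<close>

lemma mark_congruence:
  assumes HM: "(H, M) \<in> normal_pairs G" and KM: "(K, M) \<in> normal_pairs G"
    and KH: "K \<subseteq> H" and norm: "\<And>h. h \<in> H \<Longrightarrow> conj_set G h K = K"
    and d: "\<And>J. subgroup J G \<Longrightarrow> K \<subseteq> J \<Longrightarrow> J \<subset> H \<Longrightarrow> d dvd card H div card J"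
    and P: "P \<in> normal_pairs G"
  shows "int d dvd mark (K, M) P - mark (H, M) P"
proof -
  note h = normal_pairsD[OF HM, simplified] and k = normal_pairsD[OF KM, simplified] and p = normal_pairsD[OF P]
  let ?T1 = "transporter (K, M) P" and ?T2 = "transporter (H, M) P"
  have c1: "dcoset_closed H (fst P) ?T1"
    using dcoset_closed_transporter[OF h(1) P, of "(K, M)"] k h norm by (simp add: conj_pair_def)
  have c2: "dcoset_closed H (fst P) ?T2"
    using dcoset_closed_transporter[OF h(1) P, of "(H, M)"] h conj_set_self[OF h(1)] by (simp add: conj_pair_def)
  have c: "dcoset_closed H (fst P) (?T1 - ?T2)"
    unfolding dcoset_closed_def
  proof (intro conjI ballI subsetI DiffI notI)
    fix g z assume g: "g \<in> ?T1 - ?T2" and z: "z \<in> dcoset H (fst P) g"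
    then show "z \<in> ?T1" using c1 unfolding dcoset_closed_def by blast
    have gG: "g \<in> carrier G" using g by (simp add: transporter_def)
    assume "z \<in> ?T2"
    then have "dcoset H (fst P) z \<subseteq> ?T2" using c2 unfolding dcoset_closed_def by blast
    then show False
      using dcoset_eq_of_mem[OF h(1) p(1) gG z] dcoset_self[OF h(1) p(1) gG] g by blast
  qed (simp add: transporter_def)
  have "d * card (fst P) dvd card (dcoset H (fst P) g)" if g: "g \<in> ?T1 - ?T2" for g
  proof -
    have gG: "g \<in> carrier G" using g by (simp add: transporter_def)
    let ?J = "H \<inter> conj_set G g (fst P)"
    have J: "subgroup ?J G" using subgroups_Inter_pair[OF h(1) subgroup_conj_set[OF gG p(1)]] .
    have KJ: "K \<subseteq> ?J" using KH g by (auto simp: transporter_def)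
    have "\<not> H \<subseteq> conj_set G g (fst P)" using g by (auto simp: transporter_def)
    then have JH: "?J \<subset> H" by blast
    obtain m where m: "card H div card ?J = d * m" using d[OF J KJ JH] by (elim dvdE)
    have "card H = (card H div card ?J) * card ?J"
      using subgroup_card_dvd[OF J h(1)] by simp
    then have "card H = d * m * card ?J" unfolding m .
    then have "card (dcoset H (fst P) g) * card ?J = (d * m * card (fst P)) * card ?J"
      using card_dcoset[OF h(1) p(1) gG] by (simp only: mult_ac)
    then have "card (dcoset H (fst P) g) = d * m * card (fst P)"
      using subgroup_card_pos[OF J] mult_right_cancel[of "card ?J"] by blast
    then show ?thesis by simp
  qed
  then have "d * card (fst P) dvd card (?T1 - ?T2)" by (rule dvd_card_dcoset_closed[OF h(1) p(1) c])
  then have "int (card (fst P)) * int d dvd int (card (?T1 - ?T2))"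
    by (metis int_dvd_int_iff mult.commute of_nat_mult)
  also have "int (card (?T1 - ?T2)) = int (card ?T1) - int (card ?T2)"
  proof -
    have "?T2 \<subseteq> ?T1" using KH by (auto simp: transporter_def)
    then show ?thesis using finite_transporter card_mono[of ?T1 ?T2]
      by (simp add: card_Diff_subset of_nat_diff)
  qed
  also have "\<dots> = int (card (fst P)) * (mark (K, M) P - mark (H, M) P)"
    using card_transporter[of "(K, M)" P] card_transporter[of "(H, M)" P] h k P by (simp add: right_diff_distrib)
  finally show ?thesis using subgroup_card_pos[OF p(1)] by simp
qed

lemma ghost_congruence:
  assumes "(H, M) \<in> normal_pairs G" "(K, M) \<in> normal_pairs G"
    and "K \<subseteq> H" "\<And>h. h \<in> H \<Longrightarrow> conj_set G h K = K"
    and "\<And>J. subgroup J G \<Longrightarrow> K \<subseteq> J \<Longrightarrow> J \<subset> H \<Longrightarrow> d dvd card H div card J"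
    and "x \<in> carrier burnside"
  shows "int d dvd ghost x (K, M) - ghost x (H, M)"
  using assms(6)
proof (induction x rule: burnside_induct)
  case (diff a b)
  have "ghost (a - b) (K, M) - ghost (a - b) (H, M)
      = (ghost a (K, M) - ghost a (H, M)) - (ghost b (K, M) - ghost b (H, M))"
    by (simp add: ghost_simps)
  then show ?case using diff.IH by (metis dvd_diff)
next
  case (basis P)
  then show ?case using mark_congruence[OF assms(1-5), of P] by (simp add: ghost_basis)
qed (simp add: ghost_simps)

section \<open>Solvable subgroups\<close>

lemma solvable_seq_subgroup:
  assumes "solvable_seq G H" "subgroup K G" "K \<subseteq> H"
  shows "solvable_seq G K"
proof -
  obtain n where "(derived G ^^ n) H = {\<one>}" using solvable_imp_trivial_derived_seq assms(1) by blast
  then have "(derived G ^^ n) K \<subseteq> {\<one>}" using mono_exp_of_derived[OF assms(3), of n] by simp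
  then have "(derived G ^^ n) K = {\<one>}"
    using subgroup.one_closed[OF exp_of_derived_is_subgroup[OF assms(2)]] by blast
  then show ?thesis using trivial_derived_seq_imp_solvable assms(2) by blast
qed

lemma solvable_seq_conj:
  assumes "a \<in> carrier G" "solvable_seq G H"
  shows "solvable_seq G (conj_set G a H)"
proof -
  have "group_hom G G (\<lambda>x. a \<otimes> x \<otimes> inv a)"
    using assms(1) is_group by (auto simp: group_hom_def group_hom_axioms_def hom_def m_assoc cancel_assoc)
  from group_hom.solvable_imp_solvable_img[OF this assms(2)] show ?thesis by (simp add: conj_set_eq)
qed

lemma solvable_seq_conj_iff:
  assumes "a \<in> carrier G" "H \<subseteq> carrier G"
  shows "solvable_seq G (conj_set G a H) \<longleftrightarrow> solvable_seq G H"
  using solvable_seq_conj[of a H] solvable_seq_conj[of "inv a" "conj_set G a H"] conj_set_cancel assms by auto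

text \<open>
  The quotient $\langle n, H\rangle / H$ is cyclic, hence commutative. The elements that commute with
  a given one modulo $H$ form a subgroup containing $H$. Applied to $n$ itself this shows that
  everything commutes with $n$ modulo $H$; applied to an arbitrary element it then shows that
  everything commutes.
\<close>

lemma derived_generate_insert:
  assumes H: "subgroup H G" and n: "n \<in> carrier G" "conj_set G n H = H"
  shows "derived G (generate G (insert n H)) \<subseteq> H"
proof -
  let ?J = "generate G (insert n H)"
  let ?N = "pair_stabilizer (H, H)"
  have HG: "H \<subseteq> carrier G" by (rule subgroup.subset[OF H])
  have N: "subgroup ?N G" by (rule subgroup_pair_stabilizer) (simp_all add: HG)
  have HN: "H \<subseteq> ?N" using HG conj_set_self[OF H] by (auto simp: pair_stabilizer_iff)
  have nN: "n \<in> ?N" using n by (simp add: pair_stabilizer_iff)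
  have conjH: "b \<otimes> h \<otimes> inv b \<in> H" if "b \<in> ?N" "h \<in> H" for b h
    using that by (auto simp: pair_stabilizer_iff conj_set_eq)
  define C where "C = (\<lambda>c. {b \<in> ?N. c \<otimes> b \<otimes> inv c \<otimes> inv b \<in> H})"
  have C: "subgroup (C c) G" if c: "c \<in> ?N" for c
  proof (rule subgroupI)
    have cG: "c \<in> carrier G" using c by (simp add: pair_stabilizer_iff)
    have NG: "b \<in> carrier G" if "b \<in> ?N" for b using that by (simp add: pair_stabilizer_iff)
    show "C c \<subseteq> carrier G" by (auto simp: C_def NG)
    have "\<one> \<in> C c" using subgroup.one_closed[OF N] subgroup.one_closed[OF H] cG by (simp add: C_def)
    then show "C c \<noteq> {}" by auto
    show "inv b \<in> C c" if "b \<in> C c" for b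
    proof -
      have b: "b \<in> ?N" "b \<in> carrier G" "c \<otimes> b \<otimes> inv c \<otimes> inv b \<in> H" using that NG by (auto simp: C_def)
      have ib: "inv b \<in> ?N" using subgroup.m_inv_closed[OF N b(1)] .
      have "inv b \<otimes> inv (c \<otimes> b \<otimes> inv c \<otimes> inv b) \<otimes> inv (inv b) \<in> H"
        using conjH[OF ib subgroup.m_inv_closed[OF H b(3)]] .
      moreover have "inv b \<otimes> inv (c \<otimes> b \<otimes> inv c \<otimes> inv b) \<otimes> inv (inv b) = c \<otimes> inv b \<otimes> inv c \<otimes> inv (inv b)"
        using b cG by (simp add: inv_mult_group m_assoc cancel_assoc)
      ultimately show ?thesis using ib by (simp add: C_def)
    qed
    show "b \<otimes> b' \<in> C c" if "b \<in> C c" "b' \<in> C c" for b b'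
    proof -
      have b: "b \<in> ?N" "b \<in> carrier G" "c \<otimes> b \<otimes> inv c \<otimes> inv b \<in> H" using that NG by (auto simp: C_def)
      have b': "b' \<in> ?N" "b' \<in> carrier G" "c \<otimes> b' \<otimes> inv c \<otimes> inv b' \<in> H" using that NG by (auto simp: C_def)
      have "(c \<otimes> b \<otimes> inv c \<otimes> inv b) \<otimes> (b \<otimes> (c \<otimes> b' \<otimes> inv c \<otimes> inv b') \<otimes> inv b) \<in> H"
        using subgroup.m_closed[OF H b(3) conjH[OF b(1) b'(3)]] .
      moreover have "(c \<otimes> b \<otimes> inv c \<otimes> inv b) \<otimes> (b \<otimes> (c \<otimes> b' \<otimes> inv c \<otimes> inv b') \<otimes> inv b)
          = c \<otimes> (b \<otimes> b') \<otimes> inv c \<otimes> inv (b \<otimes> b')"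
        using b b' cG by (simp add: inv_mult_group m_assoc cancel_assoc)
      ultimately show ?thesis using subgroup.m_closed[OF N b(1) b'(1)] by (simp add: C_def)
    qed
  qed
  have HC: "H \<subseteq> C c" if c: "c \<in> ?N" for c
  proof
    fix h assume h: "h \<in> H"
    have "(c \<otimes> h \<otimes> inv c) \<otimes> inv h \<in> H"
      using subgroup.m_closed[OF H conjH[OF c h] subgroup.m_inv_closed[OF H h]] .
    then show "h \<in> C c" using h HN by (auto simp: C_def)
  qed
  have sym: "c \<in> C b" if b: "b \<in> C c" and c: "c \<in> ?N" for b c
  proof -
    have "inv (c \<otimes> b \<otimes> inv c \<otimes> inv b) \<in> H" using subgroup.m_inv_closed[OF H] b by (auto simp: C_def)
    moreover have "inv (c \<otimes> b \<otimes> inv c \<otimes> inv b) = b \<otimes> c \<otimes> inv b \<otimes> inv c"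
      using b c by (auto simp: C_def pair_stabilizer_iff inv_mult_group m_assoc)
    ultimately show ?thesis using c by (simp add: C_def)
  qed
  have JN: "?J \<subseteq> ?N" unfolding generate_insert_subset_iff[OF N] using nN HN by blast
  \<comment> \<open>Every element of \<open>?J\<close> commutes with \<open>n\<close> modulo \<open>H\<close>, and then, by symmetry, with every other element.\<close>
  have "n \<in> C n" using n subgroup.one_closed[OF H] nN by (simp add: C_def m_assoc)
  then have "?J \<subseteq> C n" unfolding generate_insert_subset_iff[OF C[OF nN]] using HC[OF nN] by blast
  then have JC: "?J \<subseteq> C b" if "b \<in> ?J" for b
    unfolding generate_insert_subset_iff[OF C[OF subsetD[OF JN that]]]
    using HC[OF subsetD[OF JN that]] sym[OF _ nN] that by blast
  have "derived_set G ?J \<subseteq> H"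
  proof
    fix z assume "z \<in> derived_set G ?J"
    then obtain a b where ab: "a \<in> ?J" "b \<in> ?J" "z = a \<otimes> b \<otimes> inv a \<otimes> inv b" by auto
    then show "z \<in> H" using JC[OF ab(1)] by (auto simp: C_def)
  qed
  then show ?thesis unfolding derived_def by (rule generate_subgroup_incl[OF _ H])
qed

lemma solvable_seq_adjoin_iff:
  assumes H: "subgroup H G" and n: "n \<in> carrier G" "conj_set G n H = H"
  shows "solvable_seq G (generate G (insert n H)) \<longleftrightarrow> solvable_seq G H"
proof
  let ?J = "generate G (insert n H)"
  have J: "subgroup ?J G" using n subgroup.subset[OF H] by (intro generate_is_subgroup) auto
  show "solvable_seq G ?J \<Longrightarrow> solvable_seq G H"
    using solvable_seq_subgroup H by (auto intro: generate.incl)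
  assume "solvable_seq G H"
  then have "solvable_seq G (derived G ?J)"
    using derived_generate_insert[OF assms] derived_is_subgroup[OF subgroup.subset[OF J]]
    by (blast intro: solvable_seq_subgroup)
  then show "solvable_seq G ?J" by (rule augment_solvable_seq[OF J])
qed

text \<open>
  $H/M$ is solvable and not trivial, hence not perfect: the preimage $K_0$ of its derived subgroup is
  proper. A maximal proper subgroup of $H$ above $K_0$ contains the derived subgroup of $H$, which
  makes it normal.
\<close>

lemma solvable_maximal_normal:
  assumes HM: "(H, M) \<in> normal_pairs G" and "M \<noteq> H" and sol: "solvable_seq G H"
  obtains K where "subgroup K G" "M \<subseteq> K" "K \<subset> H" "\<And>h. h \<in> H \<Longrightarrow> conj_set G h K = K"
    "\<And>J. subgroup J G \<Longrightarrow> K \<subseteq> J \<Longrightarrow> J \<subset> H \<Longrightarrow> J = K"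
proof -
  note h = normal_pairsD[OF HM, simplified]
  let ?H = "G\<lparr>carrier := H\<rparr>"
  interpret H: group ?H using h(1) by (rule subgroup_imp_group)
  interpret M: normal M ?H using HM by (simp add: normal_pairs_def)
  let ?\<pi> = "\<lambda>x. M #>\<^bsub>?H\<^esub> x"
  interpret \<pi>: group_hom ?H "?H Mod M" ?\<pi>
    using M.r_coset_hom_Mod M.factorgroup_is_group H.is_group
    by (simp add: group_hom_def group_hom_axioms_def)
  have subD: "subgroup (derived G H) G" by (rule derived_is_subgroup[OF h(5)])
  have DH: "derived G H \<subseteq> H" using derived_incl[OF _ h(1)] by blast
  define K0 where "K0 = {x \<in> H. ?\<pi> x \<in> ?\<pi> ` derived G H}"
  have subK0: "subgroup K0 G"
  proof -
    have D': "subgroup (derived G H) ?H" using subgroup_incl[OF subD h(1) DH] .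
    have im: "subgroup (?\<pi> ` derived G H) (?H Mod M)" by (rule \<pi>.subgroup_img_is_subgroup[OF D'])
    have "subgroup K0 ?H"
    proof (rule H.subgroupI)
      have "\<one> \<in> K0" using subgroup.one_closed[OF subD] subgroup.one_closed[OF h(1)] by (simp add: K0_def)
      then show "K0 \<noteq> {}" by blast
      show "inv\<^bsub>?H\<^esub> a \<in> K0" if "a \<in> K0" for a
        using that subgroup.m_inv_closed[OF im, of "?\<pi> a"] \<pi>.hom_inv[of a] H.inv_closed[of a]
        by (simp add: K0_def)
      show "a \<otimes>\<^bsub>?H\<^esub> b \<in> K0" if "a \<in> K0" "b \<in> K0" for a b
        using that subgroup.m_closed[OF im, of "?\<pi> a" "?\<pi> b"] \<pi>.hom_mult[of a b] H.m_closed[of a b]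
        by (simp add: K0_def)
    qed (auto simp: K0_def)
    then show ?thesis by (rule incl_subgroup[OF h(1)])
  qed
  have one: "?\<pi> \<one> = M" using H.coset_mult_one[of M] h(3) by simp
  have MK0: "M \<subseteq> K0"
  proof
    fix m assume m: "m \<in> M"
    then have "?\<pi> m = M" using H.coset_join2[of m M] h(3) M.subgroup_axioms by auto
    then have "?\<pi> m = ?\<pi> \<one>" using one by simp
    then show "m \<in> K0" using m h(3) subgroup.one_closed[OF subD] by (auto simp: K0_def)
  qed
  have "K0 \<noteq> H"
  proof
    \<comment> \<open>A perfect image would survive in all terms of the derived series, the last of which is trivial.\<close>
    assume "K0 = H"
    then have "?\<pi> ` H \<subseteq> ?\<pi> ` derived G H" by (auto simp: K0_def)
    then have im: "?\<pi> ` H = ?\<pi> ` derived G H" using DH by blast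
    have fix1: "derived (?H Mod M) (?\<pi> ` H) = ?\<pi> ` H"
      using \<pi>.derived_img[of H] derived_consistent[OF _ h(1), of H] im by simp
    have "(derived (?H Mod M) ^^ n) (?\<pi> ` H) = ?\<pi> ` H" for n
      by (induction n) (simp, simp only: funpow.simps comp_apply fix1)
    then have iter: "?\<pi> ` ((derived ?H ^^ n) H) = ?\<pi> ` H" for n
      using \<pi>.exp_of_derived_img[of H n] by simp
    have cons: "(derived ?H ^^ n) H = (derived G ^^ n) H \<and> (derived G ^^ n) H \<subseteq> H" for n
    proof (induction n)
      case (Suc n)
      then show ?case using derived_consistent[OF _ h(1)] derived_incl[OF _ h(1)] by auto
    qed simp
    obtain n where n: "(derived G ^^ n) H = {\<one>}" using solvable_imp_trivial_derived_seq[OF sol] by blast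
    have "?\<pi> ` {\<one>} = ?\<pi> ` H" using iter[of n] cons[of n] n by simp
    then have all: "?\<pi> x = ?\<pi> \<one>" if "x \<in> H" for x using that by blast
    have "H \<subseteq> M"
    proof
      fix x assume x: "x \<in> H"
      have "?\<pi> x = M" using all[OF x] one by (rule trans)
      then show "x \<in> M" using H.coset_join1[of M x] x M.subgroup_axioms by simp
    qed
    then show False using \<open>M \<noteq> H\<close> h(3) by blast
  qed
  then have K0H: "K0 \<subset> H" by (auto simp: K0_def)
  let ?S = "{K. subgroup K G \<and> K0 \<subseteq> K \<and> K \<subset> H}"
  have "finite ?S" by (rule finite_subset[of _ "Pow H"]) (use subgroup_finite[OF h(1)] in auto)
  moreover have "?S \<noteq> {}" using subK0 K0H by blast
  ultimately obtain K where K: "K \<in> ?S" "\<And>J. J \<in> ?S \<Longrightarrow> K \<subseteq> J \<Longrightarrow> J = K"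
    using finite_has_maximal[of ?S] by (metis (no_types, lifting))
  have DK: "derived G H \<subseteq> K" using K(1) DH by (auto simp: K0_def)
  have sub: "conj_set G y K \<subseteq> K" if y: "y \<in> H" for y
  proof
    fix z assume "z \<in> conj_set G y K"
    then obtain k where k: "k \<in> K" "z = y \<otimes> k \<otimes> inv y" by (auto simp: conj_set_eq)
    have kH: "k \<in> H" using k K by auto
    have "y \<otimes> k \<otimes> inv y \<otimes> inv k \<in> derived_set G H" using y kH by auto
    then have "y \<otimes> k \<otimes> inv y \<otimes> inv k \<in> K"
      using DK unfolding derived_def by (meson generate.incl subsetD)
    then have "(y \<otimes> k \<otimes> inv y \<otimes> inv k) \<otimes> k \<in> K" using k K subgroup.m_closed by fastforce
    then show "z \<in> K" using y kH h(5) k by (simp add: m_assoc subset_iff)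
  qed
  have KG: "K \<subseteq> carrier G" using K h(5) by auto
  have "conj_set G y K = K" if y: "y \<in> H" for y
    using sub[OF y] card_subset_eq[of K "conj_set G y K"] card_conj_set[of y K] KG y h(5) fin finite_subset
    by (metis subsetD)
  then show thesis
    using that[of K] K MK0 by (metis (mono_tags, lifting) mem_Collect_eq order_trans)
qed

section \<open>Values of idempotents and indicator functions\<close>

text \<open>
  Induction on $|H|$. For a maximal subgroup $K \geq M$ that is normal in $H$, all subgroups $J$ in
  \<open>ghost_congruence\<close> equal $K$, so the values at $(H, M)$ and $(K, M)$ agree modulo $|H : K| > 1$; being
  $0$ or $1$, they are equal.
\<close>

lemma ghost_solvable_constant:
  assumes x: "x \<in> carrier burnside" and 01: "\<And>Z. Z \<in> normal_pairs G \<Longrightarrow> ghost x Z \<in> {0, 1}"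
    and sol: "solvable_seq G H" and HM: "(H, M) \<in> normal_pairs G"
  shows "ghost x (H, M) = ghost x (M, M)"
  using sol HM
proof (induction "card H" arbitrary: H rule: less_induct)
  case less
  note h = normal_pairsD[OF less.prems(2), simplified]
  show ?case
  proof (cases "M = H")
    case False
    then obtain K where K: "subgroup K G" "M \<subseteq> K" "K \<subset> H" "\<And>h. h \<in> H \<Longrightarrow> conj_set G h K = K"
      "\<And>J. subgroup J G \<Longrightarrow> K \<subseteq> J \<Longrightarrow> J \<subset> H \<Longrightarrow> J = K"
      using solvable_maximal_normal less.prems by metis
    have KM: "(K, M) \<in> normal_pairs G" using K h by (auto simp: normal_pairs_iff)
    have cK: "card K < card H" using K(3) subgroup_finite[OF h(1)] by (simp add: psubset_card_mono)
    have "solvable_seq G K" using solvable_seq_subgroup less.prems K by blast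
    then have "ghost x (K, M) = ghost x (M, M)" using less.hyps[OF cK] KM by blast
    moreover have "int (card H div card K) dvd ghost x (K, M) - ghost x (H, M)"
    proof (rule ghost_congruence[OF less.prems(2) KM _ K(4) _ x])
      show "card H div card K dvd card H div card J" if "subgroup J G" "K \<subseteq> J" "J \<subset> H" for J
        using K(5)[OF that] by simp
    qed (use K in auto)
    moreover have "card H div card K > 1"
    proof -
      obtain m where m: "card H = card K * m" using subgroup_card_dvd[OF K(1) h(1)] K(3) by (auto elim: dvdE)
      have "m \<noteq> 0" using m cK by auto
      moreover have "m \<noteq> 1" using m cK by auto
      ultimately have "m > 1" by linarith
      then show ?thesis using m subgroup_card_pos[OF K(1)] by simp
    qed
    moreover have "ghost x (K, M) \<in> {0, 1}" "ghost x (H, M) \<in> {0, 1}" using 01 KM less.prems(2) by blast+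
    ultimately show ?thesis
      using two_valued_congruent[of "int (card H div card K)" 1 "ghost x (K, M)" "ghost x (H, M)"]
      by (metis int_dvd_int_iff nat_dvd_1_iff_1 of_nat_1 order_less_irrefl)
  qed simp
qed

lemma ghost_p_group_congruence:
  assumes x: "x \<in> carrier burnside" and q: "Factorial_Ring.prime (q::nat)"
    and H: "card H = q ^ n" and HM: "(H, M) \<in> normal_pairs G"
  shows "int q dvd ghost x (M, M) - ghost x (H, M)"
proof (rule ghost_congruence[OF HM _ _ _ _ x])
  note h = normal_pairsD[OF HM, simplified]
  show "(M, M) \<in> normal_pairs G" using h conj_set_self[OF h(2)] by (auto simp: normal_pairs_iff)
  show "M \<subseteq> H" "\<And>y. y \<in> H \<Longrightarrow> conj_set G y M = M" using h by auto
  show "q dvd card H div card J" if J: "subgroup J G" "M \<subseteq> J" "J \<subset> H" for J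
  proof -
    have d: "card J dvd q ^ n" using subgroup_card_dvd[OF J(1) h(1)] J H by auto
    then obtain i where i: "i \<le> n" "card J = q ^ i" using divides_primepow_nat[OF q] by blast
    have "card J < card H" using J subgroup_finite[OF h(1)] by (simp add: psubset_card_mono)
    then have "i \<noteq> n" using i H by auto
    then have "i < n" using i by simp
    then have "q ^ n = q ^ (n - i) * q ^ i" by (simp flip: power_add)
    then have "card H div card J = q ^ (n - i)" using H i q by (simp add: prime_gt_0_nat)
    then show ?thesis using \<open>i < n\<close> by simp
  qed
qed

lemma trivial_pair_iff: "(H, {\<one>}) \<in> normal_pairs G \<longleftrightarrow> subgroup H G"
  using triv_subgroup subgroup.one_closed subgroup.subset
  by (fastforce simp: normal_pairs_iff conj_set_eq)

lemma conj_set_trivial: "a \<in> carrier G \<Longrightarrow> conj_set G a {\<one>} = {\<one>}"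
  by (simp add: conj_set_eq)

lemma conj_set_eq_trivial: "a \<in> carrier G \<Longrightarrow> M \<subseteq> carrier G \<Longrightarrow> conj_set G a M = {\<one>} \<longleftrightarrow> M = {\<one>}"
  using conj_set_cancel(2)[of a M] conj_set_trivial[of "inv a"] conj_set_trivial[of a] by auto

text \<open>
  Adjoining to $H$ an element that normalizes it does not affect solvability.
\<close>

lemma solvable_idempotent:
  obtains x where "x \<in> carrier burnside"
    "\<And>Z. Z \<in> normal_pairs G \<Longrightarrow> ghost x Z = of_bool (snd Z = {\<one>} \<and> solvable_seq G (fst Z))"
proof (rule ghost_indicator[of "\<lambda>Z. snd Z = {\<one>} \<and> solvable_seq G (fst Z)"])
  show "(snd (conj_pair G a Z) = {\<one>} \<and> solvable_seq G (fst (conj_pair G a Z)))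
      \<longleftrightarrow> (snd Z = {\<one>} \<and> solvable_seq G (fst Z))" if "Z \<in> normal_pairs G" "a \<in> carrier G" for Z a
    using that(2) normal_pairs_subset[OF that(1)]
    by (simp add: conj_pair_def conj_set_eq_trivial solvable_seq_conj_iff split_beta)
  show "(snd (adjoin n Z) = {\<one>} \<and> solvable_seq G (fst (adjoin n Z)))
      \<longleftrightarrow> (snd Z = {\<one>} \<and> solvable_seq G (fst Z))" if "Z \<in> normal_pairs G" "n \<in> pair_stabilizer Z" for Z n
    using that(2) solvable_seq_adjoin_iff[OF normal_pairsD(1)[OF that(1)]]
    by (auto simp: adjoin_def pair_stabilizer_iff)
qed (use that in blast)

text \<open>
  Adjoining an element leaves the second component of a pair unchanged, so the criterion holds.
\<close>

lemma conjugacy_idempotent: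
  assumes L: "L \<subseteq> carrier G"
  obtains x where "x \<in> carrier burnside"
    "\<And>Z. Z \<in> normal_pairs G \<Longrightarrow> ghost x Z = of_bool (\<exists>a\<in>carrier G. snd Z = conj_set G a L)"
proof (rule ghost_indicator[of "\<lambda>Z. \<exists>a\<in>carrier G. snd Z = conj_set G a L"])
  show "(\<exists>b\<in>carrier G. snd (conj_pair G a Z) = conj_set G b L) \<longleftrightarrow> (\<exists>b\<in>carrier G. snd Z = conj_set G b L)"
    if "Z \<in> normal_pairs G" "a \<in> carrier G" for Z a
  proof -
    have e: "snd (conj_pair G a Z) = conj_set G a (snd Z)" by (simp add: conj_pair_def split: prod.splits)
    have "snd Z = conj_set G (inv a \<otimes> b) L" if "conj_set G a (snd Z) = conj_set G b L" "b \<in> carrier G" for b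
      using that L \<open>a \<in> carrier G\<close> conj_set_cancel(2)[of a "snd Z"] normal_pairs_subset[OF \<open>Z \<in> normal_pairs G\<close>]
      by (simp add: conj_set_mult)
    moreover have "conj_set G a (snd Z) = conj_set G (a \<otimes> b) L" if "snd Z = conj_set G b L" "b \<in> carrier G" for b
      using that L \<open>a \<in> carrier G\<close> by (simp add: conj_set_mult)
    ultimately show ?thesis unfolding e using that(2) by (meson inv_closed m_closed)
  qed
qed (use that in \<open>auto simp: adjoin_def\<close>)

section \<open>Supports of idempotents\<close>

text \<open>
  The supports of the idempotents of $R_{(p)}$, without reference to $R_{(p)}$ itself: up to a unit
  the indicator function of the set has to consist of the marks of an element of $R$.
\<close>

definition supports :: "enat \<Rightarrow> ('a set \<times> 'a set) set set" where
  "supports p = {S. S \<subseteq> normal_pairs G \<and>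
     (\<exists>x\<in>carrier burnside. \<exists>b. unit_at p b \<and> (\<forall>Z\<in>normal_pairs G. ghost x Z = b * of_bool (Z \<in> S)))}"

lemma supports_diff:
  assumes p: "p = \<infinity> \<or> (\<exists>q::nat. Factorial_Ring.prime q \<and> p = enat q)"
    and "S \<in> supports p" "T \<in> supports p" "T \<subseteq> S"
  shows "S - T \<in> supports p"
proof -
  obtain x b where x: "x \<in> carrier burnside" "unit_at p b" "\<And>Z. Z \<in> normal_pairs G \<Longrightarrow> ghost x Z = b * of_bool (Z \<in> S)"
    using assms(2) by (auto simp: supports_def)
  obtain y c where y: "y \<in> carrier burnside" "unit_at p c" "\<And>Z. Z \<in> normal_pairs G \<Longrightarrow> ghost y Z = c * of_bool (Z \<in> T)"
    using assms(3) by (auto simp: supports_def)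
  let ?z = "frag_cmul c x - frag_cmul b y"
  have "?z \<in> carrier burnside" using x y by (intro burnside_diff burnside_cmul)
  moreover have "ghost ?z Z = (b * c) * of_bool (Z \<in> S - T)" if "Z \<in> normal_pairs G" for Z
    using x(3)[OF that] y(3)[OF that] assms(4) by (auto simp: ghost_simps)
  moreover have "unit_at p (b * c)" using unit_at_mult p x y by blast
  moreover have "S - T \<subseteq> normal_pairs G" using assms(2) by (auto simp: supports_def)
  ultimately show ?thesis unfolding supports_def by blast
qed

text \<open>
  The blocks of pairs that are indexed by the conjugacy classes of subgroups.
\<close>

definition label_class :: "'a set \<Rightarrow> ('a set \<times> 'a set) set" where
  "label_class L = {Z \<in> normal_pairs G. \<exists>a\<in>carrier G. snd Z = conj_set G a L}"

lemma label_class_support: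
  assumes "p = \<infinity> \<or> (\<exists>q::nat. Factorial_Ring.prime q \<and> p = enat q)" "L \<subseteq> carrier G"
  shows "label_class L \<in> supports p"
proof -
  obtain x where "x \<in> carrier burnside"
    "\<And>Z. Z \<in> normal_pairs G \<Longrightarrow> ghost x Z = of_bool (\<exists>a\<in>carrier G. snd Z = conj_set G a L)"
    using conjugacy_idempotent[OF assms(2)] by blast
  then show ?thesis
    unfolding supports_def using unit_at_one[OF assms(1)]
    by (auto simp: label_class_def intro!: bexI[of _ x] exI[of _ 1])
qed

lemma diagonal_normal: "subgroup M G \<Longrightarrow> (M, M) \<in> normal_pairs G"
  using conj_set_self by (simp add: normal_pairs_iff)

lemma card_subgroup_p_group:
  assumes "Factorial_Ring.prime (q::nat)" "order G = q ^ n" "subgroup H G"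
  obtains k where "card H = q ^ k"
proof -
  have "card H dvd q ^ n" using subgroup_card_dvd[OF assms(3) subgroup_self] subgroup.subset[OF assms(3)] assms(2)
    by (simp add: order_def)
  then show thesis using divides_primepow_nat[OF assms(1)] that by blast
qed

text \<open>
  No support separates $(H, M)$ from $(M, M)$, which is why the blocks of pairs do not split.
\<close>

lemma supports_of_p_group:
  assumes p: "p = \<infinity> \<or> (\<exists>q::nat. Factorial_Ring.prime q \<and> p = enat q)"
    and G: "is_p_group p G" and S: "S \<in> supports p" and Z: "(H, M) \<in> normal_pairs G"
  shows "(H, M) \<in> S \<longleftrightarrow> (M, M) \<in> S"
proof -
  have MM: "(M, M) \<in> normal_pairs G" using diagonal_normal normal_pairsD(2)[OF Z] by simp
  obtain x b where x: "x \<in> carrier burnside" "unit_at p b" "\<And>Z. Z \<in> normal_pairs G \<Longrightarrow> ghost x Z = b * of_bool (Z \<in> S)"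
    using S by (auto simp: supports_def)
  have b0: "b \<noteq> 0" using x(2) by (auto simp: unit_at_def split: enat.splits)
  have H: "subgroup H G" using normal_pairsD(1)[OF Z] by simp
  have "ghost x (H, M) = ghost x (M, M)"
  proof (cases p)
    case (enat q)
    then have q: "Factorial_Ring.prime q" using p by auto
    obtain n where "order G = q ^ n" using G enat by (auto simp: is_p_group_def)
    then obtain k where k: "card H = q ^ k" using card_subgroup_p_group[OF q _ H] by blast
    have "\<not> int q dvd b" using x(2) enat by (simp add: unit_at_def)
    then have "ghost x (M, M) = ghost x (H, M)"
      using two_valued_congruent[OF _ ghost_p_group_congruence[OF x(1) q k Z]] x(3)[OF MM] x(3)[OF Z] by simp
    then show ?thesis by simp
  next
    case infinity
    then have "b = 1" using x(2) by (simp add: unit_at_def)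
    moreover have "solvable_seq G H" using solvable_subgroup[OF H] G infinity by (simp add: is_p_group_def)
    ultimately show ?thesis using ghost_solvable_constant[OF x(1) _ _ Z] x(3) by simp
  qed
  then show ?thesis using x(3)[OF MM] x(3)[OF Z] b0 by (auto split: if_splits)
qed

lemma supports_conj:
  assumes "S \<in> supports p" "Z \<in> normal_pairs G" "a \<in> carrier G"
  shows "conj_pair G a Z \<in> S \<longleftrightarrow> Z \<in> S"
proof -
  obtain x b where x: "x \<in> carrier burnside" "unit_at p b" "\<And>Z. Z \<in> normal_pairs G \<Longrightarrow> ghost x Z = b * of_bool (Z \<in> S)"
    using assms(1) by (auto simp: supports_def)
  have b0: "b \<noteq> 0" using x(2) by (auto simp: unit_at_def split: enat.splits)
  show ?thesis
    using ghost_conj[OF x(1) assms(2,3)] x(3)[OF assms(2)] x(3)[OF normal_pairs_conj[OF assms(3,2)]] b0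
    by (auto split: if_splits)
qed

lemma ghost_product:
  assumes "x \<in> carrier burnside" "finite V"
  shows "\<exists>z\<in>carrier burnside. \<forall>Z\<in>normal_pairs G. ghost z Z = (\<Prod>v\<in>V. v - ghost x Z)"
  using assms(2)
proof (induction V)
  case empty
  then show ?case using burnside_one ghost_one by (intro bexI[of _ "\<one>\<^bsub>burnside\<^esub>"]) simp_all
next
  case (insert v V)
  then obtain z where z: "z \<in> carrier burnside" "\<And>Z. Z \<in> normal_pairs G \<Longrightarrow> ghost z Z = (\<Prod>v\<in>V. v - ghost x Z)"
    by blast
  let ?w = "frag_cmul v \<one>\<^bsub>burnside\<^esub> - x"
  have w: "?w \<in> carrier burnside" using burnside_one assms(1) by (intro burnside_diff burnside_cmul)
  have "ghost (?w \<otimes>\<^bsub>burnside\<^esub> z) Z = (\<Prod>v\<in>insert v V. v - ghost x Z)" if "Z \<in> normal_pairs G" for Z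
    using ghost_mult[OF w z(1) that] z(2)[OF that] ghost_one[OF that] insert.hyps by (simp add: ghost_simps)
  then show ?case using burnside_mult_closed[OF w z(1)] by blast
qed

text \<open>
  Let $x = [(G/P)_1]$ for a Sylow $p$-subgroup $P$. A nonzero mark of $x$ occurs only at $(H, 1)$ with
  $H$ contained in a conjugate of $P$. Conversely, for a $p$-group $H$ the mark at $(H, 1)$ is
  congruent to $|G : P|$ modulo $p$. If $V$ is the finite set of values at these pairs and $U$ the
  product of its elements, then $U - \prod_{v \in V}(v - x)$ has marks $U$ there and $0$ elsewhere.
\<close>

lemma p_subgroups_support:
  assumes q: "Factorial_Ring.prime (q::nat)"
  shows "{Z \<in> normal_pairs G. snd Z = {\<one>} \<and> (\<exists>n. card (fst Z) = q ^ n)} \<in> supports (enat q)"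
    (is "?S \<in> _")
proof -
  have o0: "order G \<noteq> 0" using subgroup_card_pos[OF subgroup_self] by (simp add: order_def)
  obtain a m where m: "order G = q ^ a * m" "\<not> q dvd m"
    using multiplicity_decompose'[of "order G" q] o0 q by (metis not_prime_unit)
  obtain P where P: "subgroup P G" "card P = q ^ a" using sylow_thm[OF q is_group m(1) fin] by blast
  have PN: "(P, {\<one>}) \<in> normal_pairs G" using P trivial_pair_iff by blast
  define x where "x = frag_of (pair_class G (P, {\<one>}))"
  have x: "x \<in> carrier burnside" unfolding x_def by (rule burnside_basis[OF PN])
  have gx: "ghost x Z = mark Z (P, {\<one>})" for Z unfolding x_def by (rule ghost_basis[OF PN])
  have tr: "({\<one>}, {\<one>}) \<in> normal_pairs G" using triv_subgroup trivial_pair_iff by blast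
  have m1: "mark ({\<one>}, {\<one>}) (P, {\<one>}) = int m"
  proof -
    have "transporter ({\<one>}, {\<one>}) (P, {\<one>}) = carrier G"
      using subgroup.one_closed[OF subgroup_conj_set[OF _ P(1)]] by (auto simp: transporter_def conj_set_trivial)
    then have "int (order G) = int (card P) * mark ({\<one>}, {\<one>}) (P, {\<one>})"
      using card_transporter[of "({\<one>}, {\<one>})" "(P, {\<one>})"] PN by (simp add: order_def)
    then show ?thesis using m(1) P q by (simp add: prime_gt_0_nat)
  qed
  have good: "\<not> int q dvd ghost x (H, {\<one>})" if H: "subgroup H G" "card H = q ^ n" for H n
  proof
    assume d: "int q dvd ghost x (H, {\<one>})"
    have c: "int q dvd ghost x ({\<one>}, {\<one>}) - ghost x (H, {\<one>})"
      using ghost_p_group_congruence[OF x q H(2)] trivial_pair_iff H(1) by blast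
    then have "int q dvd int m" using dvd_add[OF c d] by (simp add: gx m1)
    then show False using m(2) by simp
  qed
  have bad: "ghost x Z = 0" if Z: "Z \<in> normal_pairs G" "Z \<notin> ?S" for Z
  proof (rule ccontr)
    assume "ghost x Z \<noteq> 0"
    then obtain g where g: "g \<in> carrier G" "fst Z \<subseteq> conj_set G g P" "snd Z \<subseteq> conj_set G g {\<one>}"
      using mark_nonzeroE[OF Z(1) PN] by (auto simp: gx conj_pair_def)
    have "snd Z = {\<one>}"
      using g subgroup.one_closed[OF normal_pairsD(2)[OF Z(1)]] by (auto simp: conj_set_trivial)
    moreover have "card (fst Z) dvd q ^ a"
      using subgroup_card_dvd[OF normal_pairsD(1)[OF Z(1)] subgroup_conj_set[OF g(1) P(1)] g(2)]
        card_conj_set[OF g(1) subgroup.subset[OF P(1)]] P(2) by simp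
    then have "\<exists>n. card (fst Z) = q ^ n" using divides_primepow_nat[OF q] by blast
    ultimately show False using Z by blast
  qed
  define V where "V = ghost x ` ?S"
  have fV: "finite V" using finite_normal_pairs by (simp add: V_def)
  obtain z where z: "z \<in> carrier burnside" "\<And>Z. Z \<in> normal_pairs G \<Longrightarrow> ghost z Z = (\<Prod>v\<in>V. v - ghost x Z)"
    using ghost_product[OF x fV] by blast
  define U where "U = \<Prod>V"
  let ?y = "frag_cmul U \<one>\<^bsub>burnside\<^esub> - z"
  have "?y \<in> carrier burnside" using burnside_one z by (intro burnside_diff burnside_cmul)
  moreover have "ghost ?y Z = U * of_bool (Z \<in> ?S)" if Z: "Z \<in> normal_pairs G" for Z
  proof (cases "Z \<in> ?S")
    case True
    then have "(\<Prod>v\<in>V. v - ghost x Z) = 0" using fV by (intro prod_zero) (auto simp: V_def)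
    then show ?thesis using True z(2)[OF Z] ghost_one[OF Z] by (simp add: ghost_simps)
  next
    case False
    then show ?thesis using z(2)[OF Z] ghost_one[OF Z] bad[OF Z False] by (simp add: ghost_simps U_def)
  qed
  moreover have "unit_at (enat q) U"
  proof -
    have "\<not> int q dvd v" if "v \<in> V" for v
    proof -
      obtain Z n where Z: "Z \<in> normal_pairs G" "snd Z = {\<one>}" "card (fst Z) = q ^ n" "v = ghost x Z"
        using \<open>v \<in> V\<close> unfolding V_def by blast
      then have "Z = (fst Z, {\<one>})" by (simp add: prod_eq_iff)
      then show ?thesis using good[OF normal_pairsD(1)[OF Z(1)] Z(3)] Z(4) by simp
    qed
    then show ?thesis using q fV by (simp add: unit_at_def U_def prime_dvd_prod_iff)
  qed
  ultimately show ?thesis unfolding supports_def by blast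
qed

lemma label_class_trivial: "Z \<in> label_class {\<one>} \<longleftrightarrow> Z \<in> normal_pairs G \<and> snd Z = {\<one>}"
  by (auto simp: label_class_def conj_set_trivial)

text \<open>
  The support contains $(1, 1)$ but not $(G, 1)$, so that the block of the trivial subgroup splits.
\<close>

lemma proper_support:
  assumes p: "p = \<infinity> \<or> (\<exists>q::nat. Factorial_Ring.prime q \<and> p = enat q)" and "\<not> is_p_group p G"
  obtains T where "T \<in> supports p" "T \<noteq> {}" "T \<subset> label_class {\<one>}"
proof -
  have tr: "({\<one>}, {\<one>}) \<in> normal_pairs G" and whole: "(carrier G, {\<one>}) \<in> label_class {\<one>}"
    using triv_subgroup subgroup_self by (simp_all add: trivial_pair_iff label_class_trivial)
  show thesis
  proof (cases p)
    case (enat q)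
    let ?S = "{Z \<in> normal_pairs G. snd Z = {\<one>} \<and> (\<exists>n. card (fst Z) = q ^ n)}"
    have "Factorial_Ring.prime q" using p enat by auto
    then have "?S \<in> supports p" unfolding enat by (rule p_subgroups_support)
    moreover have "({\<one>}, {\<one>}) \<in> ?S" using tr by (auto intro!: exI[of _ 0])
    moreover have "(carrier G, {\<one>}) \<notin> ?S" using assms(2) enat by (auto simp: is_p_group_def order_def)
    moreover have "?S \<subseteq> label_class {\<one>}" by (auto simp: label_class_trivial)
    ultimately show thesis using that[of ?S] whole by blast
  next
    case infinity
    let ?S = "{Z \<in> normal_pairs G. snd Z = {\<one>} \<and> solvable_seq G (fst Z)}"
    obtain x where "x \<in> carrier burnside"
      "\<And>Z. Z \<in> normal_pairs G \<Longrightarrow> ghost x Z = of_bool (snd Z = {\<one>} \<and> solvable_seq G (fst Z))"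
      using solvable_idempotent by blast
    then have "?S \<in> supports p"
      unfolding supports_def using unit_at_one[OF p] by (auto intro!: bexI[of _ x] exI[of _ 1])
    moreover have "({\<one>}, {\<one>}) \<in> ?S" using tr solvable_seq.unity by auto
    moreover have "(carrier G, {\<one>}) \<notin> ?S" using assms(2) infinity by (auto simp: is_p_group_def solvable_def)
    moreover have "?S \<subseteq> label_class {\<one>}" by (auto simp: label_class_trivial)
    ultimately show thesis using that[of ?S] whole by blast
  qed
qed

theorem card_atoms_supports_iff:
  assumes p: "p = \<infinity> \<or> (\<exists>q::nat. Factorial_Ring.prime q \<and> p = enat q)"
    and C: "full_nonconjugate_subgroups G C"
  shows "is_p_group p G \<longleftrightarrow> card (atoms (supports p)) = card C"
proof -
  have CG: "subgroup L G" if "L \<in> C" for L using C that by (simp add: full_nonconjugate_subgroups_def)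
  have Cu: "\<exists>!K. K \<in> C \<and> (\<exists>g\<in>carrier G. K = conj_set G g H)" if "subgroup H G" for H
    using C that by (simp add: full_nonconjugate_subgroups_def)
  have E: "label_class L \<in> supports p" "label_class L \<noteq> {}" if "L \<in> C" for L
  proof -
    show "label_class L \<in> supports p" using label_class_support[OF p] subgroup.subset[OF CG[OF that]] by blast
    have "(L, L) \<in> label_class L"
      using diagonal_normal[OF CG[OF that]] conj_set_one[OF subgroup.subset[OF CG[OF that]]]
      by (auto simp: label_class_def intro!: bexI[of _ \<one>])
    then show "label_class L \<noteq> {}" by blast
  qed
  have rep: "\<exists>g\<in>carrier G. L = conj_set G g (snd Z)" if "L \<in> C" "Z \<in> label_class L" for L Z
  proof -
    obtain a where a: "a \<in> carrier G" "snd Z = conj_set G a L"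
      using \<open>Z \<in> label_class L\<close> by (auto simp: label_class_def)
    then have "L = conj_set G (inv a) (snd Z)" using conj_set_cancel(2) subgroup.subset[OF CG[OF that(1)]] by simp
    then show ?thesis using a by blast
  qed
  have disj: "label_class K \<inter> label_class L = {}" if "K \<in> C" "L \<in> C" "K \<noteq> L" for K L
  proof -
    have False if Z: "Z \<in> label_class K" "Z \<in> label_class L" for Z
    proof -
      have "subgroup (snd Z) G" using Z normal_pairsD(2) by (auto simp: label_class_def)
      then show False using Cu[of "snd Z"] rep[OF \<open>K \<in> C\<close> Z(1)] rep[OF \<open>L \<in> C\<close> Z(2)] \<open>K \<in> C\<close> \<open>L \<in> C\<close> \<open>K \<noteq> L\<close> by blast
    qed
    then show ?thesis by blast
  qed
  have diff: "S - T \<in> supports p" if "S \<in> supports p" "T \<in> supports p" "T \<subseteq> S" for S T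
    using supports_diff[OF p that] .
  show ?thesis
  proof
    assume G: "is_p_group p G"
    show "card (atoms (supports p)) = card C"
    proof (rule card_atoms_eq[of C label_class])
      show "S \<subseteq> (\<Union>L\<in>C. label_class L)" if "S \<in> supports p" for S
      proof
        fix Z assume "Z \<in> S"
        then have Z: "Z \<in> normal_pairs G" using that by (auto simp: supports_def)
        note z = normal_pairsD[OF Z]
        obtain L g where L: "L \<in> C" "g \<in> carrier G" "L = conj_set G g (snd Z)" using Cu[OF z(2)] by blast
        then have "snd Z = conj_set G (inv g) L" using conj_set_cancel(2) z(6) by simp
        then have "Z \<in> label_class L" using Z L(2) unfolding label_class_def by blast
        then show "Z \<in> (\<Union>L\<in>C. label_class L)" using L(1) by blast
      qed
      show "label_class L \<subseteq> S" if S: "S \<in> supports p" and L: "L \<in> C" and ne: "S \<inter> label_class L \<noteq> {}" for S L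
      proof -
        have key: "Z \<in> S \<longleftrightarrow> (L, L) \<in> S" if Z: "Z \<in> label_class L" for Z
        proof -
          obtain a where a: "a \<in> carrier G" "snd Z = conj_set G a L" using Z by (auto simp: label_class_def)
          have ZN: "(fst Z, snd Z) \<in> normal_pairs G" using Z by (simp add: label_class_def)
          have "conj_pair G a (L, L) = (snd Z, snd Z)" using a by (simp add: conj_pair_def)
          then show ?thesis
            using supports_of_p_group[OF p G S ZN] supports_conj[OF S diagonal_normal[OF CG[OF L]] a(1)] by simp
        qed
        then show ?thesis using ne by blast
      qed
    qed (use E disj diff in auto)
  next
    assume eq: "card (atoms (supports p)) = card C"
    show "is_p_group p G"
    proof (rule ccontr)
      assume "\<not> is_p_group p G"
      then obtain T where T: "T \<in> supports p" "T \<noteq> {}" "T \<subset> label_class {\<one>}" using proper_support[OF p] by blast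
      have "{\<one>} \<in> C" using Cu[OF triv_subgroup] by (metis conj_set_trivial)
      moreover have "finite C" by (rule finite_subset[of _ "Pow (carrier G)"]) (use CG subgroup.subset fin in auto)
      ultimately have "card C < card (atoms (supports p))"
        using T E disj diff finite_normal_pairs
        by (intro card_atoms_gt[of C label_class _ "normal_pairs G" "{\<one>}" T]) (auto simp: supports_def)
      then show False using eq by simp
    qed
  qed
qed

lemma num_primitive_idempotents_infinity:
  "card (primitive_idempotents burnside) = card (atoms (supports \<infinity>))"
proof -
  have "card (primitive_idempotents burnside)
      = card (atoms {S. S \<subseteq> normal_pairs G \<and> (\<exists>x\<in>carrier burnside. \<forall>Z\<in>normal_pairs G. ghost x Z = of_bool (Z \<in> S))})"
  proof (rule card_primitive_idempotents)
    fix x y assume x: "x \<in> carrier burnside" and y: "y \<in> carrier burnside"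
      and eq: "\<And>Z. Z \<in> normal_pairs G \<Longrightarrow> ghost x Z = ghost y Z"
    have "x - y = 0" by (rule ghost_injective[OF burnside_diff[OF x y]]) (simp add: eq ghost_simps)
    then show "x = y" by simp
  qed (use burnside_mult_closed ghost_mult burnside_zero burnside_add in \<open>auto simp: burnside_simps(3,4) ghost_simps\<close>)
  then show ?thesis by (simp add: supports_def unit_at_def)
qed

end

section \<open>Integral monoid rings\<close>

text \<open>
  The additive extension of \<open>c\<close> to formal sums.
\<close>

definition frag_eval :: "('k \<Rightarrow> 'c::comm_ring_1) \<Rightarrow> ('k \<Rightarrow>\<^sub>0 int) \<Rightarrow> 'c" where
  "frag_eval c w = (\<Sum>k\<in>Poly_Mapping.keys w. of_int (Poly_Mapping.lookup w k) * c k)"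

lemma frag_eval_superset:
  assumes "finite S" "Poly_Mapping.keys w \<subseteq> S"
  shows "frag_eval c w = (\<Sum>k\<in>S. of_int (Poly_Mapping.lookup w k) * c k)"
  unfolding frag_eval_def using assms
  by (intro sum.mono_neutral_left) (auto simp: in_keys_iff)

lemma frag_eval_simps [simp]:
  "frag_eval c 0 = 0" "frag_eval c (frag_of k) = c k"
  "frag_eval c (v + w) = frag_eval c v + frag_eval c w"
  "frag_eval c (v - w) = frag_eval c v - frag_eval c w"
proof -
  let ?S = "Poly_Mapping.keys v \<union> Poly_Mapping.keys w"
  have S: "finite ?S" "Poly_Mapping.keys (v + w) \<subseteq> ?S" "Poly_Mapping.keys (v - w) \<subseteq> ?S"
    using keys_add[of v w] keys_diff[of v w] by auto
  note e = frag_eval_superset[OF S(1)]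
  show "frag_eval c (v + w) = frag_eval c v + frag_eval c w"
    using e[OF S(2), of c] e[of v c] e[of w c] by (simp add: lookup_add sum.distrib distrib_right)
  show "frag_eval c (v - w) = frag_eval c v - frag_eval c w"
    using e[OF S(3), of c] e[of v c] e[of w c] by (simp add: lookup_minus sum_subtractf left_diff_distrib)
qed (simp_all add: frag_eval_def keys_frag_of)

lemma integral_monoid_ring_simps:
  "w \<in> carrier (integral_monoid_ring M) \<longleftrightarrow> Poly_Mapping.keys w \<subseteq> carrier M"
  "v \<otimes>\<^bsub>integral_monoid_ring M\<^esub> w = bilinear_extend (\<lambda>a b. frag_of (a \<otimes>\<^bsub>M\<^esub> b)) v w"
  "v \<oplus>\<^bsub>integral_monoid_ring M\<^esub> w = v + w"
  "\<zero>\<^bsub>integral_monoid_ring M\<^esub> = 0" "\<one>\<^bsub>integral_monoid_ring M\<^esub> = frag_of \<one>\<^bsub>M\<^esub>"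
  by (simp_all add: integral_monoid_ring_def)

lemma ring_integral_monoid_ring:
  assumes "monoid M"
  shows "ring (integral_monoid_ring M)"
proof -
  interpret M: monoid M by fact
  let ?T = "integral_monoid_ring M"
  show ?thesis
  proof (rule ringI)
    show "abelian_group ?T"
    proof (rule abelian_groupI)
      show "x \<oplus>\<^bsub>?T\<^esub> y \<in> carrier ?T" if "x \<in> carrier ?T" "y \<in> carrier ?T" for x y
        using that keys_add[of x y] by (auto simp: integral_monoid_ring_simps)
      show "\<exists>y\<in>carrier ?T. y \<oplus>\<^bsub>?T\<^esub> x = \<zero>\<^bsub>?T\<^esub>" if "x \<in> carrier ?T" for x
        using that by (intro bexI[of _ "- x"]) (auto simp: integral_monoid_ring_simps)
    qed (auto simp: integral_monoid_ring_simps algebra_simps)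
    show "monoid ?T"
    proof (rule monoidI)
      show "x \<otimes>\<^bsub>?T\<^esub> y \<in> carrier ?T" if "x \<in> carrier ?T" "y \<in> carrier ?T" for x y
        using that unfolding integral_monoid_ring_simps
        by (intro keys_bilinear_extend) (auto simp: keys_frag_of)
      show "\<one>\<^bsub>?T\<^esub> \<in> carrier ?T" by (simp add: integral_monoid_ring_simps keys_frag_of)
      show "\<one>\<^bsub>?T\<^esub> \<otimes>\<^bsub>?T\<^esub> x = x" if "x \<in> carrier ?T" for x
        using that unfolding integral_monoid_ring_simps
        by (induction x rule: frag_induction) (simp_all add: bilinear_extend_simps)
      show "x \<otimes>\<^bsub>?T\<^esub> \<one>\<^bsub>?T\<^esub> = x" if "x \<in> carrier ?T" for x
        using that unfolding integral_monoid_ring_simps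
        by (induction x rule: frag_induction) (simp_all add: bilinear_extend_simps)
      let ?m = "bilinear_extend (\<lambda>a b. frag_of (a \<otimes>\<^bsub>M\<^esub> b))"
      show "x \<otimes>\<^bsub>?T\<^esub> y \<otimes>\<^bsub>?T\<^esub> z = x \<otimes>\<^bsub>?T\<^esub> (y \<otimes>\<^bsub>?T\<^esub> z)"
        if x: "x \<in> carrier ?T" and y: "y \<in> carrier ?T" and z: "z \<in> carrier ?T" for x y z
      proof -
        have "?m (?m x y) z = ?m x (?m y z)"
          using x unfolding integral_monoid_ring_simps(1)
        proof (induction x rule: frag_induction)
          case (one a)
          show ?case
            using y unfolding integral_monoid_ring_simps(1)
          proof (induction y rule: frag_induction)
            case (one b)
            show ?case
              using z unfolding integral_monoid_ring_simps(1)
              by (induction z rule: frag_induction)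
                (simp_all add: bilinear_extend_simps M.m_assoc \<open>a \<in> carrier M\<close> \<open>b \<in> carrier M\<close>)
          qed (simp_all add: bilinear_extend_simps)
        qed (simp_all add: bilinear_extend_simps)
        then show ?thesis by (simp add: integral_monoid_ring_simps)
      qed
    qed
  qed (simp_all add: integral_monoid_ring_simps bilinear_extend_add)
qed

section \<open>Localization at a prime\<close>

lemma tensor_relations_add_left:
  assumes "a \<in> carrier A" "a' \<in> carrier A" "b \<in> carrier B"
  shows "frag_of (a \<oplus>\<^bsub>A\<^esub> a', b) - frag_of (a, b) - frag_of (a', b) \<in> tensor_relations A B"
  unfolding tensor_relations_def by (rule UnI1, intro CollectI exI conjI, rule refl) (rule assms)+

lemma tensor_relations_add_right:
  assumes "a \<in> carrier A" "b \<in> carrier B" "b' \<in> carrier B"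
  shows "frag_of (a, b \<oplus>\<^bsub>B\<^esub> b') - frag_of (a, b) - frag_of (a, b') \<in> tensor_relations A B"
  unfolding tensor_relations_def by (rule UnI2, intro CollectI exI conjI, rule refl) (rule assms)+

text \<open>
  Functions that vanish outside \<open>I\<close> stand for functions on \<open>I\<close>, so that they are determined by their
  values there.
\<close>

definition function_ring :: "'i set \<Rightarrow> ('i \<Rightarrow> 'c::comm_ring_1) ring" where
  "function_ring I =
     \<lparr>carrier = {f. \<forall>i. i \<notin> I \<longrightarrow> f i = 0}, monoid.mult = (\<lambda>f g i. f i * g i),
      one = (\<lambda>i. of_bool (i \<in> I)), ring.zero = (\<lambda>i. 0), add = (\<lambda>f g i. f i + g i)\<rparr>"

lemma ring_function_ring: "ring (function_ring I)"
proof (rule ringI)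
  show "abelian_group (function_ring I)"
  proof (rule abelian_groupI)
    show "\<exists>y\<in>carrier (function_ring I). y \<oplus>\<^bsub>function_ring I\<^esub> x = \<zero>\<^bsub>function_ring I\<^esub>"
      if "x \<in> carrier (function_ring I)" for x
      using that by (intro bexI[of _ "\<lambda>i. - x i"]) (auto simp: function_ring_def)
  qed (auto simp: function_ring_def algebra_simps)
  show "monoid (function_ring I)"
    by (rule monoidI) (auto simp: function_ring_def algebra_simps)
qed (auto simp: function_ring_def algebra_simps)

lemma int_localized_carrier:
  "a \<in> carrier (int_localized q) \<longleftrightarrow> (\<exists>m b. a = of_int m / of_int b \<and> \<not> int q dvd b)"
  by (auto simp: int_localized_def)

lemma int_localized_closed:
  assumes "Factorial_Ring.prime q" "a \<in> carrier (int_localized q)" "b \<in> carrier (int_localized q)"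
  shows "a * b \<in> carrier (int_localized q)" "a + b \<in> carrier (int_localized q)" "of_int n * a \<in> carrier (int_localized q)"
proof -
  obtain k l m n' where e: "a = of_int k / of_int l" "b = of_int m / of_int n'" "\<not> int q dvd l" "\<not> int q dvd n'"
    using assms(2,3) by (auto simp: int_localized_carrier)
  have d: "\<not> int q dvd l * n'" using assms(1) e by (simp add: prime_dvd_mult_iff)
  have nz: "l \<noteq> 0" "n' \<noteq> 0" using e by auto
  have "a * b = of_int (k * m) / of_int (l * n')" using e by simp
  then show "a * b \<in> carrier (int_localized q)" unfolding int_localized_carrier using d by blast
  have "a + b = of_int (k * n' + m * l) / of_int (l * n')" using e nz by (simp add: field_simps)
  then show "a + b \<in> carrier (int_localized q)" unfolding int_localized_carrier using d by blast
  have "of_int n * a = of_int (n * k) / of_int l" using e by simp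
  then show "of_int n * a \<in> carrier (int_localized q)" unfolding int_localized_carrier using e by blast
qed

lemma int_localized_simps:
  "a \<otimes>\<^bsub>int_localized q\<^esub> b = a * b" "a \<oplus>\<^bsub>int_localized q\<^esub> b = a + b" "\<one>\<^bsub>int_localized q\<^esub> = 1"
  by (simp_all add: int_localized_def)

lemma int_localized_one: "Factorial_Ring.prime q \<Longrightarrow> 1 \<in> carrier (int_localized q)"
  unfolding int_localized_carrier by (intro exI[of _ 1]) (use not_prime_1 in auto)

lemma monoid_int_localized: "Factorial_Ring.prime q \<Longrightarrow> monoid (int_localized q)"
  by (rule monoidI) (simp_all add: int_localized_simps int_localized_closed int_localized_one)

context finite_group begin

lemma monoid_burnside: "monoid burnside"
proof (rule monoidI)
  have eqI: "x = y" if "x \<in> carrier burnside" "y \<in> carrier burnside"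
    "\<And>Z. Z \<in> normal_pairs G \<Longrightarrow> ghost x Z = ghost y Z" for x y
    using ghost_injective[OF burnside_diff[OF that(1,2)]] that(3) by (simp add: ghost_simps)
  show "x \<otimes>\<^bsub>burnside\<^esub> y \<otimes>\<^bsub>burnside\<^esub> z = x \<otimes>\<^bsub>burnside\<^esub> (y \<otimes>\<^bsub>burnside\<^esub> z)"
    if "x \<in> carrier burnside" "y \<in> carrier burnside" "z \<in> carrier burnside" for x y z
    using that by (intro eqI) (simp_all add: burnside_mult_closed ghost_mult)
  show "\<one>\<^bsub>burnside\<^esub> \<otimes>\<^bsub>burnside\<^esub> x = x" "x \<otimes>\<^bsub>burnside\<^esub> \<one>\<^bsub>burnside\<^esub> = x" if "x \<in> carrier burnside" for x
    using that by (auto intro!: eqI simp: burnside_mult_closed ghost_mult burnside_one ghost_one)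
qed (simp_all add: burnside_mult_closed burnside_one)

text \<open>
  On pure tensors this is $a \otimes x \mapsto a\,\varphi(x)$, here defined on the formal sums of
  which the tensor product is a quotient.
\<close>

definition local_ghost :: "(rat \<times> (('a set \<times> 'a set) set \<Rightarrow>\<^sub>0 int) \<Rightarrow>\<^sub>0 int) \<Rightarrow> 'a set \<times> 'a set \<Rightarrow> rat" where
  "local_ghost w Z = (if Z \<in> normal_pairs G then frag_eval (\<lambda>(a, x). a * of_int (ghost x Z)) w else 0)"

context
  fixes q :: nat
  assumes q: "Factorial_Ring.prime q"
begin

abbreviation "loc \<equiv> int_localized q"
abbreviation "pairs_ring \<equiv> integral_monoid_ring (loc \<times>\<times> burnside)"
abbreviation "relations_ideal \<equiv> Idl\<^bsub>pairs_ring\<^esub> (tensor_relations loc burnside)"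

lemma ring_pairs_ring: "ring pairs_ring"
  using ring_integral_monoid_ring DirProd_monoid monoid_int_localized[OF q] monoid_burnside by blast

lemma pairs_ring_simps:
  "w \<in> carrier pairs_ring \<longleftrightarrow> Poly_Mapping.keys w \<subseteq> carrier loc \<times> carrier burnside"
  "frag_of (a, x) \<in> carrier pairs_ring \<longleftrightarrow> a \<in> carrier loc \<and> x \<in> carrier burnside"
  by (simp_all add: integral_monoid_ring_simps keys_frag_of)

lemma pairs_ring_diff:
  "v \<in> carrier pairs_ring \<Longrightarrow> w \<in> carrier pairs_ring \<Longrightarrow> v - w \<in> carrier pairs_ring"
  using keys_diff[of v w] by (auto simp: pairs_ring_simps)

lemma local_ghost_hom: "ring_hom_ring pairs_ring (function_ring (normal_pairs G)) local_ghost"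
proof (rule ring_hom_ringI[OF ring_pairs_ring ring_function_ring])
  show "local_ghost x \<in> carrier (function_ring (normal_pairs G))" for x
    by (simp add: local_ghost_def function_ring_def)
  show "local_ghost (x \<oplus>\<^bsub>pairs_ring\<^esub> y) = local_ghost x \<oplus>\<^bsub>function_ring (normal_pairs G)\<^esub> local_ghost y" for x y
    by (auto simp: local_ghost_def function_ring_def integral_monoid_ring_simps)
  show "local_ghost \<one>\<^bsub>pairs_ring\<^esub> = \<one>\<^bsub>function_ring (normal_pairs G)\<^esub>"
    by (auto simp: local_ghost_def function_ring_def integral_monoid_ring_simps int_localized_simps ghost_one)
  show "local_ghost (x \<otimes>\<^bsub>pairs_ring\<^esub> y) = local_ghost x \<otimes>\<^bsub>function_ring (normal_pairs G)\<^esub> local_ghost y"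
    if x: "x \<in> carrier pairs_ring" and y: "y \<in> carrier pairs_ring" for x y
  proof -
    let ?m = "bilinear_extend (\<lambda>a b. frag_of (a \<otimes>\<^bsub>loc \<times>\<times> burnside\<^esub> b))"
    have "frag_eval (\<lambda>(a, x). a * of_int (ghost x Z)) (?m x y)
        = frag_eval (\<lambda>(a, x). a * of_int (ghost x Z)) x * frag_eval (\<lambda>(a, x). a * of_int (ghost x Z)) y"
      if Z: "Z \<in> normal_pairs G" for Z
      using x unfolding pairs_ring_simps(1)
    proof (induction x rule: frag_induction)
      case (one k)
      obtain a u where k: "k = (a, u)" "u \<in> carrier burnside" using one by auto
      show ?case
        using y unfolding pairs_ring_simps(1)
      proof (induction y rule: frag_induction)
        case (one l)
        obtain b v where l: "l = (b, v)" "v \<in> carrier burnside" using one by auto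
        show ?case
          using k l by (simp add: bilinear_extend_simps int_localized_simps ghost_mult[OF _ _ Z])
      qed (simp_all add: bilinear_extend_simps algebra_simps)
    qed (simp_all add: bilinear_extend_simps algebra_simps)
    then show ?thesis by (auto simp: local_ghost_def function_ring_def integral_monoid_ring_simps(2))
  qed
qed

lemma tensor_relations_closed: "tensor_relations loc burnside \<subseteq> carrier pairs_ring"
proof
  fix w assume "w \<in> tensor_relations loc burnside"
  then show "w \<in> carrier pairs_ring"
    unfolding tensor_relations_def
    by (auto intro!: pairs_ring_diff int_localized_closed[OF q] burnside_add
        simp: pairs_ring_simps(2) int_localized_simps burnside_simps(3))
qed

lemma relations_ideal_subset_kernel:
  "relations_ideal \<subseteq> a_kernel pairs_ring (function_ring (normal_pairs G)) local_ghost"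
proof (rule ring.genideal_minimal[OF ring_pairs_ring])
  show "ideal (a_kernel pairs_ring (function_ring (normal_pairs G)) local_ghost) pairs_ring"
    by (rule ring_hom_ring.kernel_is_ideal[OF local_ghost_hom])
  have "local_ghost w = (\<lambda>_. 0)" if "w \<in> tensor_relations loc burnside" for w
    using that unfolding tensor_relations_def
    by (auto simp: local_ghost_def int_localized_simps burnside_simps(3) ghost_simps ring_distribs fun_eq_iff)
  then show "tensor_relations loc burnside \<subseteq> a_kernel pairs_ring (function_ring (normal_pairs G)) local_ghost"
    using tensor_relations_closed by (auto simp: a_kernel_def' function_ring_def)
qed

lemma relations_ideal: "ideal relations_ideal pairs_ring"
  by (rule ring.genideal_ideal[OF ring_pairs_ring tensor_relations_closed])

lemma relations_ideal_closed:
  "0 \<in> relations_ideal"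
  "v \<in> relations_ideal \<Longrightarrow> w \<in> relations_ideal \<Longrightarrow> v + w \<in> relations_ideal"
  "v \<in> relations_ideal \<Longrightarrow> - v \<in> relations_ideal"
  "v \<in> relations_ideal \<Longrightarrow> w \<in> relations_ideal \<Longrightarrow> v - w \<in> relations_ideal"
proof -
  interpret I: ideal relations_ideal pairs_ring by (rule relations_ideal)
  show z: "0 \<in> relations_ideal" using additive_subgroup.zero_closed[OF I.additive_subgroup_axioms]
    unfolding integral_monoid_ring_simps .
  show a: "v + w \<in> relations_ideal" if "v \<in> relations_ideal" "w \<in> relations_ideal" for v w
    using additive_subgroup.a_closed[OF I.additive_subgroup_axioms that] by (simp add: integral_monoid_ring_simps)
  show m: "- v \<in> relations_ideal" if v: "v \<in> relations_ideal" for v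
  proof -
    have vc: "v \<in> carrier pairs_ring" using v by (rule I.a_Hcarr)
    then have "- v \<in> carrier pairs_ring" by (simp add: pairs_ring_simps)
    then have "\<ominus>\<^bsub>pairs_ring\<^esub> v = - v"
      using abelian_group.minus_equality[OF ring.is_abelian_group[OF ring_pairs_ring], of "- v" v] vc
      by (simp add: integral_monoid_ring_simps(3,4))
    then show ?thesis using additive_subgroup.a_inv_closed[OF I.additive_subgroup_axioms v] by simp
  qed
  show "v - w \<in> relations_ideal" if "v \<in> relations_ideal" "w \<in> relations_ideal" for v w
    using a[OF that(1) m[OF that(2)]] by simp
qed

lemma tensor_bilinear:
  "a \<in> carrier loc \<Longrightarrow> a' \<in> carrier loc \<Longrightarrow> x \<in> carrier burnside \<Longrightarrow>
     frag_of (a + a', x) - frag_of (a, x) - frag_of (a', x) \<in> relations_ideal"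
  "a \<in> carrier loc \<Longrightarrow> x \<in> carrier burnside \<Longrightarrow> x' \<in> carrier burnside \<Longrightarrow>
     frag_of (a, x + x') - frag_of (a, x) - frag_of (a, x') \<in> relations_ideal"
proof -
  have sub: "tensor_relations loc burnside \<subseteq> relations_ideal"
    by (rule ring.genideal_self[OF ring_pairs_ring tensor_relations_closed])
  show "frag_of (a + a', x) - frag_of (a, x) - frag_of (a', x) \<in> relations_ideal"
    if "a \<in> carrier loc" "a' \<in> carrier loc" "x \<in> carrier burnside"
    using subsetD[OF sub tensor_relations_add_left[OF that]] by (simp add: int_localized_simps)
  show "frag_of (a, x + x') - frag_of (a, x) - frag_of (a, x') \<in> relations_ideal"
    if "a \<in> carrier loc" "x \<in> carrier burnside" "x' \<in> carrier burnside"
    using subsetD[OF sub tensor_relations_add_right[OF that]] by (simp add: burnside_simps(3))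
qed

lemma tensor_zero:
  assumes "a \<in> carrier loc"
  shows "frag_of (a, 0) \<in> relations_ideal"
  using relations_ideal_closed(3)[OF tensor_bilinear(2)[OF assms burnside_zero burnside_zero]] by simp

text \<open>
  Integers may be moved across the tensor sign, as the difference of the two sides is additive in $n$.
\<close>

lemma tensor_scalar:
  assumes a: "a \<in> carrier loc" and x: "x \<in> carrier burnside"
  shows "frag_of (of_int n * a, x) - frag_of (a, frag_cmul n x) \<in> relations_ideal"
proof (induction n rule: int_induct[where k = 0])
  case base
  have za: "of_int 0 * a \<in> carrier loc" using int_localized_closed(3)[OF q a a] .
  have "frag_of (0, x) \<in> relations_ideal"
    using relations_ideal_closed(3)[OF tensor_bilinear(1)[OF za za x]] by simp
  then show ?case using relations_ideal_closed(4)[OF _ tensor_zero[OF a]] by simp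
next
  let ?f = "\<lambda>n. frag_of (of_int n * a, x) - frag_of (a, frag_cmul n x)"
  have step: "?f (n + 1) - ?f n \<in> relations_ideal" for n
  proof -
    have "frag_of (of_int n * a + a, x) - frag_of (of_int n * a, x) - frag_of (a, x) \<in> relations_ideal"
      using tensor_bilinear(1)[OF int_localized_closed(3)[OF q a a] a x] .
    moreover have "frag_of (a, frag_cmul n x + x) - frag_of (a, frag_cmul n x) - frag_of (a, x) \<in> relations_ideal"
      using tensor_bilinear(2)[OF a burnside_cmul[OF x] x] .
    ultimately have "(frag_of (of_int n * a + a, x) - frag_of (of_int n * a, x) - frag_of (a, x))
        - (frag_of (a, frag_cmul n x + x) - frag_of (a, frag_cmul n x) - frag_of (a, x)) \<in> relations_ideal"
      by (rule relations_ideal_closed(4))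
    then show ?thesis by (simp add: algebra_simps frag_cmul_distrib)
  qed
  show "?f (i + 1) \<in> relations_ideal" if "?f i \<in> relations_ideal" for i
    using relations_ideal_closed(2)[OF step[of i] that] by simp
  show "?f (i - 1) \<in> relations_ideal" if "?f i \<in> relations_ideal" for i
    using relations_ideal_closed(4)[OF that step[of "i - 1"]] by simp
qed

lemma inverse_in_loc: "\<not> int q dvd b \<Longrightarrow> 1 / of_int b \<in> carrier loc"
  unfolding int_localized_carrier by (intro exI[of _ 1] exI[of _ b]) simp

text \<open>
  Every element of $\mathbb Z_{(p)} \otimes R$ is a pure tensor $b^{-1} \otimes x$ with $p \nmid b$.
\<close>

lemma tensor_common_denominator:
  assumes "w \<in> carrier pairs_ring"
  shows "\<exists>b x. \<not> int q dvd b \<and> x \<in> carrier burnside \<and> w - frag_of (1 / of_int b, x) \<in> relations_ideal"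
  using assms unfolding pairs_ring_simps(1)
proof (induction w rule: frag_induction)
  case zero
  have "\<not> int q dvd 1" using q not_prime_1 by auto
  then show ?case
    using relations_ideal_closed(3)[OF tensor_zero[OF inverse_in_loc[of 1]]] burnside_zero
    by (intro exI[of _ 1] exI[of _ 0]) simp
next
  case (one k)
  then obtain m b x where k: "k = (of_int m / of_int b, x)" "\<not> int q dvd b" "x \<in> carrier burnside"
    by (auto simp: int_localized_carrier)
  have "frag_of (of_int m * (1 / of_int b), x) - frag_of (1 / of_int b, frag_cmul m x) \<in> relations_ideal"
    by (rule tensor_scalar[OF inverse_in_loc[OF k(2)] k(3)])
  then show ?case using k burnside_cmul by auto
next
  case (diff v w)
  obtain b x where x: "\<not> int q dvd b" "x \<in> carrier burnside" "v - frag_of (1 / of_int b, x) \<in> relations_ideal"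
    using diff by blast
  obtain c y where y: "\<not> int q dvd c" "y \<in> carrier burnside" "w - frag_of (1 / of_int c, y) \<in> relations_ideal"
    using diff by blast
  let ?d = "1 / of_int (b * c) :: rat"
  let ?x = "frag_cmul c x" and ?y = "frag_cmul b y"
  have bc: "\<not> int q dvd b * c" using q x y by (simp add: prime_dvd_mult_iff)
  have nz: "b \<noteq> 0" "c \<noteq> 0" using x y by auto
  have d: "?d \<in> carrier loc" by (rule inverse_in_loc[OF bc])
  have cx: "?x \<in> carrier burnside" "?y \<in> carrier burnside" using x y burnside_cmul by auto
  have 1: "frag_of (1 / of_int b, x) - frag_of (?d, ?x) \<in> relations_ideal"
    using tensor_scalar[OF d x(2), of c] nz by simp
  have 2: "frag_of (1 / of_int c, y) - frag_of (?d, ?y) \<in> relations_ideal"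
    using tensor_scalar[OF d y(2), of b] nz by simp
  have 3: "frag_of (?d, ?x) - frag_of (?d, ?x - ?y) - frag_of (?d, ?y) \<in> relations_ideal"
    using tensor_bilinear(2)[OF d burnside_diff[OF cx] cx(2)] by simp
  have "((v - frag_of (1 / of_int b, x)) + (frag_of (1 / of_int b, x) - frag_of (?d, ?x)))
      - ((w - frag_of (1 / of_int c, y)) + (frag_of (1 / of_int c, y) - frag_of (?d, ?y)))
      + (frag_of (?d, ?x) - frag_of (?d, ?x - ?y) - frag_of (?d, ?y)) \<in> relations_ideal"
    by (intro relations_ideal_closed(2) relations_ideal_closed(4) x(3) y(3) 1 2 3)
  then have "v - w - frag_of (?d, ?x - ?y) \<in> relations_ideal" by (simp add: algebra_simps)
  then show ?case using bc burnside_diff[OF cx] by blast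
qed

lemma local_ghost_of_ideal:
  assumes "w \<in> carrier pairs_ring" "v \<in> carrier pairs_ring" "w - v \<in> relations_ideal"
  shows "local_ghost w = local_ghost v"
proof -
  have "local_ghost (w - v) = (\<lambda>_. 0)"
    using relations_ideal_subset_kernel assms(3) by (auto simp: a_kernel_def' function_ring_def)
  then show ?thesis by (auto simp: local_ghost_def fun_eq_iff split: if_splits)
qed

text \<open>
  Modulo the relations every formal sum is of the form $b^{-1} \otimes x$, and this is sent to zero
  only if all marks of $x$ vanish, that is, for $x = 0$.
\<close>

lemma relations_ideal_eq_kernel:
  "relations_ideal = a_kernel pairs_ring (function_ring (normal_pairs G)) local_ghost"
proof (rule equalityI[OF relations_ideal_subset_kernel], rule subsetI)
  fix w assume "w \<in> a_kernel pairs_ring (function_ring (normal_pairs G)) local_ghost"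
  then have w: "w \<in> carrier pairs_ring" "local_ghost w = (\<lambda>_. 0)" by (auto simp: a_kernel_def' function_ring_def)
  obtain b x where x: "\<not> int q dvd b" "x \<in> carrier burnside" "w - frag_of (1 / of_int b, x) \<in> relations_ideal"
    using tensor_common_denominator[OF w(1)] by blast
  have "b \<noteq> 0" using x by auto
  have f: "frag_of (1 / of_int b, x) \<in> carrier pairs_ring" using x inverse_in_loc by (simp add: pairs_ring_simps)
  have l: "local_ghost (frag_of (1 / of_int b, x)) = (\<lambda>_. 0)" using local_ghost_of_ideal[OF w(1) f x(3)] w(2) by simp
  have "ghost x Z = 0" if Z: "Z \<in> normal_pairs G" for Z
    using fun_cong[OF l, of Z] Z \<open>b \<noteq> 0\<close> by (simp add: local_ghost_def)
  then have "x = 0" using ghost_injective x(2) by blast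
  then have "frag_of (1 / of_int b, x) \<in> relations_ideal" using tensor_zero inverse_in_loc[OF x(1)] by simp
  then show "w \<in> relations_ideal" using relations_ideal_closed(2)[OF x(3), of "frag_of (1 / of_int b, x)"] by simp
qed

text \<open>
  By \<open>relations_ideal_eq_kernel\<close> the localized ring is isomorphic to the image of \<open>local_ghost\<close>, whose
  elements are the functions $b^{-1}\varphi(x)$.
\<close>

lemma num_primitive_idempotents_prime:
  "card (primitive_idempotents (tensor_ring loc burnside)) = card (atoms (supports (enat q)))"
proof -
  let ?F = "function_ring (normal_pairs G) :: ('a set \<times> 'a set \<Rightarrow> rat) ring"
  let ?Q = "tensor_ring loc burnside"
  interpret h: ring_hom_ring pairs_ring ?F local_ghost by (rule local_ghost_hom)
  have Q: "?Q = pairs_ring Quot (a_kernel pairs_ring ?F local_ghost)"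
    unfolding tensor_ring_def relations_ideal_eq_kernel ..
  interpret Q: ring ?Q unfolding Q by (rule ideal.quotient_is_ring[OF h.kernel_is_ideal])
  let ?\<Theta> = "\<lambda>A. the_elem (local_ghost ` A)"
  have hom: "?\<Theta> \<in> ring_hom ?Q ?F" unfolding Q by (rule h.the_elem_hom)
  have img: "?\<Theta> ` carrier ?Q = local_ghost ` carrier pairs_ring" unfolding Q by (rule h.the_elem_surj)
  have out: "?\<Theta> A Z = 0" if "A \<in> carrier ?Q" "Z \<notin> normal_pairs G" for A Z
    using ring_hom_closed[OF hom that(1)] that(2) by (cases Z) (simp add: function_ring_def)
  have "card (primitive_idempotents ?Q)
      = card (atoms {S. S \<subseteq> normal_pairs G \<and> (\<exists>A\<in>carrier ?Q. \<forall>Z\<in>normal_pairs G. ?\<Theta> A Z = of_bool (Z \<in> S))})"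
  proof (rule card_primitive_idempotents)
    fix A B assume A: "A \<in> carrier ?Q" and B: "B \<in> carrier ?Q"
      and eq: "\<And>Z. Z \<in> normal_pairs G \<Longrightarrow> ?\<Theta> A Z = ?\<Theta> B Z"
    have "?\<Theta> A = ?\<Theta> B" using eq out A B by (metis ext)
    then show "A = B" using A B h.the_elem_inj unfolding Q by blast
  next
    show "\<zero>\<^bsub>?Q\<^esub> \<in> carrier ?Q" by (rule Q.zero_closed)
    have "?\<Theta> \<zero>\<^bsub>?Q\<^esub> = \<zero>\<^bsub>?F\<^esub>" by (rule ring_hom_zero[OF hom Q.ring_axioms ring_function_ring])
    then show "?\<Theta> \<zero>\<^bsub>?Q\<^esub> Z = 0" for Z by (simp add: function_ring_def)
  qed (use ring_hom_mult[OF hom] ring_hom_add[OF hom] in \<open>simp_all add: function_ring_def\<close>)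
  also have "{S. S \<subseteq> normal_pairs G \<and> (\<exists>A\<in>carrier ?Q. \<forall>Z\<in>normal_pairs G. ?\<Theta> A Z = of_bool (Z \<in> S))}
      = supports (enat q)"
  proof (intro equalityI subsetI)
    fix S assume "S \<in> {S. S \<subseteq> normal_pairs G \<and> (\<exists>A\<in>carrier ?Q. \<forall>Z\<in>normal_pairs G. ?\<Theta> A Z = of_bool (Z \<in> S))}"
    then obtain A where S: "S \<subseteq> normal_pairs G" and A: "A \<in> carrier ?Q"
      "\<And>Z. Z \<in> normal_pairs G \<Longrightarrow> ?\<Theta> A Z = of_bool (Z \<in> S)" by auto
    obtain w where w: "w \<in> carrier pairs_ring" "?\<Theta> A = local_ghost w" using img A(1) by blast
    obtain b x where x: "\<not> int q dvd b" "x \<in> carrier burnside" "w - frag_of (1 / of_int b, x) \<in> relations_ideal"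
      using tensor_common_denominator[OF w(1)] by blast
    have f: "frag_of (1 / of_int b, x) \<in> carrier pairs_ring" using x inverse_in_loc by (simp add: pairs_ring_simps)
    have b: "b \<noteq> 0" using x by auto
    have "ghost x Z = b * of_bool (Z \<in> S)" if Z: "Z \<in> normal_pairs G" for Z
    proof -
      have "of_bool (Z \<in> S) = local_ghost (frag_of (1 / of_int b, x)) Z"
        using A(2)[OF Z] w(2) local_ghost_of_ideal[OF w(1) f x(3)] by simp
      then have "of_int (ghost x Z) = (of_int (b * of_bool (Z \<in> S)) :: rat)"
        using Z b by (simp add: local_ghost_def field_simps)
      then show ?thesis by (simp only: of_int_eq_iff)
    qed
    moreover have "unit_at (enat q) b" using x(1) by (simp add: unit_at_def)
    ultimately show "S \<in> supports (enat q)" using S x(2) unfolding supports_def by blast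
  next
    fix S assume "S \<in> supports (enat q)"
    then obtain x b where S: "S \<subseteq> normal_pairs G" and x: "x \<in> carrier burnside" "\<not> int q dvd b"
      "\<And>Z. Z \<in> normal_pairs G \<Longrightarrow> ghost x Z = b * of_bool (Z \<in> S)" by (auto simp: supports_def unit_at_def)
    have b: "b \<noteq> 0" using x by auto
    have f: "frag_of (1 / of_int b, x) \<in> carrier pairs_ring" using x inverse_in_loc by (simp add: pairs_ring_simps)
    have "local_ghost (frag_of (1 / of_int b, x)) \<in> ?\<Theta> ` carrier ?Q" unfolding img using f by (rule imageI)
    then obtain A where A: "A \<in> carrier ?Q" "?\<Theta> A = local_ghost (frag_of (1 / of_int b, x))"
      by (rule imageE) (rule that, assumption, erule sym)
    have "?\<Theta> A Z = of_bool (Z \<in> S)" if "Z \<in> normal_pairs G" for Z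
      using A(2) that x(3)[OF that] b by (simp add: local_ghost_def)
    then show "S \<in> {S. S \<subseteq> normal_pairs G \<and> (\<exists>A\<in>carrier ?Q. \<forall>Z\<in>normal_pairs G. ?\<Theta> A Z = of_bool (Z \<in> S))}"
      using S A(1) by blast
  qed
  finally show ?thesis .
qed

end

end

theorem theorem6p6:
  fixes G :: "('a, 'b) monoid_scheme" and p :: enat and C :: "'a set set"
  assumes "group G" and "finite (carrier G)"
    and "p = \<infinity> \<or> (\<exists>q::nat. Factorial_Ring.prime q \<and> p = enat q)"
    and "full_nonconjugate_subgroups G C"
  shows "is_p_group p G \<longleftrightarrow>
    num_primitive_idempotents_at p (lattice_burnside_ring G) = card C"
proof -
  interpret finite_group G using assms(1,2) by (simp add: finite_group_def finite_group_axioms_def)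
  have "num_primitive_idempotents_at p (lattice_burnside_ring G) = card (atoms (supports p))"
    using assms(3) num_primitive_idempotents_infinity num_primitive_idempotents_prime
    by (auto simp: num_primitive_idempotents_at_def)
  then show ?thesis using card_atoms_supports_iff[OF assms(3,4)] by simp
qed

end
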